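(* For every $\mathcal{V}\text{-}\mathsf{Cat}_{\mathsf{sep}}$-enriched autonomous category $\mathcal{C}$ there is a $\mathcal{V}\text{-}\mathsf{Cat}_{\mathsf{sep}}$-enriched equivalence of categories $\mathrm{Syn}(\mathrm{Lang}(\mathcal{C}))\simeq\mathcal{C}$.
   Context: Standing assumptions on $\mathcal{V}$: commutative unital quantale (complete lattice, commutative associative $\otimes$ distributing over joins, unit $k$), integral ($k=\top$), underlying lattice continuous (every $x$ equals $\bigvee\{y\mid y\ll x\}$, with $y\ll x$ meaning: whenever $x\le\bigvee X$ some finite $A\subseteq X$ has $y\le\bigvee A$), with a fixed basis $B$ (for each $x$, $B\cap\{y\mid y\ll x\}$ is directed with join $x$) closed under finite joins and $\otimes$ and containing $k$. $\mathcal{V}$-categories $(X,a)$: $k\le a(x,x)$, $a(x,y)\otimes a(y,z)\le a(x,z)$; separated if $k\le a(x,y),a(y,x)$ imply $x=y$; $\mathcal{V}$-functors: $a(x,y)\le b(fx,fy)$. A $\mathcal{V}\text{-}\mathsf{Cat}_{\mathsf{sep}}$-enriched autonomous category: symmetric monoidal closed category whose hom-sets are small separated $\mathcal{V}$-categories, with composition and the action of $\otimes$ on homs being $\mathcal{V}$-functors (pointwise tensor of $\mathcal{V}$-categories), and $-\otimes X\dashv X\multimap-$ an enriched adjunction (functors act by $\mathcal{V}$-functors on homs, currying bijections are $\mathcal{V}$-isomorphisms). A $\mathcal{V}\text{-}\mathsf{Cat}_{\mathsf{sep}}$-equivalence is an equivalence of categories whose functors act by $\mathcal{V}$-functors on homs.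 Linear $\mathcal{V}\lambda$-theories: over ground types $G$ and operation symbols $\Sigma$ ($f:A_1,\dots,A_n\to A$, $n\ge1$), linear $\lambda$-terms with types $X\in G$, $I$, $A\otimes B$, $A\multimap B$ and constructors $f(\vec v)$, variables, $\ast$, $v\ \mathtt{to}\ \ast.\,w$, $v\otimes w$, $\mathtt{pm}\ v\ \mathtt{to}\ x\otimes y.\,w$, $\lambda x.\,v$, $v\,w$; axioms are $\mathcal{V}$-equations-in-context $\Gamma\rhd v=_q w:A$ with $q\in B$; theorems are derived from axioms and the $\beta\eta$/commuting-conversion equations (an equation $v=w$ meaning $v=_\top w$ and $w=_\top v$) by reflexivity ($v=_\top v$), transitivity ($q\otimes r$), weakening of labels, the Archimedean rule (if $v=_r w$ for all $r\ll q$ then $v=_q w$), finite joins, compatibility of constructors and substitution (labels combined by $\otimes$; $\lambda$ preserves labels), and context permutation. $\mathrm{Syn}(T)$: objects are types; the hom-object from $A$ to $B$ is the separated quotient of the $\mathcal{V}$-category of terms $x:A\rhd v:B$ with $a(v,w)=\bigvee\{q\mid v=_q w$ is a theorem$\}$ (identify $v,w$ when $a(v,w),a(w,v)\ge k$); composition is substitution. $\mathrm{Lang}(\mathcal{C})$: ground types = objects of $\mathcal{C}$; operation symbols = all morphisms of $\mathcal{C}$ plus, for each type $A$, isomorphisms between $A$ and $i(A)$, where $i(I)=\hat I$, $i(X)=X$, $i(A\otimes B)=i(A)\hat\otimes i(B)$, $i(A\multimap B)=i(A)\hat\multimap i(B)$ (hats = structure of $\mathcal{C}$); axioms = all $\mathcal{V}$-equations-in-context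 satisfied ($a(\llbracket v\rrbracket,\llbracket w\rrbracket)\ge q$) by the obvious interpretation in $\mathcal{C}$. *)

theory Defs
  imports "HOL-Library.Multiset" "HOL-Library.FuncSet"
begin

section \<open>Quantales\<close>

definition (in complete_lattice) way_below :: "'a \<Rightarrow> 'a \<Rightarrow> bool" (infix "\<lless>" 50) where
  "y \<lless> x \<longleftrightarrow> (\<forall>X. x \<le> Sup X \<longrightarrow> (\<exists>A. finite A \<and> A \<subseteq> X \<and> y \<le> Sup A))"

text \<open>Commutative unital quantales that are integral and whose underlying lattice is continuous;
  \<^term>\<open>x * y\<close> is the tensor and \<^term>\<open>1\<close> the unit \<open>k\<close>.\<close>

class continuous_quantale = complete_lattice + comm_monoid_mult +
  assumes mult_Sup: "x * Sup Y = Sup ((\<lambda>y. x * y) ` Y)"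
    and one_eq_top: "1 = top"
    and continuous: "x = Sup {y. y \<lless> x}"

definition directed :: "'v::order set \<Rightarrow> bool" where
  "directed D \<longleftrightarrow> D \<noteq> {} \<and> (\<forall>x\<in>D. \<forall>y\<in>D. \<exists>z\<in>D. x \<le> z \<and> y \<le> z)"

definition quantale_basis :: "'v::continuous_quantale set \<Rightarrow> bool" where
  "quantale_basis B \<longleftrightarrow>
    (\<forall>x. directed (B \<inter> {y. y \<lless> x}) \<and> Sup (B \<inter> {y. y \<lless> x}) = x) \<and>
    (\<forall>Q. finite Q \<and> Q \<subseteq> B \<longrightarrow> Sup Q \<in> B) \<and>
    (\<forall>q\<in>B. \<forall>r\<in>B. q * r \<in> B) \<and>
    1 \<in> B"

section \<open>Categories enriched over quantale-valued categories\<close>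

definition vcategory :: "'a set \<Rightarrow> ('a \<Rightarrow> 'a \<Rightarrow> 'v::continuous_quantale) \<Rightarrow> bool" where
  "vcategory X a \<longleftrightarrow> (\<forall>x\<in>X. 1 \<le> a x x) \<and>
    (\<forall>x\<in>X. \<forall>y\<in>X. \<forall>z\<in>X. a x y * a y z \<le> a x z)"

definition separated :: "'a set \<Rightarrow> ('a \<Rightarrow> 'a \<Rightarrow> 'v::continuous_quantale) \<Rightarrow> bool" where
  "separated X a \<longleftrightarrow> (\<forall>x\<in>X. \<forall>y\<in>X. 1 \<le> a x y \<and> 1 \<le> a y x \<longrightarrow> x = y)"

definition vfunctor :: "'a set \<Rightarrow> ('a \<Rightarrow> 'a \<Rightarrow> 'v::continuous_quantale) \<Rightarrow>
    'b set \<Rightarrow> ('b \<Rightarrow> 'b \<Rightarrow> 'v) \<Rightarrow> ('a \<Rightarrow> 'b) \<Rightarrow> bool" where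
  "vfunctor X a Y b f \<longleftrightarrow> f \<in> X \<rightarrow> Y \<and> (\<forall>x\<in>X. \<forall>x'\<in>X. a x x' \<le> b (f x) (f x'))"

definition vtensor :: "('a \<Rightarrow> 'a \<Rightarrow> 'v::continuous_quantale) \<Rightarrow> ('b \<Rightarrow> 'b \<Rightarrow> 'v) \<Rightarrow>
    'a \<times> 'b \<Rightarrow> 'a \<times> 'b \<Rightarrow> 'v" where
  "vtensor a b p p' = a (fst p) (fst p') * b (snd p) (snd p')"

definition viso :: "'a set \<Rightarrow> ('a \<Rightarrow> 'a \<Rightarrow> 'v::continuous_quantale) \<Rightarrow>
    'b set \<Rightarrow> ('b \<Rightarrow> 'b \<Rightarrow> 'v) \<Rightarrow> ('a \<Rightarrow> 'b) \<Rightarrow> bool" where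
  "viso X a Y b f \<longleftrightarrow> bij_betw f X Y \<and> vfunctor X a Y b f \<and> vfunctor Y b X a (inv_into X f)"

record ('o, 'm, 'v) vcat =
  Ob :: "'o set"
  Arr :: "'m set"
  Dom :: "'m \<Rightarrow> 'o"
  Cod :: "'m \<Rightarrow> 'o"
  Id :: "'o \<Rightarrow> 'm"
  Comp :: "'m \<Rightarrow> 'm \<Rightarrow> 'm" (infixr "\<cdot>\<index>" 60)
  Dist :: "'m \<Rightarrow> 'm \<Rightarrow> 'v"

definition hom :: "('o, 'm, 'v, 'z) vcat_scheme \<Rightarrow> 'o \<Rightarrow> 'o \<Rightarrow> 'm set" where
  "hom C X Y = {f \<in> Arr C. Dom C f = X \<and> Cod C f = Y}"

text \<open>Smallness of the hom-sets is automatic, since they are sets of elements of a type.\<close>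

locale enriched_category =
  fixes C :: "('o, 'm, 'v::continuous_quantale, 'z) vcat_scheme" (structure)
  assumes Dom_Ob: "f \<in> Arr C \<Longrightarrow> Dom C f \<in> Ob C"
    and Cod_Ob: "f \<in> Arr C \<Longrightarrow> Cod C f \<in> Ob C"
    and Id_hom: "X \<in> Ob C \<Longrightarrow> Id C X \<in> hom C X X"
    and Comp_Id: "f \<in> hom C X Y \<Longrightarrow> f \<cdot> Id C X = f"
    and Id_Comp: "f \<in> hom C X Y \<Longrightarrow> Id C Y \<cdot> f = f"
    and Comp_assoc: "\<lbrakk>f \<in> hom C W X; g \<in> hom C X Y; h \<in> hom C Y Z\<rbrakk>
      \<Longrightarrow> (h \<cdot> g) \<cdot> f = h \<cdot> (g \<cdot> f)"
    and hom_vcategory: "\<lbrakk>X \<in> Ob C; Y \<in> Ob C\<rbrakk> \<Longrightarrow> vcategory (hom C X Y) (Dist C)"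
    and hom_separated: "\<lbrakk>X \<in> Ob C; Y \<in> Ob C\<rbrakk> \<Longrightarrow> separated (hom C X Y) (Dist C)"
    and Comp_vfunctor: "\<lbrakk>X \<in> Ob C; Y \<in> Ob C; Z \<in> Ob C\<rbrakk> \<Longrightarrow>
      vfunctor (hom C Y Z \<times> hom C X Y) (vtensor (Dist C) (Dist C)) (hom C X Z) (Dist C)
        (\<lambda>(g, f). g \<cdot> f)"

definition inverse_arrows :: "('o, 'm, 'v, 'z) vcat_scheme \<Rightarrow> 'm \<Rightarrow> 'm \<Rightarrow> bool" where
  "inverse_arrows C f g \<longleftrightarrow> f \<in> Arr C \<and> g \<in> hom C (Cod C f) (Dom C f) \<and>
    Comp C g f = Id C (Dom C f) \<and> Comp C f g = Id C (Cod C f)"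

definition iso_in :: "('o, 'm, 'v, 'z) vcat_scheme \<Rightarrow> 'o \<Rightarrow> 'o \<Rightarrow> 'm \<Rightarrow> bool" where
  "iso_in C X Y f \<longleftrightarrow> f \<in> hom C X Y \<and> (\<exists>g. inverse_arrows C f g)"

definition Inv :: "('o, 'm, 'v, 'z) vcat_scheme \<Rightarrow> 'm \<Rightarrow> 'm" where
  "Inv C f = (THE g. inverse_arrows C f g)"

record ('o, 'm, 'v) autcat = "('o, 'm, 'v) vcat" +
  Unit :: "'o"
  TensO :: "'o \<Rightarrow> 'o \<Rightarrow> 'o" (infixr "\<otimes>\<^sub>o\<index>" 70)
  TensM :: "'m \<Rightarrow> 'm \<Rightarrow> 'm" (infixr "\<otimes>\<^sub>m\<index>" 70)
  Assoc :: "'o \<Rightarrow> 'o \<Rightarrow> 'o \<Rightarrow> 'm"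
  LUnit :: "'o \<Rightarrow> 'm"
  RUnit :: "'o \<Rightarrow> 'm"
  Sym :: "'o \<Rightarrow> 'o \<Rightarrow> 'm"
  LolliO :: "'o \<Rightarrow> 'o \<Rightarrow> 'o" (infixr "\<multimap>\<index>" 65)
  LolliM :: "'o \<Rightarrow> 'm \<Rightarrow> 'm"
  Curry :: "'o \<Rightarrow> 'o \<Rightarrow> 'm \<Rightarrow> 'm"

text \<open>\<open>LolliM X\<close> is the action on morphisms of the functor \<open>X \<multimap> -\<close>, and
  \<open>Curry Y X : hom (Y \<otimes> X) Z \<rightarrow> hom Y (X \<multimap> Z)\<close> is the adjunction bijection.\<close>

locale autonomous_category = enriched_category C
  for C :: "('o, 'm, 'v::continuous_quantale, 'z) autcat_scheme" (structure) +
  assumes Unit_Ob: "Unit C \<in> Ob C"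
    and TensO_Ob: "\<lbrakk>X \<in> Ob C; Y \<in> Ob C\<rbrakk> \<Longrightarrow> X \<otimes>\<^sub>o Y \<in> Ob C"
    and TensM_vfunctor: "\<lbrakk>X \<in> Ob C; X' \<in> Ob C; Y \<in> Ob C; Y' \<in> Ob C\<rbrakk> \<Longrightarrow>
      vfunctor (hom C X X' \<times> hom C Y Y') (vtensor (Dist C) (Dist C))
        (hom C (X \<otimes>\<^sub>o Y) (X' \<otimes>\<^sub>o Y')) (Dist C) (\<lambda>(f, g). f \<otimes>\<^sub>m g)"
    and TensM_Id: "\<lbrakk>X \<in> Ob C; Y \<in> Ob C\<rbrakk> \<Longrightarrow> Id C X \<otimes>\<^sub>m Id C Y = Id C (X \<otimes>\<^sub>o Y)"
    and TensM_Comp: "\<lbrakk>f \<in> hom C X X'; f' \<in> hom C X' X''; g \<in> hom C Y Y'; g' \<in> hom C Y' Y''\<rbrakk>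
      \<Longrightarrow> (f' \<cdot> f) \<otimes>\<^sub>m (g' \<cdot> g) = (f' \<otimes>\<^sub>m g') \<cdot> (f \<otimes>\<^sub>m g)"
    and Assoc_iso: "\<lbrakk>X \<in> Ob C; Y \<in> Ob C; Z \<in> Ob C\<rbrakk> \<Longrightarrow>
      iso_in C ((X \<otimes>\<^sub>o Y) \<otimes>\<^sub>o Z) (X \<otimes>\<^sub>o (Y \<otimes>\<^sub>o Z)) (Assoc C X Y Z)"
    and Assoc_nat: "\<lbrakk>f \<in> hom C X X'; g \<in> hom C Y Y'; h \<in> hom C Z Z'\<rbrakk> \<Longrightarrow>
      Assoc C X' Y' Z' \<cdot> ((f \<otimes>\<^sub>m g) \<otimes>\<^sub>m h) = (f \<otimes>\<^sub>m (g \<otimes>\<^sub>m h)) \<cdot> Assoc C X Y Z"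
    and LUnit_iso: "X \<in> Ob C \<Longrightarrow> iso_in C (Unit C \<otimes>\<^sub>o X) X (LUnit C X)"
    and LUnit_nat: "f \<in> hom C X Y \<Longrightarrow> LUnit C Y \<cdot> (Id C (Unit C) \<otimes>\<^sub>m f) = f \<cdot> LUnit C X"
    and RUnit_iso: "X \<in> Ob C \<Longrightarrow> iso_in C (X \<otimes>\<^sub>o Unit C) X (RUnit C X)"
    and RUnit_nat: "f \<in> hom C X Y \<Longrightarrow> RUnit C Y \<cdot> (f \<otimes>\<^sub>m Id C (Unit C)) = f \<cdot> RUnit C X"
    and Sym_hom: "\<lbrakk>X \<in> Ob C; Y \<in> Ob C\<rbrakk> \<Longrightarrow> Sym C X Y \<in> hom C (X \<otimes>\<^sub>o Y) (Y \<otimes>\<^sub>o X)"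
    and Sym_nat: "\<lbrakk>f \<in> hom C X X'; g \<in> hom C Y Y'\<rbrakk> \<Longrightarrow>
      Sym C X' Y' \<cdot> (f \<otimes>\<^sub>m g) = (g \<otimes>\<^sub>m f) \<cdot> Sym C X Y"
    and Sym_Sym: "\<lbrakk>X \<in> Ob C; Y \<in> Ob C\<rbrakk> \<Longrightarrow> Sym C Y X \<cdot> Sym C X Y = Id C (X \<otimes>\<^sub>o Y)"
    and pentagon: "\<lbrakk>W \<in> Ob C; X \<in> Ob C; Y \<in> Ob C; Z \<in> Ob C\<rbrakk> \<Longrightarrow>
      Assoc C W X (Y \<otimes>\<^sub>o Z) \<cdot> Assoc C (W \<otimes>\<^sub>o X) Y Z =
      (Id C W \<otimes>\<^sub>m Assoc C X Y Z) \<cdot> Assoc C W (X \<otimes>\<^sub>o Y) Z \<cdot> (Assoc C W X Y \<otimes>\<^sub>m Id C Z)"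
    and triangle: "\<lbrakk>X \<in> Ob C; Y \<in> Ob C\<rbrakk> \<Longrightarrow>
      (Id C X \<otimes>\<^sub>m LUnit C Y) \<cdot> Assoc C X (Unit C) Y = RUnit C X \<otimes>\<^sub>m Id C Y"
    and hexagon: "\<lbrakk>X \<in> Ob C; Y \<in> Ob C; Z \<in> Ob C\<rbrakk> \<Longrightarrow>
      Assoc C Y Z X \<cdot> Sym C X (Y \<otimes>\<^sub>o Z) \<cdot> Assoc C X Y Z =
      (Id C Y \<otimes>\<^sub>m Sym C X Z) \<cdot> Assoc C Y X Z \<cdot> (Sym C X Y \<otimes>\<^sub>m Id C Z)"
    and LolliO_Ob: "\<lbrakk>X \<in> Ob C; Y \<in> Ob C\<rbrakk> \<Longrightarrow> X \<multimap> Y \<in> Ob C"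
    and LolliM_vfunctor: "\<lbrakk>X \<in> Ob C; Y \<in> Ob C; Z \<in> Ob C\<rbrakk> \<Longrightarrow>
      vfunctor (hom C Y Z) (Dist C) (hom C (X \<multimap> Y) (X \<multimap> Z)) (Dist C) (LolliM C X)"
    and LolliM_Id: "\<lbrakk>X \<in> Ob C; Y \<in> Ob C\<rbrakk> \<Longrightarrow> LolliM C X (Id C Y) = Id C (X \<multimap> Y)"
    and LolliM_Comp: "\<lbrakk>X \<in> Ob C; f \<in> hom C Y Y'; g \<in> hom C Y' Y''\<rbrakk> \<Longrightarrow>
      LolliM C X (g \<cdot> f) = LolliM C X g \<cdot> LolliM C X f"
    and Curry_viso: "\<lbrakk>X \<in> Ob C; Y \<in> Ob C; Z \<in> Ob C\<rbrakk> \<Longrightarrow>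
      viso (hom C (Y \<otimes>\<^sub>o X) Z) (Dist C) (hom C Y (X \<multimap> Z)) (Dist C) (Curry C Y X)"
    and Curry_nat_left: "\<lbrakk>X \<in> Ob C; g \<in> hom C Y' Y; f \<in> hom C (Y \<otimes>\<^sub>o X) Z\<rbrakk> \<Longrightarrow>
      Curry C Y' X (f \<cdot> (g \<otimes>\<^sub>m Id C X)) = Curry C Y X f \<cdot> g"
    and Curry_nat_right: "\<lbrakk>X \<in> Ob C; Y \<in> Ob C; f \<in> hom C (Y \<otimes>\<^sub>o X) Z; h \<in> hom C Z Z'\<rbrakk> \<Longrightarrow>
      Curry C Y X (h \<cdot> f) = LolliM C X h \<cdot> Curry C Y X f"

definition Eval :: "('o, 'm, 'v, 'z) autcat_scheme \<Rightarrow> 'o \<Rightarrow> 'o \<Rightarrow> 'm" where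
  "Eval C X Z =
    (THE e. e \<in> hom C (TensO C (LolliO C X Z) X) Z \<and>
            Curry C (LolliO C X Z) X e = Id C (LolliO C X Z))"

definition enriched_functor ::
  "('o, 'm, 'v::continuous_quantale, 'z) vcat_scheme \<Rightarrow> ('p, 'n, 'v, 'y) vcat_scheme \<Rightarrow>
   ('o \<Rightarrow> 'p) \<Rightarrow> ('m \<Rightarrow> 'n) \<Rightarrow> bool" where
  "enriched_functor C D Fo Fm \<longleftrightarrow>
    enriched_category C \<and> enriched_category D \<and>
    (\<forall>X\<in>Ob C. Fo X \<in> Ob D) \<and>
    (\<forall>X\<in>Ob C. \<forall>Y\<in>Ob C.
      vfunctor (hom C X Y) (Dist C) (hom D (Fo X) (Fo Y)) (Dist D) Fm) \<and>
    (\<forall>X\<in>Ob C. Fm (Id C X) = Id D (Fo X)) \<and>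
    (\<forall>X\<in>Ob C. \<forall>Y\<in>Ob C. \<forall>Z\<in>Ob C. \<forall>f\<in>hom C X Y. \<forall>g\<in>hom C Y Z.
      Fm (Comp C g f) = Comp D (Fm g) (Fm f))"

definition natural_iso ::
  "('o, 'm, 'v, 'z) vcat_scheme \<Rightarrow> ('p, 'n, 'v, 'y) vcat_scheme \<Rightarrow>
   ('o \<Rightarrow> 'p) \<Rightarrow> ('m \<Rightarrow> 'n) \<Rightarrow> ('o \<Rightarrow> 'p) \<Rightarrow> ('m \<Rightarrow> 'n) \<Rightarrow> ('o \<Rightarrow> 'n) \<Rightarrow> bool" where
  "natural_iso C D Fo Fm Go Gm t \<longleftrightarrow>
    (\<forall>X\<in>Ob C. iso_in D (Fo X) (Go X) (t X)) \<and>
    (\<forall>X\<in>Ob C. \<forall>Y\<in>Ob C. \<forall>f\<in>hom C X Y. Comp D (Gm f) (t X) = Comp D (t Y) (Fm f))"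

definition enriched_equivalent ::
  "('o, 'm, 'v::continuous_quantale, 'z) vcat_scheme \<Rightarrow> ('p, 'n, 'v, 'y) vcat_scheme \<Rightarrow> bool" where
  "enriched_equivalent C D \<longleftrightarrow>
    (\<exists>Fo Fm Go Gm unit counit.
      enriched_functor C D Fo Fm \<and> enriched_functor D C Go Gm \<and>
      natural_iso C C (\<lambda>X. X) (\<lambda>f. f) (Go \<circ> Fo) (Gm \<circ> Fm) unit \<and>
      natural_iso D D (Fo \<circ> Go) (Fm \<circ> Gm) (\<lambda>X. X) (\<lambda>f. f) counit)"

section \<open>The linear lambda-calculus\<close>

datatype (ground_types: 'g) ty =
    Ground 'g
  | TUnit
  | TTens "'g ty" "'g ty"
  | TLolli "'g ty" "'g ty"

type_synonym var = nat

text \<open>Terms up to renaming of bound variables, in locally nameless representation: \<open>FV\<close> is a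
  named variable and \<open>BV\<close> a de Bruijn index. \<open>Lam\<close> binds one index in its body, \<open>Pm\<close> binds two in
  its second argument. Binding of a named variable is expressed by \<open>lam\<close> and \<open>pm\<close> below; only
  locally closed terms are typable.\<close>

datatype ('g, 'f) tm =
    FV var
  | BV nat
  | Op 'f "('g, 'f) tm list"
  | Star
  | ToStar "('g, 'f) tm" "('g, 'f) tm"
  | Tensor "('g, 'f) tm" "('g, 'f) tm"
  | Pm "('g, 'f) tm" "('g, 'f) tm"
  | Lam "'g ty" "('g, 'f) tm"
  | App "('g, 'f) tm" "('g, 'f) tm"

fun close :: "nat \<Rightarrow> var \<Rightarrow> ('g, 'f) tm \<Rightarrow> ('g, 'f) tm" where
  "close k x (FV y) = (if y = x then BV k else FV y)"
| "close k x (BV i) = BV i"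
| "close k x (Op f vs) = Op f (map (close k x) vs)"
| "close k x Star = Star"
| "close k x (ToStar v w) = ToStar (close k x v) (close k x w)"
| "close k x (Tensor v w) = Tensor (close k x v) (close k x w)"
| "close k x (Pm v w) = Pm (close k x v) (close (k + 2) x w)"
| "close k x (Lam A v) = Lam A (close (k + 1) x v)"
| "close k x (App v w) = App (close k x v) (close k x w)"

definition lam :: "var \<Rightarrow> 'g ty \<Rightarrow> ('g, 'f) tm \<Rightarrow> ('g, 'f) tm" where
  "lam x A v = Lam A (close 0 x v)"

text \<open>\<open>pm v x y w\<close> is \<open>pm v to x \<otimes> y. w\<close>.\<close>

definition pm :: "('g, 'f) tm \<Rightarrow> var \<Rightarrow> var \<Rightarrow> ('g, 'f) tm \<Rightarrow> ('g, 'f) tm" where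
  "pm v x y w = Pm v (close 0 y (close 1 x w))"

text \<open>Simultaneous substitution. It avoids capture because the substituted terms are always
  locally closed and bound variables have no names.\<close>

fun subst :: "(var \<Rightarrow> ('g, 'f) tm) \<Rightarrow> ('g, 'f) tm \<Rightarrow> ('g, 'f) tm" where
  "subst s (FV x) = s x"
| "subst s (BV i) = BV i"
| "subst s (Op f vs) = Op f (map (subst s) vs)"
| "subst s Star = Star"
| "subst s (ToStar v w) = ToStar (subst s v) (subst s w)"
| "subst s (Tensor v w) = Tensor (subst s v) (subst s w)"
| "subst s (Pm v w) = Pm (subst s v) (subst s w)"
| "subst s (Lam A v) = Lam A (subst s v)"
| "subst s (App v w) = App (subst s v) (subst s w)"

abbreviation subst1 :: "('g, 'f) tm \<Rightarrow> var \<Rightarrow> ('g, 'f) tm \<Rightarrow> ('g, 'f) tm" ("_[_ ::= _]" [1000, 0, 0] 1000)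
  where "v[x ::= w] \<equiv> subst (FV(x := w)) v"

text \<open>The last variable of a context is the head of the list: \<open>(x, A) # \<Gamma>\<close> is \<open>\<Gamma>, x : A\<close>, and
  \<open>\<Delta> @ \<Gamma>\<close> is \<open>\<Gamma>, \<Delta>\<close>.\<close>

type_synonym 'g ctx = "(var \<times> 'g ty) list"

abbreviation distinct_vars :: "'g ctx \<Rightarrow> bool" where
  "distinct_vars \<Gamma> \<equiv> distinct (map fst \<Gamma>)"

text \<open>Interleavings of contexts that keep the order of variables inside each of them.\<close>

fun Sf :: "'g ctx list \<Rightarrow> 'g ctx set" where
  "Sf [] = {[]}"
| "Sf (\<Gamma> # \<Gamma>s) = (\<Union>\<Delta>\<in>Sf \<Gamma>s. shuffles \<Gamma> \<Delta>)"

text \<open>Equations-in-context \<open>\<Gamma> \<rhd> v =\<^sub>q w : A\<close>.\<close>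

type_synonym ('g, 'f, 'v) veqn = "'g ctx \<times> ('g, 'f) tm \<times> 'v \<times> ('g, 'f) tm \<times> 'g ty"

record ('g, 'f, 'v) theory_data =
  Gnd :: "'g set"
  Ops :: "'f set"
  Args :: "'f \<Rightarrow> 'g ty list"
  Res :: "'f \<Rightarrow> 'g ty"
  Ax :: "('g, 'f, 'v) veqn set"

definition types :: "('g, 'f, 'v) theory_data \<Rightarrow> 'g ty set" where
  "types T = {A. ground_types A \<subseteq> Gnd T}"

inductive typed :: "('g, 'f, 'v) theory_data \<Rightarrow> 'g ctx \<Rightarrow> ('g, 'f) tm \<Rightarrow> 'g ty \<Rightarrow> bool"
  for T :: "('g, 'f, 'v) theory_data" where
  ty_op: "\<lbrakk>f \<in> Ops T; length vs = length (Args T f); length \<Gamma>s = length (Args T f);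
      \<forall>i<length (Args T f). typed T (\<Gamma>s ! i) (vs ! i) (Args T f ! i);
      E \<in> Sf \<Gamma>s; distinct_vars E\<rbrakk>
    \<Longrightarrow> typed T E (Op f vs) (Res T f)"
| ty_hyp: "A \<in> types T \<Longrightarrow> typed T [(x, A)] (FV x) A"
| ty_star: "typed T [] Star TUnit"
| ty_to: "\<lbrakk>typed T \<Gamma> v TUnit; typed T \<Delta> w A; E \<in> Sf [\<Gamma>, \<Delta>]; distinct_vars E\<rbrakk>
    \<Longrightarrow> typed T E (ToStar v w) A"
| ty_tensor: "\<lbrakk>typed T \<Gamma> v A; typed T \<Delta> w B; E \<in> Sf [\<Gamma>, \<Delta>]; distinct_vars E\<rbrakk>
    \<Longrightarrow> typed T E (Tensor v w) (TTens A B)"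
| ty_pm: "\<lbrakk>typed T \<Gamma> v (TTens A B); typed T ((y, B) # (x, A) # \<Delta>) w D;
      E \<in> Sf [\<Gamma>, \<Delta>]; distinct_vars E\<rbrakk>
    \<Longrightarrow> typed T E (pm v x y w) D"
| ty_lam: "typed T ((x, A) # \<Gamma>) v B \<Longrightarrow> typed T \<Gamma> (lam x A v) (TLolli A B)"
| ty_app: "\<lbrakk>typed T \<Gamma> v (TLolli A B); typed T \<Delta> w A; E \<in> Sf [\<Gamma>, \<Delta>]; distinct_vars E\<rbrakk>
    \<Longrightarrow> typed T E (App v w) B"

definition linear_theory :: "'v::continuous_quantale set \<Rightarrow> ('g, 'f, 'v) theory_data \<Rightarrow> bool" where
  "linear_theory B T \<longleftrightarrow>
    (\<forall>f\<in>Ops T. Args T f \<noteq> [] \<and> set (Args T f) \<subseteq> types T \<and> Res T f \<in> types T) \<and>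
    (\<forall>(\<Gamma>, v, q, w, A)\<in>Ax T. q \<in> B \<and> typed T \<Gamma> v A \<and> typed T \<Gamma> w A)"

text \<open>The \<open>\<beta>\<close>, \<open>\<eta>\<close> and commuting-conversion equations.\<close>

inductive conv :: "('g, 'f, 'v) theory_data \<Rightarrow> 'g ctx \<Rightarrow> ('g, 'f) tm \<Rightarrow> ('g, 'f) tm \<Rightarrow> 'g ty \<Rightarrow> bool"
  for T :: "('g, 'f, 'v) theory_data" where
  beta_tensor: "\<lbrakk>typed T \<Gamma> v A; typed T \<Delta> w B; typed T ((y, B) # (x, A) # \<Theta>) u D;
      E \<in> Sf [\<Gamma>, \<Delta>, \<Theta>]; distinct_vars E\<rbrakk>
    \<Longrightarrow> conv T E (pm (Tensor v w) x y u) (subst (FV(x := v, y := w)) u) D"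
| eta_tensor: "\<lbrakk>typed T \<Gamma> v (TTens A B); typed T ((z, TTens A B) # \<Delta>) u D;
      distinct_vars ((y, B) # (x, A) # \<Delta>); E \<in> Sf [\<Gamma>, \<Delta>]; distinct_vars E\<rbrakk>
    \<Longrightarrow> conv T E (pm v x y (u[z ::= Tensor (FV x) (FV y)])) (u[z ::= v]) D"
| beta_unit: "typed T \<Gamma> v A \<Longrightarrow> conv T \<Gamma> (ToStar Star v) v A"
| eta_unit: "\<lbrakk>typed T \<Gamma> v TUnit; typed T ((z, TUnit) # \<Delta>) w A;
      E \<in> Sf [\<Gamma>, \<Delta>]; distinct_vars E\<rbrakk>
    \<Longrightarrow> conv T E (ToStar v (w[z ::= Star])) (w[z ::= v]) A"
| beta_lam: "\<lbrakk>typed T ((x, A) # \<Gamma>) v B; typed T \<Delta> w A; E \<in> Sf [\<Gamma>, \<Delta>]; distinct_vars E\<rbrakk>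
    \<Longrightarrow> conv T E (App (lam x A v) w) (v[x ::= w]) B"
| eta_lam: "\<lbrakk>typed T \<Gamma> v (TLolli A B); distinct_vars ((x, A) # \<Gamma>)\<rbrakk>
    \<Longrightarrow> conv T \<Gamma> (lam x A (App v (FV x))) v (TLolli A B)"
| cc_unit: "\<lbrakk>typed T \<Gamma> v TUnit; typed T \<Delta> w A; typed T ((z, A) # \<Theta>) u B;
      E \<in> Sf [\<Gamma>, \<Delta>, \<Theta>]; distinct_vars E\<rbrakk>
    \<Longrightarrow> conv T E (u[z ::= ToStar v w]) (ToStar v (u[z ::= w])) B"
| cc_tensor: "\<lbrakk>typed T \<Gamma> v (TTens A B); typed T ((y, B) # (x, A) # \<Delta>) w D;
      typed T ((z, D) # \<Theta>) u D'; distinct_vars ((y, B) # (x, A) # \<Theta>);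
      E \<in> Sf [\<Gamma>, \<Delta>, \<Theta>]; distinct_vars E\<rbrakk>
    \<Longrightarrow> conv T E (u[z ::= pm v x y w]) (pm v x y (u[z ::= w])) D'"

text \<open>\<open>derivable B T \<Gamma> v q w A\<close>: \<open>\<Gamma> \<rhd> v =\<^sub>q w : A\<close> is a theorem of \<open>T\<close>. All labels lie in the
  basis \<open>B\<close>. The premises on typing in the Archimedean and join rules matter only when
  there are no other premises.\<close>

inductive derivable :: "'v::continuous_quantale set \<Rightarrow> ('g, 'f, 'v) theory_data \<Rightarrow>
    'g ctx \<Rightarrow> ('g, 'f) tm \<Rightarrow> 'v \<Rightarrow> ('g, 'f) tm \<Rightarrow> 'g ty \<Rightarrow> bool"
  for B :: "'v::continuous_quantale set" and T :: "('g, 'f, 'v) theory_data" where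
  d_ax: "(\<Gamma>, v, q, w, A) \<in> Ax T \<Longrightarrow> derivable B T \<Gamma> v q w A"
| d_conv: "conv T \<Gamma> v w A \<Longrightarrow> derivable B T \<Gamma> v top w A"
| d_conv_sym: "conv T \<Gamma> v w A \<Longrightarrow> derivable B T \<Gamma> w top v A"
| d_refl: "typed T \<Gamma> v A \<Longrightarrow> derivable B T \<Gamma> v top v A"
| d_trans: "\<lbrakk>derivable B T \<Gamma> v q w A; derivable B T \<Gamma> w r u A\<rbrakk> \<Longrightarrow> derivable B T \<Gamma> v (q * r) u A"
| d_weak: "\<lbrakk>derivable B T \<Gamma> v q w A; r \<in> B; r \<le> q\<rbrakk> \<Longrightarrow> derivable B T \<Gamma> v r w A"
| d_arch: "\<lbrakk>q \<in> B; typed T \<Gamma> v A; typed T \<Gamma> w A;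
      \<forall>r\<in>B. r \<lless> q \<longrightarrow> derivable B T \<Gamma> v r w A\<rbrakk> \<Longrightarrow> derivable B T \<Gamma> v q w A"
| d_join: "\<lbrakk>finite Q; Q \<subseteq> B; typed T \<Gamma> v A; typed T \<Gamma> w A;
      \<forall>q\<in>Q. derivable B T \<Gamma> v q w A\<rbrakk> \<Longrightarrow> derivable B T \<Gamma> v (Sup Q) w A"
| d_op: "\<lbrakk>f \<in> Ops T; length vs = length (Args T f); length ws = length (Args T f);
      length qs = length (Args T f); length \<Gamma>s = length (Args T f);
      \<forall>i<length (Args T f). derivable B T (\<Gamma>s ! i) (vs ! i) (qs ! i) (ws ! i) (Args T f ! i);
      E \<in> Sf \<Gamma>s; distinct_vars E\<rbrakk>
    \<Longrightarrow> derivable B T E (Op f vs) (prod_list qs) (Op f ws) (Res T f)"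
| d_to: "\<lbrakk>derivable B T \<Gamma> v q w TUnit; derivable B T \<Delta> v' r w' A;
      E \<in> Sf [\<Gamma>, \<Delta>]; distinct_vars E\<rbrakk>
    \<Longrightarrow> derivable B T E (ToStar v v') (q * r) (ToStar w w') A"
| d_tensor: "\<lbrakk>derivable B T \<Gamma> v q w A; derivable B T \<Delta> v' r w' A';
      E \<in> Sf [\<Gamma>, \<Delta>]; distinct_vars E\<rbrakk>
    \<Longrightarrow> derivable B T E (Tensor v v') (q * r) (Tensor w w') (TTens A A')"
| d_pm: "\<lbrakk>derivable B T \<Gamma> v q w (TTens A A'); derivable B T ((y, A') # (x, A) # \<Delta>) v' r w' D;
      E \<in> Sf [\<Gamma>, \<Delta>]; distinct_vars E\<rbrakk>
    \<Longrightarrow> derivable B T E (pm v x y v') (q * r) (pm w x y w') D"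
| d_lam: "derivable B T ((x, A) # \<Gamma>) v q w A'
    \<Longrightarrow> derivable B T \<Gamma> (lam x A v) q (lam x A w) (TLolli A A')"
| d_app: "\<lbrakk>derivable B T \<Gamma> v q w (TLolli A A'); derivable B T \<Delta> v' r w' A;
      E \<in> Sf [\<Gamma>, \<Delta>]; distinct_vars E\<rbrakk>
    \<Longrightarrow> derivable B T E (App v v') (q * r) (App w w') A'"
| d_subst: "\<lbrakk>derivable B T ((x, A) # \<Gamma>) v q w A'; derivable B T \<Delta> v' r w' A;
      distinct_vars (\<Delta> @ \<Gamma>)\<rbrakk>
    \<Longrightarrow> derivable B T (\<Delta> @ \<Gamma>) (v[x ::= v']) (q * r) (w[x ::= w']) A'"
| d_perm: "\<lbrakk>derivable B T \<Gamma> v q w A; mset \<Delta> = mset \<Gamma>\<rbrakk> \<Longrightarrow> derivable B T \<Delta> v q w A"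

section \<open>The syntactic category of a theory\<close>

text \<open>Terms \<open>x : A \<rhd> v : B\<close> are taken with respect to one fixed variable \<open>x\<close>.\<close>

abbreviation x0 :: var where "x0 \<equiv> 0"

definition terms :: "('g, 'f, 'v) theory_data \<Rightarrow> 'g ty \<Rightarrow> 'g ty \<Rightarrow> ('g, 'f) tm set" where
  "terms T A A' = {v. typed T [(x0, A)] v A'}"

definition tdist :: "'v::continuous_quantale set \<Rightarrow> ('g, 'f, 'v) theory_data \<Rightarrow>
    'g ty \<Rightarrow> 'g ty \<Rightarrow> ('g, 'f) tm \<Rightarrow> ('g, 'f) tm \<Rightarrow> 'v" where
  "tdist B T A A' v w = Sup {q. derivable B T [(x0, A)] v q w A'}"

definition tclass :: "'v::continuous_quantale set \<Rightarrow> ('g, 'f, 'v) theory_data \<Rightarrow>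
    'g ty \<Rightarrow> 'g ty \<Rightarrow> ('g, 'f) tm \<Rightarrow> ('g, 'f) tm set" where
  "tclass B T A A' v = {w \<in> terms T A A'. 1 \<le> tdist B T A A' v w \<and> 1 \<le> tdist B T A A' w v}"

text \<open>A morphism is a class of terms together with its domain and codomain; composition and
  distance are computed on representatives.\<close>

definition rep :: "'a set \<Rightarrow> 'a" where
  "rep c = (SOME v. v \<in> c)"

definition Syn :: "'v::continuous_quantale set \<Rightarrow> ('g, 'f, 'v) theory_data \<Rightarrow>
    ('g ty, 'g ty \<times> ('g, 'f) tm set \<times> 'g ty, 'v) vcat" where
  "Syn B T =
    \<lparr>Ob = types T,
     Arr = {(A, tclass B T A A' v, A') | A A' v. A \<in> types T \<and> A' \<in> types T \<and> v \<in> terms T A A'},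
     Dom = (\<lambda>(A, c, A'). A),
     Cod = (\<lambda>(A, c, A'). A'),
     Id = (\<lambda>A. (A, tclass B T A A (FV x0), A)),
     Comp = (\<lambda>(_, d, A'') (A, c, _). (A, tclass B T A A'' ((rep d)[x0 ::= rep c]), A'')),
     Dist = (\<lambda>(A, c, A') (_, d, _). tdist B T A A' (rep c) (rep d))\<rparr>"

section \<open>The internal language of an autonomous category\<close>

fun tyI :: "('o, 'm, 'v, 'z) autcat_scheme \<Rightarrow> 'o ty \<Rightarrow> 'o" where
  "tyI C (Ground X) = X"
| "tyI C TUnit = Unit C"
| "tyI C (TTens A B) = TensO C (tyI C A) (tyI C B)"
| "tyI C (TLolli A B) = LolliO C (tyI C A) (tyI C B)"

datatype ('o, 'm) lang_op =
    Mor 'm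
  | ToObj "'o ty"
  | FromObj "'o ty"

text \<open>\<open>ToObj A : A \<rightarrow> i(A)\<close> and \<open>FromObj A : i(A) \<rightarrow> A\<close> are the isomorphisms between a type and the
  object it denotes, the latter viewed as a ground type.\<close>

fun lang_args :: "('o, 'm, 'v, 'z) autcat_scheme \<Rightarrow> ('o, 'm) lang_op \<Rightarrow> 'o ty list" where
  "lang_args C (Mor f) = [Ground (Dom C f)]"
| "lang_args C (ToObj A) = [A]"
| "lang_args C (FromObj A) = [Ground (tyI C A)]"

fun lang_res :: "('o, 'm, 'v, 'z) autcat_scheme \<Rightarrow> ('o, 'm) lang_op \<Rightarrow> 'o ty" where
  "lang_res C (Mor f) = Ground (Cod C f)"
| "lang_res C (ToObj A) = Ground (tyI C A)"
| "lang_res C (FromObj A) = A"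

definition lang_signature ::
  "('o, 'm, 'v, 'z) autcat_scheme \<Rightarrow> ('o, ('o, 'm) lang_op, 'v) theory_data" where
  "lang_signature C =
    \<lparr>Gnd = Ob C,
     Ops = Mor ` Arr C \<union> ToObj ` {A. ground_types A \<subseteq> Ob C} \<union> FromObj ` {A. ground_types A \<subseteq> Ob C},
     Args = lang_args C,
     Res = lang_res C,
     Ax = {}\<rparr>"

text \<open>A type \<open>A\<close> and the ground type \<open>i(A)\<close> denote the same object of \<open>C\<close>, so the isomorphisms
  between them denote identities.\<close>

fun opI :: "('o, 'm, 'v, 'z) autcat_scheme \<Rightarrow> ('o, 'm) lang_op \<Rightarrow> 'm" where
  "opI C (Mor f) = f"
| "opI C (ToObj A) = Id C (tyI C A)"
| "opI C (FromObj A) = Id C (tyI C A)"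

text \<open>Contexts denote left-nested tensors, the empty context denotes the unit.\<close>

fun ctxI :: "('o, 'm, 'v, 'z) autcat_scheme \<Rightarrow> 'o ctx \<Rightarrow> 'o" where
  "ctxI C [] = Unit C"
| "ctxI C [(x, A)] = tyI C A"
| "ctxI C ((x, A) # p # \<Gamma>) = TensO C (ctxI C (p # \<Gamma>)) (tyI C A)"

text \<open>\<open>join1 C \<Gamma> A\<close> is the canonical isomorphism from the tensor of \<open>\<Gamma>\<close> and \<open>A\<close> to \<open>\<Gamma>, x : A\<close>.\<close>

definition join1 :: "('o, 'm, 'v, 'z) autcat_scheme \<Rightarrow> 'o ctx \<Rightarrow> 'o ty \<Rightarrow> 'm" where
  "join1 C \<Gamma> A =
    (if \<Gamma> = [] then LUnit C (tyI C A) else Id C (TensO C (ctxI C \<Gamma>) (tyI C A)))"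

text \<open>For a shuffle \<open>E\<close> of \<open>\<Gamma>\<close> and \<open>\<Delta>\<close> with distinct variables, \<open>split C E \<Gamma> \<Delta>\<close> is the
  canonical isomorphism from \<open>E\<close> to the tensor of \<open>\<Gamma>\<close> and \<open>\<Delta>\<close>: the composite of the symmetries
  which reorder \<open>E\<close> into \<open>\<Gamma>, \<Delta>\<close> with the rebracketing. It is given by recursion on the last
  variable of \<open>E\<close>, which is the last variable of either \<open>\<Gamma>\<close> or \<open>\<Delta>\<close>.\<close>

fun split :: "('o, 'm, 'v, 'z) autcat_scheme \<Rightarrow> 'o ctx \<Rightarrow> 'o ctx \<Rightarrow> 'o ctx \<Rightarrow> 'm" where
  "split C [] \<Gamma> \<Delta> = Inv C (LUnit C (Unit C))"
| "split C ((x, A) # E) \<Gamma> \<Delta> =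
    (if \<Gamma> \<noteq> [] \<and> hd \<Gamma> = (x, A) then
       (let G = ctxI C (tl \<Gamma>); D = ctxI C \<Delta>; X = tyI C A in
        (join1 C (tl \<Gamma>) A \<otimes>\<^sub>m\<^bsub>C\<^esub> Id C D) \<cdot>\<^bsub>C\<^esub> Inv C (Assoc C G X D) \<cdot>\<^bsub>C\<^esub>
        (Id C G \<otimes>\<^sub>m\<^bsub>C\<^esub> Sym C D X) \<cdot>\<^bsub>C\<^esub> Assoc C G D X \<cdot>\<^bsub>C\<^esub>
        (split C E (tl \<Gamma>) \<Delta> \<otimes>\<^sub>m\<^bsub>C\<^esub> Id C X) \<cdot>\<^bsub>C\<^esub> Inv C (join1 C E A))
     else
       (let G = ctxI C \<Gamma>; D = ctxI C (tl \<Delta>); X = tyI C A in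
        (Id C G \<otimes>\<^sub>m\<^bsub>C\<^esub> join1 C (tl \<Delta>) A) \<cdot>\<^bsub>C\<^esub> Assoc C G D X \<cdot>\<^bsub>C\<^esub>
        (split C E \<Gamma> (tl \<Delta>) \<otimes>\<^sub>m\<^bsub>C\<^esub> Id C X) \<cdot>\<^bsub>C\<^esub> Inv C (join1 C E A)))"

text \<open>\<open>interp C \<Gamma> v A m\<close>: the morphism \<open>m\<close> from the denotation of \<open>\<Gamma>\<close> to that of \<open>A\<close> interprets
  \<open>\<Gamma> \<rhd> v : A\<close>. The clauses follow the typing rules; all operation symbols of the internal
  language are unary.\<close>

inductive interp :: "('o, 'm, 'v, 'z) autcat_scheme \<Rightarrow>
    'o ctx \<Rightarrow> ('o, ('o, 'm) lang_op) tm \<Rightarrow> 'o ty \<Rightarrow> 'm \<Rightarrow> bool"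
  for C :: "('o, 'm, 'v, 'z) autcat_scheme" (structure) where
  in_op: "\<lbrakk>f \<in> Ops (lang_signature C); lang_args C f = [A]; interp C \<Gamma> v A m\<rbrakk>
    \<Longrightarrow> interp C \<Gamma> (Op f [v]) (lang_res C f) (opI C f \<cdot> m)"
| in_hyp: "ground_types A \<subseteq> Ob C \<Longrightarrow> interp C [(x, A)] (FV x) A (Id C (tyI C A))"
| in_star: "interp C [] Star TUnit (Id C (Unit C))"
| in_to: "\<lbrakk>interp C \<Gamma> v TUnit m; interp C \<Delta> w A n; E \<in> shuffles \<Gamma> \<Delta>; distinct_vars E\<rbrakk>
    \<Longrightarrow> interp C E (ToStar v w) A (LUnit C (tyI C A) \<cdot> (m \<otimes>\<^sub>m n) \<cdot> split C E \<Gamma> \<Delta>)"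
| in_tensor: "\<lbrakk>interp C \<Gamma> v A m; interp C \<Delta> w B n; E \<in> shuffles \<Gamma> \<Delta>; distinct_vars E\<rbrakk>
    \<Longrightarrow> interp C E (Tensor v w) (TTens A B) ((m \<otimes>\<^sub>m n) \<cdot> split C E \<Gamma> \<Delta>)"
| in_pm: "\<lbrakk>interp C \<Gamma> v (TTens A B) m; interp C ((y, B) # (x, A) # \<Delta>) w D n;
      E \<in> shuffles \<Gamma> \<Delta>; distinct_vars E\<rbrakk>
    \<Longrightarrow> interp C E (pm v x y w) D
      (n \<cdot> (join1 C \<Delta> A \<otimes>\<^sub>m Id C (tyI C B)) \<cdot>
       Inv C (Assoc C (ctxI C \<Delta>) (tyI C A) (tyI C B)) \<cdot>
       Sym C (tyI C A \<otimes>\<^sub>o tyI C B) (ctxI C \<Delta>) \<cdot>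
       (m \<otimes>\<^sub>m Id C (ctxI C \<Delta>)) \<cdot> split C E \<Gamma> \<Delta>)"
| in_lam: "interp C ((x, A) # \<Gamma>) v B m
    \<Longrightarrow> interp C \<Gamma> (lam x A v) (TLolli A B) (Curry C (ctxI C \<Gamma>) (tyI C A) (m \<cdot> join1 C \<Gamma> A))"
| in_app: "\<lbrakk>interp C \<Gamma> v (TLolli A B) m; interp C \<Delta> w A n; E \<in> shuffles \<Gamma> \<Delta>; distinct_vars E\<rbrakk>
    \<Longrightarrow> interp C E (App v w) B (Eval C (tyI C A) (tyI C B) \<cdot> (m \<otimes>\<^sub>m n) \<cdot> split C E \<Gamma> \<Delta>)"

definition Lang :: "'v::continuous_quantale set \<Rightarrow> ('o, 'm, 'v, 'z) autcat_scheme \<Rightarrow>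
    ('o, ('o, 'm) lang_op, 'v) theory_data" where
  "Lang B C = lang_signature C
    \<lparr>Ax := {(\<Gamma>, v, q, w, A). q \<in> B \<and>
       (\<exists>m n. interp C \<Gamma> v A m \<and> interp C \<Gamma> w A n \<and> q \<le> Dist C m n)}\<rparr>"

text \<open>The internal language of an autonomous category is indeed a linear theory.\<close>

lemma typed_distinct: "typed T \<Gamma> v A \<Longrightarrow> distinct_vars \<Gamma>"
  by (induction rule: typed.induct) auto

lemma interp_typed: "interp C \<Gamma> v A m \<Longrightarrow> typed (lang_signature C) \<Gamma> v A"
proof (induction rule: interp.induct)
  case (in_op f A \<Gamma> v m)
  then show ?case
    using ty_op[of f "lang_signature C" "[v]" "[\<Gamma>]" \<Gamma>] typed_distinct[of "lang_signature C" \<Gamma> v A]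
    by (simp add: lang_signature_def)
next
  case (in_hyp A x)
  then show ?case by (auto intro: ty_hyp simp: types_def lang_signature_def)
next
  case in_star
  show ?case by (rule ty_star)
next
  case (in_to \<Gamma> v m \<Delta> w A n E)
  then show ?case using ty_to[of _ \<Gamma> v \<Delta> w A E] by simp
next
  case (in_tensor \<Gamma> v A m \<Delta> w B n E)
  then show ?case using ty_tensor[of _ \<Gamma> v A \<Delta> w B E] by simp
next
  case (in_pm \<Gamma> v A B m y x \<Delta> w D n E)
  then show ?case using ty_pm[of _ \<Gamma> v A B y x \<Delta> w D E] by simp
next
  case (in_lam x A \<Gamma> v B m)
  then show ?case by (intro ty_lam)
next
  case (in_app \<Gamma> v A B m \<Delta> w n E)
  then show ?case using ty_app[of _ \<Gamma> v A B \<Delta> w E] by simp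
qed

lemma typed_Lang: "typed (lang_signature C) \<Gamma> v A \<Longrightarrow> typed (Lang B C) \<Gamma> v A"
proof -
  have sel: "Ops (Lang B C) = Ops (lang_signature C)" "Args (Lang B C) = Args (lang_signature C)"
    "Res (Lang B C) = Res (lang_signature C)" "types (Lang B C) = types (lang_signature C)"
    by (auto simp: Lang_def lang_signature_def types_def)
  show "typed (lang_signature C) \<Gamma> v A \<Longrightarrow> typed (Lang B C) \<Gamma> v A"
  proof (induction rule: typed.induct)
    case ty_op
    then show ?case using typed.ty_op sel by metis
  qed (use sel typed.intros in metis)+
qed

lemma (in autonomous_category) tyI_Ob: "ground_types A \<subseteq> Ob C \<Longrightarrow> tyI C A \<in> Ob C"
  by (induction A) (auto intro: Unit_Ob TensO_Ob LolliO_Ob)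

lemma (in autonomous_category) linear_theory_Lang: "linear_theory B (Lang B C)"
proof -
  have "Args (Lang B C) f \<noteq> [] \<and> set (Args (Lang B C) f) \<subseteq> types (Lang B C) \<and>
      Res (Lang B C) f \<in> types (Lang B C)" if "f \<in> Ops (Lang B C)" for f
    using that tyI_Ob Dom_Ob Cod_Ob
    by (cases f) (auto simp: Lang_def lang_signature_def types_def)
  moreover have "q \<in> B \<and> typed (Lang B C) \<Gamma> v A \<and> typed (Lang B C) \<Gamma> w A"
    if "(\<Gamma>, v, q, w, A) \<in> Ax (Lang B C)" for \<Gamma> v q w A
  proof -
    from that obtain m n where "q \<in> B" "interp C \<Gamma> v A m" "interp C \<Gamma> w A n"
      by (auto simp: Lang_def)
    then show ?thesis by (blast intro: typed_Lang interp_typed)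
  qed
  ultimately show ?thesis unfolding linear_theory_def by blast
qed

end

(* Everything rests on soundness: a derivable equation v =_q w forces the denotations of v and w to
   have distance at least q. A term has many derivations, and contexts get rebracketed and permuted
   along the way, so terms are interpreted over binary trees of variables, where all canonical
   isomorphisms between trees with the same distinct leaves coincide by Mac Lane's coherence theorem.
   For the latter, a tree t acts on lists of leaves by insertion sort, t (x) [l] -> [insert t l], and
   every structure isomorphism commutes with this action; for the symmetry this comes down to the
   Yang-Baxter equation for the twist X (x) (Y (x) Z) -> Y (x) (X (x) Z).
   Denotations are then unique and compatible with substitution, and the conversions hold by
   naturality and coherence. Completeness is immediate, since all valid equations are axioms. Hence
   denotation embeds the hom-object of Syn(Lang(C)) from A to B isometrically into that of C from i(A)
   to i(B), and it is onto because g is the denotation of FromObj (g (ToObj x)). *)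
theory Submission
  imports Defs
begin

section \<open>Symmetric monoidal closed categories\<close>

text \<open>Morphisms built from structure maps are not determined by domain and codomain alone:
  \<open>Sym C X X\<close> is usually not the identity. Hence trees carry named leaves, and even a
  fact about four given objects has to name them first. The sorting action keeps a list
  \<open>l\<close> as parameter so that a node acts by composing the actions of its subtrees, and
  concatenation of lists needs no interpretation; at the end \<open>l\<close> is empty and the
  leftover factor \<open>Unit C\<close> is cancelled. Denotation is a relation \<open>den\<close>
  closed under change of tree, so that every rule may use the tree that suits it. The price is that
  uniqueness becomes a theorem, and this theorem is what lets distances be chained through a middle
  term. The axioms of an enriched category are never checked on terms: for \<open>Syn\<close> they
  are pulled back from \<open>C\<close> along denotation, together with the equivalence.\<close>

lemma vfunctor_Pi: "vfunctor X a Y b f \<Longrightarrow> x \<in> X \<Longrightarrow> f x \<in> Y"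
  by (auto simp: vfunctor_def)

lemma vfunctor_le: "vfunctor X a Y b f \<Longrightarrow> x \<in> X \<Longrightarrow> x' \<in> X \<Longrightarrow> a x x' \<le> b (f x) (f x')"
  by (auto simp: vfunctor_def)

section \<open>Homs, distances and isomorphisms in an enriched category\<close>

context enriched_category
begin

lemma homI: "f \<in> Arr C \<Longrightarrow> Dom C f = X \<Longrightarrow> Cod C f = Y \<Longrightarrow> f \<in> hom C X Y"
  by (simp add: hom_def)

lemma homD: "f \<in> hom C X Y \<Longrightarrow> f \<in> Arr C" "f \<in> hom C X Y \<Longrightarrow> Dom C f = X"
  "f \<in> hom C X Y \<Longrightarrow> Cod C f = Y"
  by (simp_all add: hom_def)

lemma hom_Ob: "f \<in> hom C X Y \<Longrightarrow> X \<in> Ob C" "f \<in> hom C X Y \<Longrightarrow> Y \<in> Ob C"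
  using Dom_Ob Cod_Ob by (auto simp: hom_def)

declare Dom_Ob [simp] Cod_Ob [simp]

lemma Comp_hom: "f \<in> hom C X Y \<Longrightarrow> g \<in> hom C Y Z \<Longrightarrow> g \<cdot> f \<in> hom C X Z"
  using vfunctor_Pi[OF Comp_vfunctor, of X Y Z "(g, f)"] hom_Ob by auto

lemma Arr_Comp [simp]:
  assumes "f \<in> Arr C" "g \<in> Arr C" "Cod C f = Dom C g"
  shows "g \<cdot> f \<in> Arr C" "Dom C (g \<cdot> f) = Dom C f" "Cod C (g \<cdot> f) = Cod C g"
  using Comp_hom[of f "Dom C f" "Dom C g" g "Cod C g"] assms by (auto simp: hom_def)

lemma Arr_Id [simp]: "X \<in> Ob C \<Longrightarrow> Id C X \<in> Arr C" "X \<in> Ob C \<Longrightarrow> Dom C (Id C X) = X"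
  "X \<in> Ob C \<Longrightarrow> Cod C (Id C X) = X"
  using Id_hom[of X] by (auto simp: hom_def)

lemma Comp_Id' [simp]: "f \<in> Arr C \<Longrightarrow> Dom C f = X \<Longrightarrow> f \<cdot> Id C X = f"
  using Comp_Id by (auto simp: hom_def)

lemma Id_Comp' [simp]: "f \<in> Arr C \<Longrightarrow> Cod C f = X \<Longrightarrow> Id C X \<cdot> f = f"
  using Id_Comp by (auto simp: hom_def)

lemma Comp_assoc' [simp]:
  "\<lbrakk>f \<in> Arr C; g \<in> Arr C; h \<in> Arr C; Cod C f = Dom C g; Cod C g = Dom C h\<rbrakk>
    \<Longrightarrow> (h \<cdot> g) \<cdot> f = h \<cdot> (g \<cdot> f)"
  using Comp_assoc[of f "Dom C f" "Cod C f" g "Cod C g" h "Cod C h"] by (auto simp: hom_def)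

text \<open>Composites are kept right-nested, so an equation for \<open>g \<cdot> f\<close> does not
  match inside a longer one; this form carries the remaining factor \<open>k\<close> along.\<close>

lemma reassoc:
  assumes "g \<cdot> f = h" "f \<in> Arr C" "g \<in> Arr C" "Cod C f = Dom C g" "k \<in> Arr C" "Cod C k = Dom C f"
  shows "g \<cdot> (f \<cdot> k) = h \<cdot> k"
  using assms by (metis Comp_assoc')

lemma Dist_refl: "f \<in> Arr C \<Longrightarrow> 1 \<le> Dist C f f"
  using hom_vcategory[of "Dom C f" "Cod C f"] by (auto simp: vcategory_def hom_def)

lemma Dist_triangle:
  "f \<in> hom C X Y \<Longrightarrow> g \<in> hom C X Y \<Longrightarrow> h \<in> hom C X Y \<Longrightarrow> Dist C f g * Dist C g h \<le> Dist C f h"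
  using hom_vcategory[of X Y] hom_Ob[of f X Y] by (auto simp: vcategory_def)

lemma Dist_separated:
  "f \<in> hom C X Y \<Longrightarrow> g \<in> hom C X Y \<Longrightarrow> 1 \<le> Dist C f g \<Longrightarrow> 1 \<le> Dist C g f \<Longrightarrow> f = g"
  using hom_separated[of X Y] hom_Ob[of f X Y] by (auto simp: separated_def)

lemma Dist_Comp:
  assumes "f \<in> hom C X Y" "f' \<in> hom C X Y" "g \<in> hom C Y Z" "g' \<in> hom C Y Z"
  shows "Dist C g g' * Dist C f f' \<le> Dist C (g \<cdot> f) (g' \<cdot> f')"
  using vfunctor_le[OF Comp_vfunctor, of X Y Z "(g, f)" "(g', f')"] assms hom_Ob
  by (auto simp: vtensor_def)

lemma inverse_arrows_unique:
  assumes "inverse_arrows C f g" "inverse_arrows C f g'"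
  shows "g = g'"
proof -
  have "g = g \<cdot> (f \<cdot> g')" using assms by (auto simp: inverse_arrows_def hom_def)
  also have "\<dots> = (g \<cdot> f) \<cdot> g'" using assms by (subst Comp_assoc') (auto simp: inverse_arrows_def hom_def)
  also have "\<dots> = g'" using assms by (auto simp: inverse_arrows_def hom_def)
  finally show ?thesis .
qed

lemma Inv_eqI: "inverse_arrows C f g \<Longrightarrow> Inv C f = g"
  unfolding Inv_def by (blast intro: inverse_arrows_unique)

lemma iso_Inv: "iso_in C X Y f \<Longrightarrow> inverse_arrows C f (Inv C f)"
  using Inv_eqI by (auto simp: iso_in_def)

lemma iso_Inv_hom: "iso_in C X Y f \<Longrightarrow> Inv C f \<in> hom C Y X"
  using iso_Inv[of X Y f] by (auto simp: iso_in_def inverse_arrows_def hom_def)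

lemma iso_Inv_Comp: "iso_in C X Y f \<Longrightarrow> Inv C f \<cdot> f = Id C X" "iso_in C X Y f \<Longrightarrow> f \<cdot> Inv C f = Id C Y"
  using iso_Inv[of X Y f] by (auto simp: iso_in_def inverse_arrows_def hom_def)

lemma iso_inI: "f \<in> hom C X Y \<Longrightarrow> g \<in> hom C Y X \<Longrightarrow> g \<cdot> f = Id C X \<Longrightarrow> f \<cdot> g = Id C Y \<Longrightarrow> iso_in C X Y f"
  by (auto simp: iso_in_def inverse_arrows_def hom_def)

lemma Inv_eqI': "f \<in> hom C X Y \<Longrightarrow> g \<in> hom C Y X \<Longrightarrow> g \<cdot> f = Id C X \<Longrightarrow> f \<cdot> g = Id C Y \<Longrightarrow> Inv C f = g"
  by (rule Inv_eqI) (auto simp: inverse_arrows_def hom_def)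

lemma iso_Comp:
  assumes "iso_in C X Y f" "iso_in C Y Z g"
  shows "iso_in C X Z (g \<cdot> f)"
proof (rule iso_inI)
  note h = iso_Inv_hom[OF assms(1)] iso_Inv_hom[OF assms(2)] and c = iso_Inv_Comp[OF assms(1)] iso_Inv_Comp[OF assms(2)]
  have f: "f \<in> hom C X Y" "g \<in> hom C Y Z" using assms by (auto simp: iso_in_def)
  note f' = hom_Ob[OF f(1)] hom_Ob[OF f(2)]
  show "g \<cdot> f \<in> hom C X Z" using f Comp_hom by blast
  show "Inv C f \<cdot> Inv C g \<in> hom C Z X" using h Comp_hom by blast
  have "Inv C g \<cdot> g \<cdot> f = f" using f f' h c reassoc[of "Inv C g" g "Id C Y" f] by (auto simp: hom_def)
  then show "(Inv C f \<cdot> Inv C g) \<cdot> g \<cdot> f = Id C X" using f h c by (auto simp: hom_def)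
  have "f \<cdot> Inv C f \<cdot> Inv C g = Inv C g" using f f' h c reassoc[of f "Inv C f" "Id C Y" "Inv C g"] by (auto simp: hom_def)
  then show "(g \<cdot> f) \<cdot> Inv C f \<cdot> Inv C g = Id C Z" using f h c by (auto simp: hom_def)
qed

lemma iso_Id: "X \<in> Ob C \<Longrightarrow> iso_in C X X (Id C X)"
  by (rule iso_inI[of _ _ _ "Id C X"]) (auto simp: hom_def)

lemma iso_cancel_right:
  assumes "iso_in C X Y k" "f \<in> Arr C" "g \<in> Arr C" "Dom C f = Y" "Dom C g = Y" "f \<cdot> k = g \<cdot> k"
  shows "f = g"
proof -
  have k: "k \<in> hom C X Y" using assms by (auto simp: iso_in_def)
  note i = iso_Inv_hom[OF assms(1)] iso_Inv_Comp[OF assms(1)]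
  have "f = (f \<cdot> k) \<cdot> Inv C k" using assms(2-5) i k by (simp add: hom_def)
  also have "\<dots> = (g \<cdot> k) \<cdot> Inv C k" using assms by simp
  also have "\<dots> = g" using assms(2-5) i k by (simp add: hom_def)
  finally show ?thesis .
qed

lemma iso_cancel_left:
  assumes "iso_in C X Y k" "f \<in> Arr C" "g \<in> Arr C" "Cod C f = X" "Cod C g = X" "k \<cdot> f = k \<cdot> g"
  shows "f = g"
proof -
  have k: "k \<in> hom C X Y" using assms by (auto simp: iso_in_def)
  note i = iso_Inv_hom[OF assms(1)] iso_Inv_Comp[OF assms(1)]
  have "Inv C k \<cdot> (k \<cdot> f) = Inv C k \<cdot> (k \<cdot> g)" using assms by simp
  moreover have "Inv C k \<cdot> (k \<cdot> f) = f" "Inv C k \<cdot> (k \<cdot> g) = g"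
    using assms(2-5) i k hom_Ob[OF k] reassoc[OF i(2)] by (auto simp: hom_def)
  ultimately show ?thesis by simp
qed

end

section \<open>Calculus of the monoidal structure: whiskering, naturality, unit laws\<close>

context autonomous_category
begin

declare Unit_Ob [simp] TensO_Ob [simp] LolliO_Ob [simp] TensM_Id [simp]

abbreviation assoc' :: "'o \<Rightarrow> 'o \<Rightarrow> 'o \<Rightarrow> 'm" where
  "assoc' X Y Z \<equiv> Inv C (Assoc C X Y Z)"

abbreviation whisker_left :: "'o \<Rightarrow> 'm \<Rightarrow> 'm" (infixr "\<lhd>" 70) where
  "X \<lhd> f \<equiv> Id C X \<otimes>\<^sub>m f"

abbreviation whisker_right :: "'m \<Rightarrow> 'o \<Rightarrow> 'm" (infixr "\<rhd>" 70) where
  "f \<rhd> X \<equiv> f \<otimes>\<^sub>m Id C X"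

lemma TensM_hom: "f \<in> hom C X X' \<Longrightarrow> g \<in> hom C Y Y' \<Longrightarrow> f \<otimes>\<^sub>m g \<in> hom C (X \<otimes>\<^sub>o Y) (X' \<otimes>\<^sub>o Y')"
  using vfunctor_Pi[OF TensM_vfunctor, of X X' Y Y' "(f, g)"] hom_Ob by auto

lemma Arr_TensM [simp]:
  assumes "f \<in> Arr C" "g \<in> Arr C"
  shows "f \<otimes>\<^sub>m g \<in> Arr C" "Dom C (f \<otimes>\<^sub>m g) = Dom C f \<otimes>\<^sub>o Dom C g" "Cod C (f \<otimes>\<^sub>m g) = Cod C f \<otimes>\<^sub>o Cod C g"
  using TensM_hom[of f "Dom C f" "Cod C f" g "Dom C g" "Cod C g"] assms by (auto simp: hom_def)

lemma Dist_TensM: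
  assumes "f \<in> hom C X X'" "f' \<in> hom C X X'" "g \<in> hom C Y Y'" "g' \<in> hom C Y Y'"
  shows "Dist C f f' * Dist C g g' \<le> Dist C (f \<otimes>\<^sub>m g) (f' \<otimes>\<^sub>m g')"
  using vfunctor_le[OF TensM_vfunctor, of X X' Y Y' "(f, g)" "(f', g')"] assms hom_Ob
  by (auto simp: vtensor_def)

text \<open>Oriented so as to fuse neighbouring tensors. Where a factor has to stay visible for a
  later rewrite, this rule and its tailed form are switched off.\<close>

lemma interchange [simp]:
  "\<lbrakk>f \<in> Arr C; f' \<in> Arr C; g \<in> Arr C; g' \<in> Arr C; Cod C f = Dom C f'; Cod C g = Dom C g'\<rbrakk>
    \<Longrightarrow> (f' \<otimes>\<^sub>m g') \<cdot> (f \<otimes>\<^sub>m g) = (f' \<cdot> f) \<otimes>\<^sub>m (g' \<cdot> g)"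
  using TensM_Comp[of f "Dom C f" "Cod C f" f' "Cod C f'" g "Dom C g" "Cod C g" g' "Cod C g'"]
  by (simp add: hom_def)

lemma interchange' [simp]:
  assumes "f \<in> Arr C" "f' \<in> Arr C" "g \<in> Arr C" "g' \<in> Arr C" "Cod C f = Dom C f'" "Cod C g = Dom C g'"
    "k \<in> Arr C" "Cod C k = Dom C f \<otimes>\<^sub>o Dom C g"
  shows "(f' \<otimes>\<^sub>m g') \<cdot> (f \<otimes>\<^sub>m g) \<cdot> k = ((f' \<cdot> f) \<otimes>\<^sub>m (g' \<cdot> g)) \<cdot> k"
  using assms by (intro reassoc) auto

lemma iso_TensM:
  assumes "iso_in C X X' f" "iso_in C Y Y' g"
  shows "iso_in C (X \<otimes>\<^sub>o Y) (X' \<otimes>\<^sub>o Y') (f \<otimes>\<^sub>m g)"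
proof (rule iso_inI)
  note h = iso_Inv_hom[OF assms(1)] iso_Inv_hom[OF assms(2)] and c = iso_Inv_Comp[OF assms(1)] iso_Inv_Comp[OF assms(2)]
  have f: "f \<in> hom C X X'" "g \<in> hom C Y Y'" using assms by (auto simp: iso_in_def)
  show "f \<otimes>\<^sub>m g \<in> hom C (X \<otimes>\<^sub>o Y) (X' \<otimes>\<^sub>o Y')" using f TensM_hom by blast
  show "Inv C f \<otimes>\<^sub>m Inv C g \<in> hom C (X' \<otimes>\<^sub>o Y') (X \<otimes>\<^sub>o Y)" using h TensM_hom by blast
  show "(Inv C f \<otimes>\<^sub>m Inv C g) \<cdot> (f \<otimes>\<^sub>m g) = Id C (X \<otimes>\<^sub>o Y)"
    "(f \<otimes>\<^sub>m g) \<cdot> (Inv C f \<otimes>\<^sub>m Inv C g) = Id C (X' \<otimes>\<^sub>o Y')"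
    using f h c hom_Ob[OF f(1)] hom_Ob[OF f(2)] by (auto simp: hom_def)
qed

lemma Arr_Assoc [simp]:
  assumes "X \<in> Ob C" "Y \<in> Ob C" "Z \<in> Ob C"
  shows "Assoc C X Y Z \<in> Arr C" "Dom C (Assoc C X Y Z) = (X \<otimes>\<^sub>o Y) \<otimes>\<^sub>o Z"
    "Cod C (Assoc C X Y Z) = X \<otimes>\<^sub>o (Y \<otimes>\<^sub>o Z)"
    "assoc' X Y Z \<in> Arr C" "Cod C (assoc' X Y Z) = (X \<otimes>\<^sub>o Y) \<otimes>\<^sub>o Z"
    "Dom C (assoc' X Y Z) = X \<otimes>\<^sub>o (Y \<otimes>\<^sub>o Z)"
    "Assoc C X Y Z \<cdot> assoc' X Y Z = Id C (X \<otimes>\<^sub>o (Y \<otimes>\<^sub>o Z))"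
    "assoc' X Y Z \<cdot> Assoc C X Y Z = Id C ((X \<otimes>\<^sub>o Y) \<otimes>\<^sub>o Z)"
  using Assoc_iso[OF assms] iso_Inv_hom[OF Assoc_iso[OF assms]] iso_Inv_Comp[OF Assoc_iso[OF assms]]
  by (auto simp: hom_def iso_in_def)

lemma Arr_LUnit [simp]:
  assumes "X \<in> Ob C"
  shows "LUnit C X \<in> Arr C" "Dom C (LUnit C X) = Unit C \<otimes>\<^sub>o X" "Cod C (LUnit C X) = X"
    "Inv C (LUnit C X) \<in> Arr C" "Cod C (Inv C (LUnit C X)) = Unit C \<otimes>\<^sub>o X" "Dom C (Inv C (LUnit C X)) = X"
    "LUnit C X \<cdot> Inv C (LUnit C X) = Id C X" "Inv C (LUnit C X) \<cdot> LUnit C X = Id C (Unit C \<otimes>\<^sub>o X)"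
  using LUnit_iso[OF assms] iso_Inv_hom[OF LUnit_iso[OF assms]] iso_Inv_Comp[OF LUnit_iso[OF assms]]
  by (auto simp: hom_def iso_in_def)

lemma Arr_RUnit [simp]:
  assumes "X \<in> Ob C"
  shows "RUnit C X \<in> Arr C" "Dom C (RUnit C X) = X \<otimes>\<^sub>o Unit C" "Cod C (RUnit C X) = X"
    "Inv C (RUnit C X) \<in> Arr C" "Cod C (Inv C (RUnit C X)) = X \<otimes>\<^sub>o Unit C" "Dom C (Inv C (RUnit C X)) = X"
    "RUnit C X \<cdot> Inv C (RUnit C X) = Id C X" "Inv C (RUnit C X) \<cdot> RUnit C X = Id C (X \<otimes>\<^sub>o Unit C)"
  using RUnit_iso[OF assms] iso_Inv_hom[OF RUnit_iso[OF assms]] iso_Inv_Comp[OF RUnit_iso[OF assms]]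
  by (auto simp: hom_def iso_in_def)

lemma Arr_Sym [simp]:
  assumes "X \<in> Ob C" "Y \<in> Ob C"
  shows "Sym C X Y \<in> Arr C" "Dom C (Sym C X Y) = X \<otimes>\<^sub>o Y" "Cod C (Sym C X Y) = Y \<otimes>\<^sub>o X"
    "Sym C Y X \<cdot> Sym C X Y = Id C (X \<otimes>\<^sub>o Y)"
  using Sym_hom[OF assms] Sym_Sym[OF assms] by (auto simp: hom_def)

lemma Sym_iso: "X \<in> Ob C \<Longrightarrow> Y \<in> Ob C \<Longrightarrow> iso_in C (X \<otimes>\<^sub>o Y) (Y \<otimes>\<^sub>o X) (Sym C X Y)"
  by (rule iso_inI[of _ _ _ "Sym C Y X"]) (auto simp: hom_def)

text \<open>Inverse pairs of structure maps at the head of a right-nested composite, where the plain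
  inverse laws do not match.\<close>

lemma cancel [simp]:
  assumes "k \<in> Arr C"
  shows "\<lbrakk>X \<in> Ob C; Y \<in> Ob C; Z \<in> Ob C; Cod C k = (X \<otimes>\<^sub>o Y) \<otimes>\<^sub>o Z\<rbrakk> \<Longrightarrow> assoc' X Y Z \<cdot> Assoc C X Y Z \<cdot> k = k"
    "\<lbrakk>X \<in> Ob C; Y \<in> Ob C; Z \<in> Ob C; Cod C k = X \<otimes>\<^sub>o (Y \<otimes>\<^sub>o Z)\<rbrakk> \<Longrightarrow> Assoc C X Y Z \<cdot> assoc' X Y Z \<cdot> k = k"
    "\<lbrakk>X \<in> Ob C; Y \<in> Ob C; Cod C k = X \<otimes>\<^sub>o Y\<rbrakk> \<Longrightarrow> Sym C Y X \<cdot> Sym C X Y \<cdot> k = k"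
    "\<lbrakk>X \<in> Ob C; Cod C k = Unit C \<otimes>\<^sub>o X\<rbrakk> \<Longrightarrow> Inv C (LUnit C X) \<cdot> LUnit C X \<cdot> k = k"
    "\<lbrakk>X \<in> Ob C; Cod C k = X\<rbrakk> \<Longrightarrow> LUnit C X \<cdot> Inv C (LUnit C X) \<cdot> k = k"
    "\<lbrakk>X \<in> Ob C; Cod C k = X \<otimes>\<^sub>o Unit C\<rbrakk> \<Longrightarrow> Inv C (RUnit C X) \<cdot> RUnit C X \<cdot> k = k"
    "\<lbrakk>X \<in> Ob C; Cod C k = X\<rbrakk> \<Longrightarrow> RUnit C X \<cdot> Inv C (RUnit C X) \<cdot> k = k"
  using assms by (subst reassoc[OF Arr_Assoc(8)] reassoc[OF Arr_Assoc(7)] reassoc[OF Arr_Sym(4)]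
    reassoc[OF Arr_LUnit(7)] reassoc[OF Arr_LUnit(8)] reassoc[OF Arr_RUnit(7)] reassoc[OF Arr_RUnit(8)]; simp)+

lemma Assoc_nat':
  "\<lbrakk>f \<in> Arr C; g \<in> Arr C; h \<in> Arr C; X' = Cod C f; Y' = Cod C g; Z' = Cod C h\<rbrakk> \<Longrightarrow>
    Assoc C X' Y' Z' \<cdot> ((f \<otimes>\<^sub>m g) \<otimes>\<^sub>m h) = (f \<otimes>\<^sub>m (g \<otimes>\<^sub>m h)) \<cdot> Assoc C (Dom C f) (Dom C g) (Dom C h)"
  using Assoc_nat by (auto simp: hom_def)

text \<open>The naturality square of \<open>Assoc\<close> read backwards, checked after composition
  with the isomorphism \<open>Assoc\<close>.\<close>

lemma Inv_Assoc_nat: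
  assumes "f \<in> Arr C" "g \<in> Arr C" "h \<in> Arr C" "X' = Cod C f" "Y' = Cod C g" "Z' = Cod C h"
  shows "assoc' X' Y' Z' \<cdot> (f \<otimes>\<^sub>m (g \<otimes>\<^sub>m h)) = ((f \<otimes>\<^sub>m g) \<otimes>\<^sub>m h) \<cdot> assoc' (Dom C f) (Dom C g) (Dom C h)"
proof (rule iso_cancel_right[OF Assoc_iso[of "Dom C f" "Dom C g" "Dom C h"]])
  show "(assoc' X' Y' Z' \<cdot> (f \<otimes>\<^sub>m g \<otimes>\<^sub>m h)) \<cdot> Assoc C (Dom C f) (Dom C g) (Dom C h) =
    (((f \<otimes>\<^sub>m g) \<otimes>\<^sub>m h) \<cdot> assoc' (Dom C f) (Dom C g) (Dom C h)) \<cdot> Assoc C (Dom C f) (Dom C g) (Dom C h)"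
    using assms by (simp add: Assoc_nat'[symmetric])
qed (use assms in simp_all)

lemmas Inv_Assoc_nat_refl = Inv_Assoc_nat[OF _ _ _ refl refl refl]

lemma Sym_nat':
  "\<lbrakk>f \<in> Arr C; g \<in> Arr C; X' = Cod C f; Y' = Cod C g\<rbrakk> \<Longrightarrow>
    Sym C X' Y' \<cdot> (f \<otimes>\<^sub>m g) = (g \<otimes>\<^sub>m f) \<cdot> Sym C (Dom C f) (Dom C g)"
  using Sym_nat by (auto simp: hom_def)

lemmas Sym_nat_refl = Sym_nat'[OF _ _ refl refl]

lemma LUnit_nat': "f \<in> Arr C \<Longrightarrow> Y = Cod C f \<Longrightarrow> LUnit C Y \<cdot> ((Unit C) \<lhd> f) = f \<cdot> LUnit C (Dom C f)"
  using LUnit_nat by (auto simp: hom_def)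

lemma RUnit_nat': "f \<in> Arr C \<Longrightarrow> Y = Cod C f \<Longrightarrow> RUnit C Y \<cdot> (f \<rhd> (Unit C)) = f \<cdot> RUnit C (Dom C f)"
  using RUnit_nat by (auto simp: hom_def)

text \<open>The denotation of a pattern match. The context \<open>T\<close> of the body stands to
  the right of the matched pair; the symmetry moves it to the front and \<open>assoc'\<close> nests
  it to the left, as the body \<open>n\<close> expects.\<close>

abbreviation pm_mor :: "'o \<Rightarrow> 'o \<Rightarrow> 'o \<Rightarrow> 'm \<Rightarrow> 'm \<Rightarrow> 'm" where
  "pm_mor T X Y m n \<equiv> n \<cdot> assoc' T X Y \<cdot> Sym C (X \<otimes>\<^sub>o Y) T \<cdot> (m \<rhd> T)"

text \<open>Naturality in the two contexts. It serves twice: with the denotations of substituted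
  terms as \<open>f\<close> and \<open>g\<close>, and with canonical isomorphisms.\<close>

lemma pm_mor_nat:
  assumes "m \<in> Arr C" "n \<in> Arr C" "f \<in> Arr C" "g \<in> Arr C" "X \<in> Ob C" "Y \<in> Ob C" "T = Cod C g" "T' = Dom C g"
    "Cod C f = Dom C m" "Cod C m = X \<otimes>\<^sub>o Y" "Dom C n = (T \<otimes>\<^sub>o X) \<otimes>\<^sub>o Y"
  shows "pm_mor T' X Y (m \<cdot> f) (n \<cdot> ((g \<rhd> X) \<rhd> Y)) = pm_mor T X Y m n \<cdot> (f \<otimes>\<^sub>m g)"
proof -
  have "pm_mor T' X Y (m \<cdot> f) (n \<cdot> ((g \<rhd> X) \<rhd> Y)) =
      n \<cdot> (((g \<rhd> X) \<rhd> Y) \<cdot> assoc' T' X Y) \<cdot> Sym C (X \<otimes>\<^sub>o Y) T' \<cdot> ((m \<cdot> f) \<rhd> T')"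
    using assms by simp
  also have "\<dots> = n \<cdot> assoc' T X Y \<cdot> ((g \<rhd> (X \<otimes>\<^sub>o Y)) \<cdot> Sym C (X \<otimes>\<^sub>o Y) T') \<cdot> ((m \<cdot> f) \<rhd> T')"
    using reassoc[OF Inv_Assoc_nat_refl[of g "Id C X" "Id C Y"],
        of "Sym C (X \<otimes>\<^sub>o Y) T' \<cdot> ((m \<cdot> f) \<rhd> T')"] assms
    by simp
  also have "\<dots> = n \<cdot> assoc' T X Y \<cdot> Sym C (X \<otimes>\<^sub>o Y) T \<cdot> ((X \<otimes>\<^sub>o Y) \<lhd> g) \<cdot> ((m \<cdot> f) \<rhd> T')"
    using Sym_nat_refl[of "Id C (X \<otimes>\<^sub>o Y)" g, symmetric] assms by simp
  also have "\<dots> = pm_mor T X Y m n \<cdot> (f \<otimes>\<^sub>m g)"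
    using assms by simp
  finally show ?thesis .
qed

text \<open>\<open>LUnit\<close> makes tensoring with the unit isomorphic to the identity functor,
  hence faithful.\<close>

lemma Unit_TensM_faithful:
  assumes "f \<in> Arr C" "g \<in> Arr C" "Dom C f = Dom C g" "Cod C f = Cod C g"
    "(Unit C) \<lhd> f = (Unit C) \<lhd> g"
  shows "f = g"
proof (rule iso_cancel_right[OF LUnit_iso[of "Dom C f"]])
  show "f \<cdot> LUnit C (Dom C f) = g \<cdot> LUnit C (Dom C f)"
    using LUnit_nat'[OF assms(1) refl] LUnit_nat'[OF assms(2) refl] assms by simp
qed (use assms in simp_all)

text \<open>The mirror image; it also ends the proof of coherence, where the empty list leaves a
  factor \<open>Unit C\<close> on the right.\<close>

lemma TensM_Unit_faithful:
  assumes "f \<in> Arr C" "g \<in> Arr C" "Dom C f = Dom C g" "Cod C f = Cod C g"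
    "f \<rhd> (Unit C) = g \<rhd> (Unit C)"
  shows "f = g"
proof (rule iso_cancel_right[OF RUnit_iso[of "Dom C f"]])
  show "f \<cdot> RUnit C (Dom C f) = g \<cdot> RUnit C (Dom C f)"
    using RUnit_nat'[OF assms(1) refl] RUnit_nat'[OF assms(2) refl] assms by simp
qed (use assms in simp_all)

text \<open>Kelly's derivation of this unit law from pentagon and triangle: after tensoring with I
  on the left, the pentagon for I, I, X, Y brings both sides within reach of the triangle.\<close>

lemma LUnit_TensO:
  assumes [simp]: "X \<in> Ob C" "Y \<in> Ob C"
  shows "LUnit C (X \<otimes>\<^sub>o Y) \<cdot> Assoc C (Unit C) X Y = LUnit C X \<rhd> Y"
proof (rule Unit_TensM_faithful)
  let ?I = "Unit C"
  \<comment> \<open>The two rightmost factors of the long side of the pentagon; the left-hand side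
    of the goal contributes the third.\<close>
  let ?k = "Assoc C ?I (?I \<otimes>\<^sub>o X) Y \<cdot> (Assoc C ?I ?I X \<rhd> Y)"
  have "iso_in C (((?I \<otimes>\<^sub>o ?I) \<otimes>\<^sub>o X) \<otimes>\<^sub>o Y) (?I \<otimes>\<^sub>o ((?I \<otimes>\<^sub>o X) \<otimes>\<^sub>o Y)) ?k"
    by (rule iso_Comp[OF iso_TensM[OF Assoc_iso iso_Id] Assoc_iso]) simp_all
  then show "?I \<lhd> (LUnit C (X \<otimes>\<^sub>o Y) \<cdot> Assoc C ?I X Y) = ?I \<lhd> LUnit C X \<rhd> Y"
  proof (rule iso_cancel_right)
    have "(?I \<lhd> (LUnit C (X \<otimes>\<^sub>o Y) \<cdot> Assoc C ?I X Y)) \<cdot> ?k =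
        (?I \<lhd> LUnit C (X \<otimes>\<^sub>o Y)) \<cdot> ((?I \<lhd> Assoc C ?I X Y) \<cdot> ?k)"
      by simp
    also have "\<dots> = (?I \<lhd> LUnit C (X \<otimes>\<^sub>o Y)) \<cdot> Assoc C ?I ?I (X \<otimes>\<^sub>o Y) \<cdot> Assoc C (?I \<otimes>\<^sub>o ?I) X Y"
      by (subst pentagon) simp_all
    also have "\<dots> = (RUnit C ?I \<rhd> (X \<otimes>\<^sub>o Y)) \<cdot> Assoc C (?I \<otimes>\<^sub>o ?I) X Y"
      by (subst reassoc[OF triangle]) simp_all
    also have "\<dots> = Assoc C ?I X Y \<cdot> ((RUnit C ?I \<rhd> X) \<rhd> Y)"
      by (subst Assoc_nat') simp_all
    also have "\<dots> = Assoc C ?I X Y \<cdot> (((?I \<lhd> LUnit C X) \<rhd> Y) \<cdot> (Assoc C ?I ?I X \<rhd> Y))"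
      by (subst triangle[symmetric]) simp_all
    also have "\<dots> = (?I \<lhd> LUnit C X \<rhd> Y) \<cdot> ?k"
      by (subst reassoc[OF Assoc_nat']) simp_all
    finally show "(?I \<lhd> (LUnit C (X \<otimes>\<^sub>o Y) \<cdot> Assoc C ?I X Y)) \<cdot> ?k = (?I \<lhd> LUnit C X \<rhd> Y) \<cdot> ?k" .
  qed simp_all
qed simp_all

text \<open>Compatibility of the units with the symmetry is not an axiom. It follows from the
  hexagon for X, I, I after tensoring with I on the right.\<close>

lemma LUnit_Sym:
  assumes [simp]: "X \<in> Ob C"
  shows "LUnit C X \<cdot> Sym C X (Unit C) = RUnit C X"
proof (rule TensM_Unit_faithful)
  let ?I = "Unit C"
  \<comment> \<open>Naturality of \<open>LUnit\<close> at \<open>Sym C X ?I\<close>, solved for its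
    value at \<open>X \<otimes>\<^sub>o ?I\<close>: it supplies the whiskered symmetry with which
    the hexagon begins.\<close>
  have L: "LUnit C (X \<otimes>\<^sub>o ?I) = Sym C ?I X \<cdot> LUnit C (?I \<otimes>\<^sub>o X) \<cdot> (?I \<lhd> Sym C X ?I)"
    by (subst LUnit_nat') simp_all
  have "(LUnit C X \<cdot> Sym C X ?I) \<rhd> ?I = (LUnit C X \<rhd> ?I) \<cdot> (Sym C X ?I \<rhd> ?I)"
    by simp
  also have "\<dots> = LUnit C (X \<otimes>\<^sub>o ?I) \<cdot> Assoc C ?I X ?I \<cdot> (Sym C X ?I \<rhd> ?I)"
    by (subst LUnit_TensO[symmetric]) simp_all
  also have "\<dots> = Sym C ?I X \<cdot> LUnit C (?I \<otimes>\<^sub>o X) \<cdot>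
      ((?I \<lhd> Sym C X ?I) \<cdot> Assoc C ?I X ?I \<cdot> (Sym C X ?I \<rhd> ?I))"
    by (subst L) (simp del: interchange interchange')
  also have "\<dots> = Sym C ?I X \<cdot> LUnit C (?I \<otimes>\<^sub>o X) \<cdot> Assoc C ?I ?I X \<cdot> Sym C X (?I \<otimes>\<^sub>o ?I) \<cdot> Assoc C X ?I ?I"
    by (subst hexagon[symmetric]) simp_all
  also have "\<dots> = Sym C ?I X \<cdot> (LUnit C ?I \<rhd> X) \<cdot> Sym C X (?I \<otimes>\<^sub>o ?I) \<cdot> Assoc C X ?I ?I"
    by (subst reassoc[OF LUnit_TensO]) simp_all
  also have "\<dots> = Sym C ?I X \<cdot> Sym C X ?I \<cdot> (X \<lhd> LUnit C ?I) \<cdot> Assoc C X ?I ?I"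
    by (subst (2) reassoc[OF Sym_nat']) simp_all
  also have "\<dots> = RUnit C X \<rhd> ?I"
    by (subst triangle) simp_all
  finally show "(LUnit C X \<cdot> Sym C X ?I) \<rhd> ?I = RUnit C X \<rhd> ?I" .
qed simp_all

lemma RUnit_Sym:
  assumes [simp]: "X \<in> Ob C"
  shows "RUnit C X \<cdot> Sym C (Unit C) X = LUnit C X"
  by (subst LUnit_Sym[symmetric]) simp_all

section \<open>Exchange of neighbours in a right-nested tensor\<close>

definition twist :: "'o \<Rightarrow> 'o \<Rightarrow> 'o \<Rightarrow> 'm" where
  "twist X Y Z = Assoc C Y X Z \<cdot> (Sym C X Y \<rhd> Z) \<cdot> assoc' X Y Z"

lemma Arr_twist [simp]:
  assumes "X \<in> Ob C" "Y \<in> Ob C" "Z \<in> Ob C"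
  shows "twist X Y Z \<in> Arr C" "Dom C (twist X Y Z) = X \<otimes>\<^sub>o (Y \<otimes>\<^sub>o Z)"
    "Cod C (twist X Y Z) = Y \<otimes>\<^sub>o (X \<otimes>\<^sub>o Z)" "twist Y X Z \<cdot> twist X Y Z = Id C (X \<otimes>\<^sub>o (Y \<otimes>\<^sub>o Z))"
  using assms by (simp_all add: twist_def)

lemma twist_cancel [simp]:
  "\<lbrakk>X \<in> Ob C; Y \<in> Ob C; Z \<in> Ob C; k \<in> Arr C; Cod C k = X \<otimes>\<^sub>o (Y \<otimes>\<^sub>o Z)\<rbrakk>
    \<Longrightarrow> twist Y X Z \<cdot> twist X Y Z \<cdot> k = k"
  by (subst reassoc[OF Arr_twist(4)]) simp_all

lemma twist_nat:
  assumes "f \<in> Arr C" "g \<in> Arr C" "h \<in> Arr C" "X' = Cod C f" "Y' = Cod C g" "Z' = Cod C h"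
  shows "twist X' Y' Z' \<cdot> (f \<otimes>\<^sub>m (g \<otimes>\<^sub>m h)) = (g \<otimes>\<^sub>m (f \<otimes>\<^sub>m h)) \<cdot> twist (Dom C f) (Dom C g) (Dom C h)"
proof -
  have "twist X' Y' Z' \<cdot> (f \<otimes>\<^sub>m (g \<otimes>\<^sub>m h)) = Assoc C Y' X' Z' \<cdot> ((Sym C X' Y' \<cdot> (f \<otimes>\<^sub>m g)) \<otimes>\<^sub>m h) \<cdot> assoc' (Dom C f) (Dom C g) (Dom C h)"
    using assms by (simp add: twist_def Inv_Assoc_nat)
  also have "\<dots> = Assoc C Y' X' Z' \<cdot> ((g \<otimes>\<^sub>m f) \<otimes>\<^sub>m h) \<cdot> (Sym C (Dom C f) (Dom C g) \<rhd> (Dom C h)) \<cdot> assoc' (Dom C f) (Dom C g) (Dom C h)"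
    using assms by (simp add: Sym_nat')
  also have "\<dots> = (g \<otimes>\<^sub>m (f \<otimes>\<^sub>m h)) \<cdot> twist (Dom C f) (Dom C g) (Dom C h)"
    using assms by (subst reassoc[OF Assoc_nat']) (simp_all add: twist_def)
  finally show ?thesis .
qed

lemmas twist_nat_refl = twist_nat[OF _ _ _ refl refl refl]

text \<open>The triangle turns the left unit of \<open>Z\<close> into a right unit of
  \<open>Y\<close>, and \<open>RUnit_Sym\<close> absorbs the symmetry. This becomes the case
  \<open>Empty\<close> in \<open>commuting_leaves\<close>.\<close>

lemma twist_Unit:
  assumes [simp]: "Y \<in> Ob C" "Z \<in> Ob C"
  shows "(Y \<lhd> LUnit C Z) \<cdot> twist (Unit C) Y Z = LUnit C (Y \<otimes>\<^sub>o Z)"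
proof -
  have "(Y \<lhd> LUnit C Z) \<cdot> twist (Unit C) Y Z = (RUnit C Y \<rhd> Z) \<cdot> (Sym C (Unit C) Y \<rhd> Z) \<cdot> assoc' (Unit C) Y Z"
    unfolding twist_def by (subst reassoc[OF triangle]) simp_all
  also have "\<dots> = (LUnit C Y \<rhd> Z) \<cdot> assoc' (Unit C) Y Z"
    by (simp add: RUnit_Sym)
  also have "\<dots> = LUnit C (Y \<otimes>\<^sub>o Z)"
    by (subst LUnit_TensO[symmetric]) simp_all
  finally show ?thesis .
qed

text \<open>The second hexagon: the first one for Z, X, Y with both sides inverted, where the
  inverse of a symmetry is again a symmetry.\<close>

lemma hexagon':
  assumes [simp]: "X \<in> Ob C" "Y \<in> Ob C" "Z \<in> Ob C"
  shows "assoc' Z X Y \<cdot> Sym C (X \<otimes>\<^sub>o Y) Z =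
    (Sym C X Z \<rhd> Y) \<cdot> assoc' X Z Y \<cdot> (X \<lhd> Sym C Y Z) \<cdot> Assoc C X Y Z" (is "?l = ?r")
proof -
  let ?h = "(X \<lhd> Sym C Z Y) \<cdot> Assoc C X Z Y \<cdot> (Sym C Z X \<rhd> Y)"
  \<comment> \<open>Insert the inverse of \<open>?l\<close> and then \<open>?l\<close>. The last
    associator of \<open>?r\<close> completes the inverse to a side of the hexagon, and the other
    side \<open>?h\<close> cancels the rest of \<open>?r\<close>.\<close>
  have "?r = ?r \<cdot> (Sym C Z (X \<otimes>\<^sub>o Y) \<cdot> Assoc C Z X Y) \<cdot> ?l" by (simp del: interchange interchange')
  also have "\<dots> = (Sym C X Z \<rhd> Y) \<cdot> assoc' X Z Y \<cdot> (X \<lhd> Sym C Y Z) \<cdot>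
      (Assoc C X Y Z \<cdot> Sym C Z (X \<otimes>\<^sub>o Y) \<cdot> Assoc C Z X Y) \<cdot> ?l"
    by (simp del: interchange interchange')
  also have "\<dots> = (Sym C X Z \<rhd> Y) \<cdot> assoc' X Z Y \<cdot> (X \<lhd> Sym C Y Z) \<cdot> ?h \<cdot> ?l"
    by (subst hexagon) simp_all
  also have "\<dots> = ?l" by simp
  finally show ?thesis by simp
qed

text \<open>A pair passes \<open>Z\<close> by letting \<open>Y\<close> pass first and then
  \<open>X\<close>. The symmetry of the pair is expanded by \<open>hexagon'\<close>, and pentagons
  absorb the change of brackets.\<close>

lemma twist_TensO:
  assumes [simp]: "X \<in> Ob C" "Y \<in> Ob C" "Z \<in> Ob C" "W \<in> Ob C"
  shows "(Z \<lhd> Assoc C X Y W) \<cdot> twist (X \<otimes>\<^sub>o Y) Z W =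
    twist X Z (Y \<otimes>\<^sub>o W) \<cdot> (X \<lhd> twist Y Z W) \<cdot> Assoc C X Y (Z \<otimes>\<^sub>o W)"
proof (rule iso_cancel_right[OF Assoc_iso[of "X \<otimes>\<^sub>o Y" Z W]])
  \<comment> \<open>The pentagon with its rightmost factor moved to the other side.\<close>
  have pent: "(A \<lhd> Assoc C B D W) \<cdot> Assoc C A (B \<otimes>\<^sub>o D) W =
      Assoc C A B (D \<otimes>\<^sub>o W) \<cdot> Assoc C (A \<otimes>\<^sub>o B) D W \<cdot> (assoc' A B D \<rhd> W)"
    if [simp]: "A \<in> Ob C" "B \<in> Ob C" "D \<in> Ob C" for A B D
  proof -
    have "Assoc C A B (D \<otimes>\<^sub>o W) \<cdot> Assoc C (A \<otimes>\<^sub>o B) D W \<cdot> (assoc' A B D \<rhd> W) =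
      (Assoc C A B (D \<otimes>\<^sub>o W) \<cdot> Assoc C (A \<otimes>\<^sub>o B) D W) \<cdot> (assoc' A B D \<rhd> W)" by simp
    also have "\<dots> = (A \<lhd> Assoc C B D W) \<cdot> Assoc C A (B \<otimes>\<^sub>o D) W"
      by (subst pentagon) simp_all
    finally show ?thesis by simp
  qed
  let ?m = "(Sym C X Z \<rhd> Y) \<cdot> assoc' X Z Y \<cdot> (X \<lhd> Sym C Y Z) \<cdot> Assoc C X Y Z"
  have "((Z \<lhd> Assoc C X Y W) \<cdot> twist (X \<otimes>\<^sub>o Y) Z W) \<cdot> Assoc C (X \<otimes>\<^sub>o Y) Z W =
      (Z \<lhd> Assoc C X Y W) \<cdot> Assoc C Z (X \<otimes>\<^sub>o Y) W \<cdot> (Sym C (X \<otimes>\<^sub>o Y) Z \<rhd> W)"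
    by (simp add: twist_def)
  also have "\<dots> = Assoc C Z X (Y \<otimes>\<^sub>o W) \<cdot> Assoc C (Z \<otimes>\<^sub>o X) Y W \<cdot> ((assoc' Z X Y \<cdot> Sym C (X \<otimes>\<^sub>o Y) Z) \<rhd> W)"
    by (subst reassoc[OF pent]) simp_all
  also have "\<dots> = Assoc C Z X (Y \<otimes>\<^sub>o W) \<cdot> Assoc C (Z \<otimes>\<^sub>o X) Y W \<cdot> (?m \<rhd> W)"
    by (subst hexagon') simp_all
  finally have 1: "((Z \<lhd> Assoc C X Y W) \<cdot> twist (X \<otimes>\<^sub>o Y) Z W) \<cdot> Assoc C (X \<otimes>\<^sub>o Y) Z W =
      Assoc C Z X (Y \<otimes>\<^sub>o W) \<cdot> Assoc C (Z \<otimes>\<^sub>o X) Y W \<cdot> (?m \<rhd> W)" .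
  have p: "Assoc C X Y (Z \<otimes>\<^sub>o W) \<cdot> Assoc C (X \<otimes>\<^sub>o Y) Z W =
      (X \<lhd> Assoc C Y Z W) \<cdot> Assoc C X (Y \<otimes>\<^sub>o Z) W \<cdot> (Assoc C X Y Z \<rhd> W)"
    by (rule pentagon) simp_all
  let ?t = "Assoc C Z X (Y \<otimes>\<^sub>o W) \<cdot> (Sym C X Z \<rhd> (Y \<otimes>\<^sub>o W)) \<cdot> assoc' X Z (Y \<otimes>\<^sub>o W)"
  have "(twist X Z (Y \<otimes>\<^sub>o W) \<cdot> (X \<lhd> twist Y Z W) \<cdot> Assoc C X Y (Z \<otimes>\<^sub>o W)) \<cdot> Assoc C (X \<otimes>\<^sub>o Y) Z W =
     ?t \<cdot> (X \<lhd> twist Y Z W) \<cdot> Assoc C X Y (Z \<otimes>\<^sub>o W) \<cdot> Assoc C (X \<otimes>\<^sub>o Y) Z W"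
    by (simp add: twist_def[of X Z])
  also have "\<dots> = ?t \<cdot> (X \<lhd> Assoc C Z Y W) \<cdot> (X \<lhd> (Sym C Y Z \<rhd> W)) \<cdot> Assoc C X (Y \<otimes>\<^sub>o Z) W \<cdot> (Assoc C X Y Z \<rhd> W)"
    by (subst p) (simp add: twist_def)
  also have "\<dots> = ?t \<cdot> ((X \<lhd> Assoc C Z Y W) \<cdot> Assoc C X (Z \<otimes>\<^sub>o Y) W) \<cdot> ((X \<lhd> Sym C Y Z) \<rhd> W) \<cdot> (Assoc C X Y Z \<rhd> W)"
    using reassoc[OF Assoc_nat'[of "Id C X" "Sym C Y Z" "Id C W", OF _ _ _ refl refl refl, symmetric], of "Assoc C X Y Z \<rhd> W"]
    by (simp del: interchange interchange')
  also have "\<dots> = Assoc C Z X (Y \<otimes>\<^sub>o W) \<cdot> (Sym C X Z \<otimes>\<^sub>m (Y \<lhd> Id C W)) \<cdot> Assoc C (X \<otimes>\<^sub>o Z) Y W \<cdot>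
     ((assoc' X Z Y \<cdot> (X \<lhd> Sym C Y Z) \<cdot> Assoc C X Y Z) \<rhd> W)"
    by (subst pent) simp_all
  also have "\<dots> = Assoc C Z X (Y \<otimes>\<^sub>o W) \<cdot> Assoc C (Z \<otimes>\<^sub>o X) Y W \<cdot> (?m \<rhd> W)"
    using reassoc[OF Assoc_nat'[of "Sym C X Z" "Id C Y" "Id C W", OF _ _ _ refl refl refl, symmetric],
        of "(assoc' X Z Y \<cdot> (X \<lhd> Sym C Y Z) \<cdot> Assoc C X Y Z) \<rhd> W"]
    by simp
  finally show "((Z \<lhd> Assoc C X Y W) \<cdot> twist (X \<otimes>\<^sub>o Y) Z W) \<cdot> Assoc C (X \<otimes>\<^sub>o Y) Z W =
    (twist X Z (Y \<otimes>\<^sub>o W) \<cdot> (X \<lhd> twist Y Z W) \<cdot> Assoc C X Y (Z \<otimes>\<^sub>o W)) \<cdot> Assoc C (X \<otimes>\<^sub>o Y) Z W"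
    using 1 by simp
qed simp_all

text \<open>Both sides move the pair of \<open>X\<close> and \<open>Y\<close> past \<open>Z\<close>
  as one object, by \<open>twist_TensO\<close>, and exchange \<open>X\<close> with \<open>Y\<close>
  after or before that. Naturality of \<open>twist\<close> at \<open>Sym C X Y\<close> compares the
  two.\<close>

lemma twist_braid:
  assumes [simp]: "X \<in> Ob C" "Y \<in> Ob C" "Z \<in> Ob C" "W \<in> Ob C"
  shows "(Z \<lhd> twist X Y W) \<cdot> twist X Z (Y \<otimes>\<^sub>o W) \<cdot> (X \<lhd> twist Y Z W) =
    twist Y Z (X \<otimes>\<^sub>o W) \<cdot> (Y \<lhd> twist X Z W) \<cdot> twist X Y (Z \<otimes>\<^sub>o W)"
proof -
  have "twist X Z (Y \<otimes>\<^sub>o W) \<cdot> (X \<lhd> twist Y Z W) =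
      (twist X Z (Y \<otimes>\<^sub>o W) \<cdot> (X \<lhd> twist Y Z W) \<cdot> Assoc C X Y (Z \<otimes>\<^sub>o W)) \<cdot> assoc' X Y (Z \<otimes>\<^sub>o W)"
    by simp
  also have "\<dots> = (Z \<lhd> Assoc C X Y W) \<cdot> twist (X \<otimes>\<^sub>o Y) Z W \<cdot> assoc' X Y (Z \<otimes>\<^sub>o W)"
    by (subst twist_TensO[symmetric]) simp_all
  finally have "(Z \<lhd> twist X Y W) \<cdot> twist X Z (Y \<otimes>\<^sub>o W) \<cdot> (X \<lhd> twist Y Z W) =
      (Z \<lhd> Assoc C Y X W) \<cdot> (Z \<lhd> (Sym C X Y \<rhd> W)) \<cdot> twist (X \<otimes>\<^sub>o Y) Z W \<cdot> assoc' X Y (Z \<otimes>\<^sub>o W)"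
    by (simp add: twist_def[of X Y W])
  also have "\<dots> = (Z \<lhd> Assoc C Y X W) \<cdot> twist (Y \<otimes>\<^sub>o X) Z W \<cdot> (Sym C X Y \<rhd> (Z \<otimes>\<^sub>o W)) \<cdot> assoc' X Y (Z \<otimes>\<^sub>o W)"
    using reassoc[OF twist_nat_refl[of "Sym C X Y" "Id C Z" "Id C W"], of "assoc' X Y (Z \<otimes>\<^sub>o W)"]
    by simp
  also have "\<dots> = ((Z \<lhd> Assoc C Y X W) \<cdot> twist (Y \<otimes>\<^sub>o X) Z W) \<cdot> (Sym C X Y \<rhd> (Z \<otimes>\<^sub>o W)) \<cdot> assoc' X Y (Z \<otimes>\<^sub>o W)"
    by simp
  also have "\<dots> = twist Y Z (X \<otimes>\<^sub>o W) \<cdot> (Y \<lhd> twist X Z W) \<cdot> twist X Y (Z \<otimes>\<^sub>o W)"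
    by (subst twist_TensO) (simp_all add: twist_def[of X Y])
  finally show ?thesis .
qed

end

section \<open>Coherence for symmetric monoidal categories\<close>

datatype 'g ctree = Leaf var "'g ty" | Empty | Node "'g ctree" "'g ctree"

primrec leaves :: "'g ctree \<Rightarrow> 'g ctx" where
  "leaves (Leaf x A) = [(x, A)]"
| "leaves Empty = []"
| "leaves (Node s t) = leaves s @ leaves t"

abbreviation labels :: "'g ctree \<Rightarrow> var set" where
  "labels t \<equiv> fst ` set (leaves t)"

abbreviation linear :: "'g ctree \<Rightarrow> bool" where
  "linear t \<equiv> distinct_vars (leaves t)"

text \<open>Every list ends in \<open>Empty\<close>, so an inserted leaf always has a tail behind it
  and \<open>twist\<close> applies to the last entry too.\<close>

primrec list_tree :: "'g ctx \<Rightarrow> 'g ctree" where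
  "list_tree [] = Empty"
| "list_tree (p # l) = Node (Leaf (fst p) (snd p)) (list_tree l)"

primrec ins :: "var \<times> 'g ty \<Rightarrow> 'g ctx \<Rightarrow> 'g ctx" where
  "ins p [] = [p]"
| "ins p (q # l) = (if fst p < fst q then p # q # l else q # ins p l)"

primrec act :: "'g ctree \<Rightarrow> 'g ctx \<Rightarrow> 'g ctx" where
  "act (Leaf x A) l = ins (x, A) l"
| "act Empty l = l"
| "act (Node s t) l = act s (act t l)"

lemma mset_ins: "mset (ins p l) = add_mset p (mset l)"
  by (induction l) auto

lemma set_ins [simp]: "set (ins p l) = insert p (set l)"
  by (induction l) auto

lemma mset_act: "mset (act t l) = mset (leaves t) + mset l"
  by (induction t arbitrary: l) (auto simp: mset_ins)

lemma set_act [simp]: "set (act t l) = set (leaves t) \<union> set l"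
  by (induction t arbitrary: l) auto

lemma ins_commute: "fst p \<noteq> fst q \<Longrightarrow> ins q (ins p l) = ins p (ins q l)"
  by (induction l) auto

text \<open>On lists the actions commute outright, so that the two sides of \<open>commuting\<close>
  have the same codomain.\<close>

lemma act_commute:
  "labels s \<inter> labels t = {} \<Longrightarrow>
    act t (act s l) = act s (act t l)"
proof (induction s arbitrary: l)
  case (Leaf x A)
  then show ?case by (induction t arbitrary: l) (auto simp: ins_commute image_Un)
next
  case (Node s1 s2)
  have "act t (act s1 k) = act s1 (act t k)"
    "act t (act s2 k) = act s2 (act t k)" for k
    using Node.prems by (auto intro!: Node.IH)
  then show ?case by simp
qed simp

lemma sorted_ins: "sorted (map fst l) \<Longrightarrow> sorted (map fst (ins p l))"
  by (induction l) auto

lemma sorted_act: "sorted (map fst l) \<Longrightarrow> sorted (map fst (act t l))"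
  by (induction t arbitrary: l) (auto simp: sorted_ins)

context autonomous_category
begin

declare tyI_Ob [simp]

abbreviation is_type :: "'o ty \<Rightarrow> bool" where
  "is_type A \<equiv> ground_types A \<subseteq> Ob C"

definition valid :: "'o ctx \<Rightarrow> bool" where
  "valid l \<longleftrightarrow> (\<forall>p\<in>set l. is_type (snd p))"

lemma valid_simps [simp]: "valid []" "valid (p # l) \<longleftrightarrow> is_type (snd p) \<and> valid l"
  "valid (l @ l') \<longleftrightarrow> valid l \<and> valid l'" "valid (ins p l) \<longleftrightarrow> is_type (snd p) \<and> valid l"
  "valid (act t l) \<longleftrightarrow> valid (leaves t) \<and> valid l"
  by (auto simp: valid_def)

primrec treeI :: "'o ctree \<Rightarrow> 'o" where
  "treeI (Leaf x A) = tyI C A"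
| "treeI Empty = Unit C"
| "treeI (Node s t) = treeI s \<otimes>\<^sub>o treeI t"

lemma treeI_Ob [simp]: "valid (leaves t) \<Longrightarrow> treeI t \<in> Ob C"
  by (induction t) simp_all

lemma leaves_list_tree [simp]: "leaves (list_tree l) = l"
  by (induction l) auto

abbreviation listI :: "'o ctx \<Rightarrow> 'o" where
  "listI l \<equiv> treeI (list_tree l)"

text \<open>Indexed by trees and not by objects: one morphism may be canonical between many pairs of
  trees, and coherence speaks about the pair. The inverses are rules of their own, so that
  derivations can be reversed.\<close>

inductive can :: "'o ctree \<Rightarrow> 'o ctree \<Rightarrow> 'm \<Rightarrow> bool" where
  can_id: "valid (leaves s) \<Longrightarrow> can s s (Id C (treeI s))"
| can_comp: "\<lbrakk>can s t f; can t u g\<rbrakk> \<Longrightarrow> can s u (g \<cdot> f)"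
| can_tens: "\<lbrakk>can s t f; can s' t' g\<rbrakk> \<Longrightarrow> can (Node s s') (Node t t') (f \<otimes>\<^sub>m g)"
| can_assoc: "\<lbrakk>valid (leaves s); valid (leaves t); valid (leaves u)\<rbrakk> \<Longrightarrow>
    can (Node (Node s t) u) (Node s (Node t u)) (Assoc C (treeI s) (treeI t) (treeI u))"
| can_assoc': "\<lbrakk>valid (leaves s); valid (leaves t); valid (leaves u)\<rbrakk> \<Longrightarrow>
    can (Node s (Node t u)) (Node (Node s t) u) (assoc' (treeI s) (treeI t) (treeI u))"
| can_lunit: "valid (leaves s) \<Longrightarrow> can (Node Empty s) s (LUnit C (treeI s))"
| can_lunit': "valid (leaves s) \<Longrightarrow> can s (Node Empty s) (Inv C (LUnit C (treeI s)))"
| can_runit: "valid (leaves s) \<Longrightarrow> can (Node s Empty) s (RUnit C (treeI s))"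
| can_runit': "valid (leaves s) \<Longrightarrow> can s (Node s Empty) (Inv C (RUnit C (treeI s)))"
| can_sym: "\<lbrakk>valid (leaves s); valid (leaves t)\<rbrakk> \<Longrightarrow>
    can (Node s t) (Node t s) (Sym C (treeI s) (treeI t))"

lemma can_mset: "can s t f \<Longrightarrow> mset (leaves s) = mset (leaves t)"
  by (induction rule: can.induct) auto

lemma can_valid: "can s t f \<Longrightarrow> valid (leaves s) \<and> valid (leaves t)"
  by (induction rule: can.induct) auto

lemma can_arr: "can s t f \<Longrightarrow> f \<in> Arr C \<and> Dom C f = treeI s \<and> Cod C f = treeI t"
proof (induction rule: can.induct)
qed (auto dest: can_valid)

lemma can_distinct: "can s t f \<Longrightarrow> linear s \<longleftrightarrow> linear t"
  by (rule mset_eq_imp_distinct_iff) (simp add: can_mset)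

lemma can_twist:
  assumes "valid (leaves s)" "valid (leaves t)" "valid (leaves u)"
  shows "can (Node s (Node t u)) (Node t (Node s u)) (twist (treeI s) (treeI t) (treeI u))"
  unfolding twist_def using assms
  by (intro can_comp[OF can_comp[OF can_assoc' can_tens[OF can_sym can_id]] can_assoc]) auto

section \<open>The sorting action of trees on lists of leaves\<close>

primrec insM :: "var \<times> 'o ty \<Rightarrow> 'o ctx \<Rightarrow> 'm" where
  "insM p [] = Id C (tyI C (snd p) \<otimes>\<^sub>o Unit C)"
| "insM p (q # l) =
    (if fst p < fst q then Id C (tyI C (snd p) \<otimes>\<^sub>o (tyI C (snd q) \<otimes>\<^sub>o listI l))
     else ((tyI C (snd q)) \<lhd> insM p l) \<cdot> twist (tyI C (snd p)) (tyI C (snd q)) (listI l))"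

text \<open>The right subtree is sorted in first, so a list behaves like an object on which trees
  act from the left, and \<open>Node\<close> acts as composition.\<close>

primrec actM :: "'o ctree \<Rightarrow> 'o ctx \<Rightarrow> 'm" where
  "actM (Leaf x A) l = insM (x, A) l"
| "actM Empty l = LUnit C (listI l)"
| "actM (Node s t) l = actM s (act t l) \<cdot>
    (treeI s \<lhd> actM t l) \<cdot> Assoc C (treeI s) (treeI t) (listI l)"

lemma insM_arr [simp]:
  assumes "is_type (snd p)" "valid l"
  shows "insM p l \<in> Arr C" "Dom C (insM p l) = tyI C (snd p) \<otimes>\<^sub>o listI l" "Cod C (insM p l) = listI (ins p l)"
  using assms by (induction l) auto

lemma insM_can:
  "is_type (snd p) \<Longrightarrow> valid l \<Longrightarrow>
    can (Node (Leaf (fst p) (snd p)) (list_tree l)) (list_tree (ins p l)) (insM p l)"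
proof (induction l)
  case Nil
  then show ?case using can_id[of "list_tree [p]"] by simp
next
  case (Cons q l)
  let ?p = "Leaf (fst p) (snd p)" and ?q = "Leaf (fst q) (snd q)"
  have "can (Node ?p (Node ?q (list_tree l))) (Node ?q (list_tree (ins p l)))
    (((treeI ?q) \<lhd> insM p l) \<cdot> twist (treeI ?p) (treeI ?q) (listI l))"
    using Cons by (intro can_comp[OF can_twist] can_tens can_id) auto
  then show ?case using can_id[of "list_tree (p # q # l)"] Cons.prems by simp
qed

lemma actM_can:
  "valid (leaves t) \<Longrightarrow> valid l \<Longrightarrow>
    can (Node t (list_tree l)) (list_tree (act t l)) (actM t l)"
proof (induction t arbitrary: l)
  case (Leaf x A)
  then show ?case using insM_can[of "(x, A)" l] by simp
next
  case Empty
  then show ?case using can_lunit[of "list_tree l"] by simp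
next
  case (Node s t)
  then show ?case by (auto intro!: can_comp[OF can_comp[OF can_assoc can_tens[OF can_id]]])
qed

lemma actM_arr [simp]:
  assumes "valid (leaves t)" "valid l"
  shows "actM t l \<in> Arr C" "Dom C (actM t l) = treeI t \<otimes>\<^sub>o listI l"
    "Cod C (actM t l) = listI (act t l)"
  using can_arr[OF actM_can[OF assms]] by auto

lemma can_iso: "can s t f \<Longrightarrow> iso_in C (treeI s) (treeI t) f"
proof (induction rule: can.induct)
  case (can_assoc' s t u)
  then show ?case by (intro iso_inI[of _ _ _ "Assoc C (treeI s) (treeI t) (treeI u)"] homI) auto
next
  case (can_lunit' s)
  then show ?case by (intro iso_inI[of _ _ _ "LUnit C (treeI s)"] homI) auto
next
  case (can_runit' s)
  then show ?case by (intro iso_inI[of _ _ _ "RUnit C (treeI s)"] homI) auto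
qed (auto intro: iso_Id iso_Comp iso_TensM Assoc_iso LUnit_iso RUnit_iso Sym_iso)

text \<open>Reverses a derivation. That the result is inverse to \<open>f\<close> is not claimed
  here; it comes out of coherence in \<open>can_Inv\<close>.\<close>

lemma can_inverse: "can s t f \<Longrightarrow> \<exists>g. can t s g"
  by (induction rule: can.induct) (blast intro: can.intros)+

text \<open>If both leaves pass the head \<open>z\<close>, three exchanges take place on either
  side, and \<open>twist_braid\<close> changes their order.\<close>

lemma insM_commute_less:
  assumes "fst p < fst q" "is_type (snd p)" "is_type (snd q)" "valid l"
  shows "insM q (ins p l) \<cdot> ((tyI C (snd q)) \<lhd> insM p l) \<cdot> twist (tyI C (snd p)) (tyI C (snd q)) (listI l)
    = insM p (ins q l) \<cdot> ((tyI C (snd p)) \<lhd> insM q l)"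
  using assms(4)
proof (induction l)
  case Nil
  then show ?case using assms by simp
next
  case (Cons z l)
  let ?P = "tyI C (snd p)" and ?Q = "tyI C (snd q)" and ?Z = "tyI C (snd z)"
  note [simp] = assms(2,3) Cons.prems[simplified]
  show ?case
  proof (cases "fst p < fst z")
    case True
    \<comment> \<open>Here \<open>p\<close> stops in front of \<open>z\<close>, and \<open>q\<close>
      has to pass \<open>p\<close> afterwards; this exchange cancels the \<open>twist\<close> of the
      left-hand side.\<close>
    then have "insM q (ins p (z # l)) \<cdot> (?Q \<lhd> insM p (z # l)) \<cdot> twist ?P ?Q (listI (z # l)) =
       ?P \<lhd> insM q (z # l)"
      using assms(1) by (simp del: insM.simps(2) add: insM.simps(2)[of p] insM.simps(2)[of q p])
    moreover have "insM p (ins q (z # l)) = Id C (?P \<otimes>\<^sub>o listI (ins q (z # l)))"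
      using True assms(1) by simp
    ultimately show ?thesis by simp
  next
    case False
    then have F: "\<not> fst p < fst z" "\<not> fst q < fst z" using assms(1) by auto
    let ?l = "listI l"
    have "insM q (ins p (z # l)) \<cdot> (?Q \<lhd> insM p (z # l)) \<cdot> twist ?P ?Q (listI (z # l)) =
        (?Z \<lhd> insM q (ins p l)) \<cdot> (twist ?Q ?Z (listI (ins p l)) \<cdot> (?Q \<lhd> (?Z \<lhd> insM p l))) \<cdot>
        (?Q \<lhd> twist ?P ?Z ?l) \<cdot> twist ?P ?Q (?Z \<otimes>\<^sub>o ?l)"
      using F by simp
    also have "\<dots> = (?Z \<lhd> insM q (ins p l)) \<cdot> (?Z \<lhd> (?Q \<lhd> insM p l)) \<cdot>
        (twist ?Q ?Z (?P \<otimes>\<^sub>o ?l) \<cdot> (?Q \<lhd> twist ?P ?Z ?l) \<cdot> twist ?P ?Q (?Z \<otimes>\<^sub>o ?l))"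
      by (subst twist_nat) simp_all
    also have "\<dots> = (?Z \<lhd> (insM q (ins p l) \<cdot> (?Q \<lhd> insM p l) \<cdot> twist ?P ?Q ?l)) \<cdot>
        twist ?P ?Z (?Q \<otimes>\<^sub>o ?l) \<cdot> (?P \<lhd> twist ?Q ?Z ?l)"
      by (subst twist_braid[symmetric]) simp_all
    also have "\<dots> = (?Z \<lhd> insM p (ins q l)) \<cdot> ((?Z \<lhd> (?P \<lhd> insM q l)) \<cdot>
        twist ?P ?Z (?Q \<otimes>\<^sub>o ?l)) \<cdot> (?P \<lhd> twist ?Q ?Z ?l)"
      by (subst Cons.IH) simp_all
    also have "\<dots> = (?Z \<lhd> insM p (ins q l)) \<cdot> (twist ?P ?Z (listI (ins q l)) \<cdot>
        (?P \<lhd> (?Z \<lhd> insM q l))) \<cdot> (?P \<lhd> twist ?Q ?Z ?l)"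
      by (subst twist_nat) simp_all
    also have "\<dots> = insM p (ins q (z # l)) \<cdot> (?P \<lhd> insM q (z # l))"
      using F by simp
    finally show ?thesis .
  qed
qed

text \<open>The exchange is a \<open>twist\<close> and not a plain symmetry because both trees stand
  in front of a common list.\<close>

definition commuting :: "'o ctree \<Rightarrow> 'o ctree \<Rightarrow> bool" where
  "commuting s t \<longleftrightarrow> (\<forall>l. valid l \<longrightarrow>
    actM t (act s l) \<cdot> (treeI t \<lhd> actM s l) \<cdot>
      twist (treeI s) (treeI t) (listI l) =
    actM s (act t l) \<cdot> (treeI s \<lhd> actM t l))"

lemma commuting_sym:
  assumes "commuting s t" and [simp]: "valid (leaves s)" "valid (leaves t)"
    and c: "labels s \<inter> labels t = {}"
  shows "commuting t s"
  unfolding commuting_def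
proof (intro allI impI)
  fix l assume [simp]: "valid l"
  have "actM s (act t l) \<cdot> (treeI s \<lhd> actM t l) \<cdot> twist (treeI t) (treeI s) (listI l)
    = (actM s (act t l) \<cdot> (treeI s \<lhd> actM t l)) \<cdot> twist (treeI t) (treeI s) (listI l)"
    by simp
  also have "\<dots> = (actM t (act s l) \<cdot> (treeI t \<lhd> actM s l) \<cdot>
      twist (treeI s) (treeI t) (listI l)) \<cdot> twist (treeI t) (treeI s) (listI l)"
    using assms(1) unfolding commuting_def by simp
  also have "\<dots> = actM t (act s l) \<cdot> (treeI t \<lhd> actM s l)"
    by simp
  finally show "actM s (act t l) \<cdot> (treeI s \<lhd> actM t l) \<cdot>
      twist (treeI t) (treeI s) (listI l) =
    actM t (act s l) \<cdot> (treeI t \<lhd> actM s l)" .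
qed

text \<open>Induction on \<open>s\<close>: \<open>twist_Unit\<close> handles the empty tree, and
  \<open>twist_TensO\<close> lets the two halves of a node pass \<open>t\<close> one after the
  other.\<close>

lemma commuting_leaves:
  assumes "\<And>x A. (x, A) \<in> set (leaves s) \<Longrightarrow> commuting (Leaf x A) t"
    and "valid (leaves s)" "valid (leaves t)" "labels s \<inter> labels t = {}"
  shows "commuting s t"
  using assms
proof (induction s)
  case Empty
  note [simp] = Empty(3)
  have "actM t l \<cdot> (treeI t \<lhd> LUnit C (listI l)) \<cdot> twist (Unit C) (treeI t) (listI l) =
    LUnit C (listI (act t l)) \<cdot> ((Unit C) \<lhd> actM t l)" if [simp]: "valid l" for l
    by (subst twist_Unit, simp_all, subst LUnit_nat', simp_all)
  then show ?case by (simp add: commuting_def)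
next
  case (Node s1 s2)
  note [simp] = Node.prems(2)[simplified] Node.prems(3)
  have d: "labels s1 \<inter> labels t = {}" "labels s2 \<inter> labels t = {}"
    using Node.prems(4) by auto
  have c: "commuting s1 t" "commuting s2 t" using Node by auto
  show ?case unfolding commuting_def
  proof (intro allI impI)
    fix l assume [simp]: "valid l"
    let ?S = "treeI s1" and ?S' = "treeI s2" and ?T = "treeI t" and ?L = "listI l"
    let ?l2 = "act s2 l"
    have cc: "act t ?l2 = act s2 (act t l)"
      using d(2) by (rule act_commute)
    have "actM t (act (Node s1 s2) l) \<cdot> (?T \<lhd> actM (Node s1 s2) l) \<cdot>
        twist (?S \<otimes>\<^sub>o ?S') ?T ?L =
      actM t (act s1 ?l2) \<cdot> (?T \<lhd> actM s1 ?l2) \<cdot>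
       (?T \<lhd> (?S \<lhd> actM s2 l)) \<cdot> ((?T \<lhd> Assoc C ?S ?S' ?L) \<cdot> twist (?S \<otimes>\<^sub>o ?S') ?T ?L)"
      by simp
    also have "\<dots> = actM t (act s1 ?l2) \<cdot> (?T \<lhd> actM s1 ?l2) \<cdot>
       ((?T \<lhd> (?S \<lhd> actM s2 l)) \<cdot> twist ?S ?T (?S' \<otimes>\<^sub>o ?L)) \<cdot>
       (?S \<lhd> twist ?S' ?T ?L) \<cdot> Assoc C ?S ?S' (?T \<otimes>\<^sub>o ?L)"
      by (subst twist_TensO) simp_all
    also have "\<dots> = (actM t (act s1 ?l2) \<cdot> (?T \<lhd> actM s1 ?l2) \<cdot>
       twist ?S ?T (listI ?l2)) \<cdot> (?S \<lhd> (?T \<lhd> actM s2 l)) \<cdot>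
       (?S \<lhd> twist ?S' ?T ?L) \<cdot> Assoc C ?S ?S' (?T \<otimes>\<^sub>o ?L)"
      using twist_nat_refl[of "Id C ?S" "Id C ?T" "actM s2 l", symmetric] by simp
    also have "\<dots> = (actM s1 (act t ?l2) \<cdot> (?S \<lhd> actM t ?l2)) \<cdot>
       (?S \<lhd> (?T \<lhd> actM s2 l)) \<cdot>
       (?S \<lhd> twist ?S' ?T ?L) \<cdot> Assoc C ?S ?S' (?T \<otimes>\<^sub>o ?L)"
      using c(1) unfolding commuting_def by simp
    also have "\<dots> = actM s1 (act s2 (act t l)) \<cdot>
       (?S \<lhd> (actM t ?l2 \<cdot> (?T \<lhd> actM s2 l) \<cdot> twist ?S' ?T ?L)) \<cdot>
       Assoc C ?S ?S' (?T \<otimes>\<^sub>o ?L)"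
      by (simp add: cc)
    also have "\<dots> = actM s1 (act s2 (act t l)) \<cdot>
       (?S \<lhd> (actM s2 (act t l) \<cdot> (?S' \<lhd> actM t l))) \<cdot>
       Assoc C ?S ?S' (?T \<otimes>\<^sub>o ?L)"
      using c(2) unfolding commuting_def by simp
    also have "\<dots> = actM s1 (act s2 (act t l)) \<cdot>
       (?S \<lhd> actM s2 (act t l)) \<cdot> ((?S \<lhd> (?S' \<lhd> actM t l)) \<cdot>
       Assoc C ?S ?S' (?T \<otimes>\<^sub>o ?L))"
      by simp
    also have "\<dots> = actM (Node s1 s2) (act t l) \<cdot> ((?S \<otimes>\<^sub>o ?S') \<lhd> actM t l)"
      using Assoc_nat'[of "Id C ?S" "Id C ?S'" "actM t l", OF _ _ _ refl refl refl, symmetric] by simp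
    finally show "actM t (act (Node s1 s2) l) \<cdot> (?T \<lhd> actM (Node s1 s2) l) \<cdot>
        twist (treeI (Node s1 s2)) ?T ?L = actM (Node s1 s2) (act t l) \<cdot>
        ((treeI (Node s1 s2)) \<lhd> actM t l)"
      by simp
  qed
qed simp

text \<open>Both trees are reduced to leaves, with \<open>commuting_sym\<close> in between, and two
  leaves with different labels are ordered one way or the other.\<close>

lemma commuting_disjoint:
  assumes s: "valid (leaves s)" and t: "valid (leaves t)" and d: "labels s \<inter> labels t = {}"
  shows "commuting s t"
proof (rule commuting_leaves[OF _ assms])
  fix x A assume x: "(x, A) \<in> set (leaves s)"
  have A: "is_type A" using x s by (force simp: valid_def)
  have x': "x \<notin> labels t" using x d by (force simp: image_def)
  have "commuting t (Leaf x A)"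
  proof (rule commuting_leaves)
    fix y D assume y: "(y, D) \<in> set (leaves t)"
    then have xy: "x \<noteq> y" using x d by (force simp: image_def)
    have D: "is_type D" using y t by (force simp: valid_def)
    show "commuting (Leaf y D) (Leaf x A)"
    proof (cases "y < x")
      case True
      then show ?thesis using insM_commute_less[of "(y, D)" "(x, A)"] A D unfolding commuting_def by simp
    next
      case False
      then have "commuting (Leaf x A) (Leaf y D)"
        using insM_commute_less[of "(x, A)" "(y, D)"] A D xy unfolding commuting_def by simp
      then show ?thesis by (rule commuting_sym) (use A D xy in auto)
    qed
  qed (use t A x' in auto)
  then show "commuting (Leaf x A) t" by (rule commuting_sym) (use t A x' in auto)
qed

text \<open>Carries the law of a structure map over to its inverse, for the primed rules of
  \<open>can\<close>.\<close>

lemma actM_inverse: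
  assumes "f \<in> hom C X (treeI t)" "g \<in> hom C (treeI t) X" "f \<cdot> g = Id C (treeI t)" "valid l" "valid (leaves t)"
    "actM t l \<cdot> (f \<rhd> listI l) = m"
  shows "m \<cdot> (g \<rhd> listI l) = actM t l"
  using assms by (auto simp: hom_def)

text \<open>The pentagon, with the list as fourth object. The laws for the units rest likewise on
  \<open>LUnit_TensO\<close> and on the triangle.\<close>

lemma actM_assoc:
  assumes [simp]: "valid (leaves s)" "valid (leaves t)" "valid (leaves u)" "valid l"
  shows "actM (Node s (Node t u)) l \<cdot> (Assoc C (treeI s) (treeI t) (treeI u) \<rhd> listI l) =
    actM (Node (Node s t) u) l"
proof -
  let ?S = "treeI s" and ?T = "treeI t" and ?U = "treeI u" and ?L = "listI l"
  let ?lu = "act u l"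
  have "actM (Node s (Node t u)) l \<cdot> (Assoc C ?S ?T ?U \<rhd> ?L) =
    actM s (act t ?lu) \<cdot> (?S \<lhd> actM t ?lu) \<cdot> (?S \<lhd> (?T \<lhd> actM u l)) \<cdot>
    ((?S \<lhd> Assoc C ?T ?U ?L) \<cdot> Assoc C ?S (?T \<otimes>\<^sub>o ?U) ?L \<cdot> (Assoc C ?S ?T ?U \<rhd> ?L))"
    by simp
  also have "\<dots> = actM s (act t ?lu) \<cdot> (?S \<lhd> actM t ?lu) \<cdot>
    ((?S \<lhd> (?T \<lhd> actM u l)) \<cdot> Assoc C ?S ?T (?U \<otimes>\<^sub>o ?L)) \<cdot> Assoc C (?S \<otimes>\<^sub>o ?T) ?U ?L"
    by (subst pentagon[symmetric]) simp_all
  also have "\<dots> = actM s (act t ?lu) \<cdot> (?S \<lhd> actM t ?lu) \<cdot>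
    (Assoc C ?S ?T (listI ?lu) \<cdot> ((?S \<lhd> Id C ?T) \<otimes>\<^sub>m actM u l)) \<cdot> Assoc C (?S \<otimes>\<^sub>o ?T) ?U ?L"
    by (subst Assoc_nat') simp_all
  finally show ?thesis by simp
qed

lemma actM_lunit:
  assumes [simp]: "valid (leaves s)" "valid l"
  shows "actM s l \<cdot> (LUnit C (treeI s) \<rhd> listI l) = actM (Node Empty s) l"
proof -
  let ?S = "treeI s" and ?L = "listI l"
  have "actM (Node Empty s) l = (LUnit C (listI (act s l)) \<cdot> ((Unit C) \<lhd> actM s l)) \<cdot> Assoc C (Unit C) ?S ?L"
    by simp
  also have "\<dots> = actM s l \<cdot> (LUnit C (?S \<otimes>\<^sub>o ?L) \<cdot> Assoc C (Unit C) ?S ?L)"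
    by (subst LUnit_nat') simp_all
  also have "\<dots> = actM s l \<cdot> (LUnit C ?S \<rhd> ?L)"
    by (subst LUnit_TensO) simp_all
  finally show ?thesis by simp
qed

lemma actM_runit:
  assumes [simp]: "valid (leaves s)" "valid l"
  shows "actM s l \<cdot> (RUnit C (treeI s) \<rhd> listI l) = actM (Node s Empty) l"
  using triangle[of "treeI s" "listI l"] by simp

text \<open>A symmetry between associators is a \<open>twist\<close>, so this is
  \<open>commuting\<close> for the two subtrees.\<close>

lemma actM_sym:
  assumes [simp]: "valid (leaves s)" "valid (leaves t)" "valid l"
    and d: "labels s \<inter> labels t = {}"
  shows "actM (Node t s) l \<cdot> (Sym C (treeI s) (treeI t) \<rhd> listI l) = actM (Node s t) l"
proof -
  let ?S = "treeI s" and ?T = "treeI t" and ?L = "listI l"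
  have "commuting s t" using d by (intro commuting_disjoint) auto
  then have c: "actM t (act s l) \<cdot> (?T \<lhd> actM s l) \<cdot> twist ?S ?T ?L =
    actM s (act t l) \<cdot> (?S \<lhd> actM t l)"
    by (simp add: commuting_def)
  have "actM (Node t s) l \<cdot> (Sym C ?S ?T \<rhd> ?L) =
    (actM t (act s l) \<cdot> (?T \<lhd> actM s l) \<cdot> twist ?S ?T ?L) \<cdot> Assoc C ?S ?T ?L"
    by (simp add: twist_def)
  also have "\<dots> = actM (Node s t) l"
    unfolding c by simp
  finally show ?thesis .
qed

text \<open>As \<open>actM t l\<close> is invertible, this determines the tensor of \<open>f\<close>
  with the list. Linearity is spent in the symmetry case, where the labels of the two subtrees must
  be disjoint.\<close>

lemma actM_can_eq:
  assumes "can s t f" "linear s" "valid l"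
  shows "act t l = act s l \<and> actM t l \<cdot> (f \<rhd> listI l) = actM s l"
  using assms
proof (induction arbitrary: l rule: can.induct)
  case (can_id s)
  then show ?case by simp
next
  case (can_comp s t f u g)
  have d: "linear t" using can_comp can_distinct by blast
  note a = can_arr[OF can_comp.hyps(1)] can_arr[OF can_comp.hyps(2)] can_valid[OF can_comp.hyps(1)] can_valid[OF can_comp.hyps(2)]
  note [simp] = \<open>valid l\<close>
  have e: "(g \<cdot> f) \<rhd> listI l = (g \<rhd> listI l) \<cdot> (f \<rhd> listI l)"
    using a by simp
  have "actM u l \<cdot> ((g \<cdot> f) \<rhd> listI l) = (actM u l \<cdot> (g \<rhd> listI l)) \<cdot> (f \<rhd> listI l)"
    unfolding e using a by (subst Comp_assoc') auto
  then show ?case using can_comp.IH[of l] d can_comp.prems by simp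
next
  case (can_tens s t f s' t' g)
  note a = can_arr[OF can_tens.hyps(1)] can_arr[OF can_tens.hyps(2)] can_valid[OF can_tens.hyps(1)] can_valid[OF can_tens.hyps(2)]
  note [simp] = \<open>valid l\<close>
  have d: "linear s" "linear s'" using can_tens.prems by auto
  note IH2 = can_tens.IH(2)[OF d(2), of l]
  have v2: "valid (act s' l)" using a by simp
  note IH1 = can_tens.IH(1)[OF d(1) v2]
  have "actM (Node t t') l \<cdot> ((f \<otimes>\<^sub>m g) \<rhd> listI l) =
     actM t (act t' l) \<cdot> (treeI t \<lhd> actM t' l) \<cdot>
     (Assoc C (treeI t) (treeI t') (listI l) \<cdot> ((f \<otimes>\<^sub>m g) \<rhd> listI l))"
    using a by simp
  also have "\<dots> = actM t (act t' l) \<cdot> (f \<otimes>\<^sub>m (actM t' l \<cdot> (g \<rhd> listI l))) \<cdot>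
     Assoc C (treeI s) (treeI s') (listI l)"
    using a by (subst Assoc_nat') simp_all
  also have "\<dots> = actM t (act s' l) \<cdot> ((f \<rhd> (listI (act s' l))) \<cdot> (treeI s \<lhd> actM s' l)) \<cdot>
     Assoc C (treeI s) (treeI s') (listI l)"
    using a IH2 by simp
  also have "\<dots> = (actM t (act s' l) \<cdot> (f \<rhd> (listI (act s' l)))) \<cdot> (treeI s \<lhd> actM s' l) \<cdot>
     Assoc C (treeI s) (treeI s') (listI l)"
    using a conjunct1[OF IH1] by (simp del: interchange interchange')
  also have "\<dots> = actM (Node s s') l"
    using IH1 by simp
  finally show ?case using IH1 IH2 by simp
next
  case (can_assoc s t u)
  then show ?case using actM_assoc[of s t u l] by simp
next
  case (can_assoc' s t u)
  then show ?case using actM_inverse[OF _ _ _ _ _ actM_assoc[of s t u l], of _ "assoc' (treeI s) (treeI t) (treeI u)"]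
    by (simp add: hom_def)
next
  case (can_lunit s)
  then show ?case using actM_lunit[of s l] by simp
next
  case (can_lunit' s)
  then show ?case using actM_inverse[OF _ _ _ _ _ actM_lunit[of s l], of _ "Inv C (LUnit C (treeI s))"]
    by (simp add: hom_def)
next
  case (can_runit s)
  then show ?case using actM_runit[of s l] by simp
next
  case (can_runit' s)
  then show ?case using actM_inverse[OF _ _ _ _ _ actM_runit[of s l], of _ "Inv C (RUnit C (treeI s))"]
    by (simp add: hom_def)
next
  case (can_sym s t)
  then have d: "labels s \<inter> labels t = {}" by auto
  then show ?case using actM_sym[OF can_sym.hyps can_sym.prems(2) d] act_commute[OF d] by simp
qed

text \<open>With \<open>l\<close> empty, \<open>actM_can_eq\<close> gives both morphisms the same
  composite with the isomorphism \<open>actM t []\<close>, and what remains of the list is a unit,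
  which cancels.\<close>

theorem coherence:
  assumes "can s t f" "can s t g" "linear s"
  shows "f = g"
proof (rule TensM_Unit_faithful)
  note a = can_arr[OF assms(1)] can_arr[OF assms(2)] can_valid[OF assms(1)]
  show "f \<in> Arr C" "g \<in> Arr C" "Dom C f = Dom C g" "Cod C f = Cod C g" using a by auto
  show "f \<rhd> (Unit C) = g \<rhd> (Unit C)"
  proof (rule iso_cancel_left[OF can_iso[OF actM_can[of t "[]"]]])
    show "actM t [] \<cdot> (f \<rhd> (Unit C)) = actM t [] \<cdot> (g \<rhd> (Unit C))"
      using actM_can_eq[OF assms(1,3), of "[]"] actM_can_eq[OF assms(2,3), of "[]"] by simp
  qed (use a in auto)
qed

lemma can_normal_form:
  assumes "valid (leaves s)"
  shows "\<exists>f. can s (list_tree (act s [])) f"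
  using assms can_comp[OF can_runit' actM_can[of s "[]", simplified]] by auto

text \<open>Trees with the same leaves sort to the same list, since distinct labels leave only one
  sorted order. One sorts \<open>s\<close> and then undoes the sorting of \<open>t\<close>.\<close>

theorem can_exists:
  assumes "valid (leaves s)" "linear s" "mset (leaves s) = mset (leaves t)"
  shows "\<exists>f. can s t f"
proof -
  have t: "valid (leaves t)" "linear t"
    using assms mset_eq_setD[OF assms(3)] mset_eq_imp_distinct_iff[of "map fst (leaves s)" "map fst (leaves t)"]
    by (auto simp: valid_def)
  have ms: "mset (act s []) = mset (leaves s)" "mset (act t []) = mset (leaves t)"
    by (simp_all add: mset_act)
  have d: "distinct_vars (act s [])" "distinct_vars (act t [])"
    using assms(2) t(2) ms by (metis mset_eq_imp_distinct_iff mset_map)+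
  have "act s [] = act t []"
  proof (rule map_sorted_distinct_set_unique[where f = fst])
    have e: "set (act s []) = set (act t [])" using ms assms(3) by (metis mset_eq_setD)
    then show "inj_on fst (set (act s []) \<union> set (act t []))"
      using d by (simp add: distinct_map)
    show "set (act s []) = set (act t [])" by (rule e)
  qed (use d sorted_act[of "[]"] in auto)
  then show ?thesis
    using can_normal_form[OF assms(1)] can_normal_form[OF t(1)] can_inverse can_comp by metis
qed

section \<open>Currying and evaluation\<close>

lemma Curry_hom: "f \<in> hom C (Y \<otimes>\<^sub>o X) Z \<Longrightarrow> X \<in> Ob C \<Longrightarrow> Y \<in> Ob C \<Longrightarrow> Curry C Y X f \<in> hom C Y (X \<multimap> Z)"
  using Curry_viso[of X Y Z] hom_Ob[of f] by (auto simp: viso_def dest: vfunctor_Pi)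

lemma Curry_arr [simp]:
  assumes "f \<in> Arr C" "Dom C f = Y \<otimes>\<^sub>o X" "X \<in> Ob C" "Y \<in> Ob C"
  shows "Curry C Y X f \<in> Arr C" "Dom C (Curry C Y X f) = Y" "Cod C (Curry C Y X f) = X \<multimap> Cod C f"
  using Curry_hom[of f Y X "Cod C f"] assms by (auto simp: hom_def)

lemma Curry_inj:
  "Curry C Y X f = Curry C Y X g \<Longrightarrow> f \<in> hom C (Y \<otimes>\<^sub>o X) Z \<Longrightarrow> g \<in> hom C (Y \<otimes>\<^sub>o X) Z \<Longrightarrow>
    X \<in> Ob C \<Longrightarrow> Y \<in> Ob C \<Longrightarrow> f = g"
  using Curry_viso[of X Y Z] hom_Ob[of f] by (auto simp: viso_def bij_betw_def dest: inj_onD)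

lemma Dist_Curry:
  "f \<in> hom C (Y \<otimes>\<^sub>o X) Z \<Longrightarrow> g \<in> hom C (Y \<otimes>\<^sub>o X) Z \<Longrightarrow> X \<in> Ob C \<Longrightarrow> Y \<in> Ob C \<Longrightarrow>
    Dist C f g \<le> Dist C (Curry C Y X f) (Curry C Y X g)"
  using Curry_viso[of X Y Z] hom_Ob[of f] by (auto simp: viso_def dest: vfunctor_le)

lemma Curry_nat: "\<lbrakk>f \<in> Arr C; g \<in> Arr C; X \<in> Ob C; Dom C f = Cod C g \<otimes>\<^sub>o X; Y' = Dom C g; Y = Cod C g\<rbrakk> \<Longrightarrow>
    Curry C Y' X (f \<cdot> (g \<rhd> X)) = Curry C Y X f \<cdot> g"
  using Curry_nat_left[of X g Y' Y f "Cod C f"] by (simp add: hom_def)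

text \<open>\<open>Eval\<close> is given by a definite description; bijectivity of
  \<open>Curry\<close> makes it meaningful.\<close>

lemma Eval_props:
  assumes "X \<in> Ob C" "Z \<in> Ob C"
  shows "Eval C X Z \<in> hom C ((X \<multimap> Z) \<otimes>\<^sub>o X) Z \<and> Curry C (X \<multimap> Z) X (Eval C X Z) = Id C (X \<multimap> Z)"
proof -
  have "bij_betw (Curry C (X \<multimap> Z) X) (hom C ((X \<multimap> Z) \<otimes>\<^sub>o X) Z) (hom C (X \<multimap> Z) (X \<multimap> Z))"
    using Curry_viso[of X "X \<multimap> Z" Z] assms by (simp add: viso_def)
  moreover have "Id C (X \<multimap> Z) \<in> hom C (X \<multimap> Z) (X \<multimap> Z)" using assms by (auto simp: hom_def)
  ultimately obtain e where e: "e \<in> hom C ((X \<multimap> Z) \<otimes>\<^sub>o X) Z" "Curry C (X \<multimap> Z) X e = Id C (X \<multimap> Z)"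
    by (metis (no_types, lifting) bij_betw_def imageE)
  have "e' = e" if "e' \<in> hom C ((X \<multimap> Z) \<otimes>\<^sub>o X) Z" "Curry C (X \<multimap> Z) X e' = Id C (X \<multimap> Z)" for e'
    by (rule Curry_inj[of "X \<multimap> Z" X _ _ Z]) (use that e assms in simp_all)
  with e have "\<exists>!e. e \<in> hom C ((X \<multimap> Z) \<otimes>\<^sub>o X) Z \<and> Curry C (X \<multimap> Z) X e = Id C (X \<multimap> Z)"
    by blast
  then show ?thesis unfolding Eval_def by (rule theI')
qed

lemma Eval_arr [simp]:
  assumes "X \<in> Ob C" "Z \<in> Ob C"
  shows "Eval C X Z \<in> Arr C" "Dom C (Eval C X Z) = (X \<multimap> Z) \<otimes>\<^sub>o X" "Cod C (Eval C X Z) = Z"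
    "Curry C (X \<multimap> Z) X (Eval C X Z) = Id C (X \<multimap> Z)"
  using Eval_props[OF assms] by (auto simp: hom_def)

lemma Curry_Eval:
  assumes "X \<in> Ob C" "Z \<in> Ob C" "g \<in> Arr C" "Cod C g = X \<multimap> Z" "Y = Dom C g"
  shows "Curry C Y X (Eval C X Z \<cdot> (g \<rhd> X)) = g"
  using assms by (subst Curry_nat) auto

lemma Eval_Curry:
  assumes "X \<in> Ob C" "Y \<in> Ob C" "f \<in> Arr C" "Dom C f = Y \<otimes>\<^sub>o X" "Z = Cod C f"
  shows "Eval C X Z \<cdot> (Curry C Y X f \<rhd> X) = f"
proof (rule Curry_inj[of Y X])
  show "Curry C Y X (Eval C X Z \<cdot> (Curry C Y X f \<rhd> X)) = Curry C Y X f"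
    using assms by (subst Curry_Eval) auto
qed (use assms in \<open>auto simp: hom_def\<close>)

end

subsection \<open>Substituting trees for leaves\<close>

primrec bind :: "(var \<Rightarrow> 'g ty \<Rightarrow> 'g ctree) \<Rightarrow> 'g ctree \<Rightarrow> 'g ctree" where
  "bind \<tau> (Leaf x A) = \<tau> x A"
| "bind \<tau> Empty = Empty"
| "bind \<tau> (Node s t) = Node (bind \<tau> s) (bind \<tau> t)"

lemma bind_cong: "(\<And>x A. (x, A) \<in> set (leaves s) \<Longrightarrow> \<tau> x A = \<tau>' x A) \<Longrightarrow> bind \<tau> s = bind \<tau>' s"
  by (induction s) auto

lemma bind_fresh: "x \<notin> labels s \<Longrightarrow> bind (\<tau>(x := a)) s = bind \<tau> s"
  by (induction s) (auto simp: image_Un)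

lemma bind_Leaf [simp]: "bind Leaf s = s"
  by (induction s) auto

text \<open>The multiset of leaves after \<open>bind\<close> depends only on the multiset of leaves
  before.\<close>

lemma distinct_bind_cong:
  assumes "mset (leaves s) = mset (leaves t)"
  shows "linear (bind \<tau> s) \<longleftrightarrow> linear (bind \<tau> t)"
proof -
  have "mset (leaves (bind \<tau> u)) = sum_mset (image_mset (\<lambda>(x, A). mset (leaves (\<tau> x A))) (mset (leaves u)))" for u :: "'a ctree"
    by (induction u) auto
  then have "mset (map fst (leaves (bind \<tau> s))) = mset (map fst (leaves (bind \<tau> t)))"
    using assms by simp
  then show ?thesis by (rule mset_eq_imp_distinct_iff)
qed

context autonomous_category
begin

primrec bindM :: "(var \<Rightarrow> 'o ty \<Rightarrow> 'm) \<Rightarrow> 'o ctree \<Rightarrow> 'm" where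
  "bindM \<nu> (Leaf x A) = \<nu> x A"
| "bindM \<nu> Empty = Id C (Unit C)"
| "bindM \<nu> (Node s t) = bindM \<nu> s \<otimes>\<^sub>m bindM \<nu> t"

lemma bindM_fresh: "x \<notin> labels s \<Longrightarrow> bindM (\<nu>(x := a)) s = bindM \<nu> s"
  by (induction s) (auto simp: image_Un)

definition binding :: "(var \<Rightarrow> 'o ty \<Rightarrow> 'o ctree) \<Rightarrow> (var \<Rightarrow> 'o ty \<Rightarrow> 'm) \<Rightarrow> 'o ctree \<Rightarrow> bool" where
  "binding \<tau> \<nu> s \<longleftrightarrow> valid (leaves s) \<and> (\<forall>(x, A)\<in>set (leaves s). valid (leaves (\<tau> x A)) \<and> \<nu> x A \<in> hom C (treeI (\<tau> x A)) (tyI C A))"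

lemma binding_simps [simp]:
  "binding \<tau> \<nu> (Leaf x A) \<longleftrightarrow> is_type A \<and> valid (leaves (\<tau> x A)) \<and> \<nu> x A \<in> hom C (treeI (\<tau> x A)) (tyI C A)"
  "binding \<tau> \<nu> Empty"
  "binding \<tau> \<nu> (Node s t) \<longleftrightarrow> binding \<tau> \<nu> s \<and> binding \<tau> \<nu> t"
  by (auto simp: binding_def)

lemma bindM_arr:
  assumes "binding \<tau> \<nu> s"
  shows "valid (leaves s) \<and> valid (leaves (bind \<tau> s)) \<and> bindM \<nu> s \<in> Arr C \<and> Dom C (bindM \<nu> s) = treeI (bind \<tau> s) \<and> Cod C (bindM \<nu> s) = treeI s"
  using assms by (induction s) (auto simp: hom_def)

lemma binding_can: "can s t f \<Longrightarrow> binding \<tau> \<nu> s \<longleftrightarrow> binding \<tau> \<nu> t"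
  using can_valid[of s t f] mset_eq_setD[OF can_mset, of s t f] by (auto simp: binding_def)

text \<open>Canonical isomorphisms are natural: every structure map slides past the tensor of the
  morphisms \<open>\<nu>\<close>, and the same structure map between the larger trees is canonical
  again.\<close>

lemma bind_can:
  assumes "can s t f" "binding \<tau> \<nu> s"
  shows "\<exists>f'. can (bind \<tau> s) (bind \<tau> t) f' \<and> bindM \<nu> t \<cdot> f' = f \<cdot> bindM \<nu> s"
  using assms
proof (induction rule: can.induct)
  case (can_id s)
  then show ?case using bindM_arr[of \<tau> \<nu> s] can.can_id[of "bind \<tau> s"]
    by (intro exI[of _ "Id C (treeI (bind \<tau> s))"]) auto
next
  case (can_comp s t f u g)
  have b: "binding \<tau> \<nu> t" "binding \<tau> \<nu> u" using can_comp binding_can by blast+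
  obtain f' where f: "can (bind \<tau> s) (bind \<tau> t) f'" "bindM \<nu> t \<cdot> f' = f \<cdot> bindM \<nu> s" using can_comp by blast
  obtain g' where g: "can (bind \<tau> t) (bind \<tau> u) g'" "bindM \<nu> u \<cdot> g' = g \<cdot> bindM \<nu> t" using can_comp b by blast
  note a = can_arr[OF f(1)] can_arr[OF g(1)] bindM_arr[OF b(1)] bindM_arr[OF b(2)] bindM_arr[OF can_comp.prems]
    can_arr[OF can_comp.hyps(1)] can_arr[OF can_comp.hyps(2)]
  have "bindM \<nu> u \<cdot> g' \<cdot> f' = (g \<cdot> bindM \<nu> t) \<cdot> f'" using a reassoc[OF g(2)] by simp
  also have "\<dots> = (g \<cdot> f) \<cdot> bindM \<nu> s" using a f(2) by simp
  finally show ?case using can.can_comp[OF f(1) g(1)] by blast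
next
  case (can_tens s t f s' t' g)
  have b: "binding \<tau> \<nu> s" "binding \<tau> \<nu> s'" "binding \<tau> \<nu> t" "binding \<tau> \<nu> t'" using can_tens binding_can by auto
  obtain f' where f: "can (bind \<tau> s) (bind \<tau> t) f'" "bindM \<nu> t \<cdot> f' = f \<cdot> bindM \<nu> s" using can_tens b by blast
  obtain g' where g: "can (bind \<tau> s') (bind \<tau> t') g'" "bindM \<nu> t' \<cdot> g' = g \<cdot> bindM \<nu> s'" using can_tens b by blast
  note a = can_arr[OF f(1)] can_arr[OF g(1)] b[THEN bindM_arr] can_arr[OF can_tens.hyps(1)] can_arr[OF can_tens.hyps(2)]
  show ?case using can.can_tens[OF f(1) g(1)] f(2) g(2) a by (intro exI[of _ "f' \<otimes>\<^sub>m g'"]) simp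
next
  case (can_assoc s t u)
  then have b: "binding \<tau> \<nu> s" "binding \<tau> \<nu> t" "binding \<tau> \<nu> u" by auto
  note a = b[THEN bindM_arr]
  show ?case using can.can_assoc[of "bind \<tau> s" "bind \<tau> t" "bind \<tau> u"] a
    by (intro exI[of _ "Assoc C (treeI (bind \<tau> s)) (treeI (bind \<tau> t)) (treeI (bind \<tau> u))"]) (simp add: Assoc_nat')
next
  case (can_assoc' s t u)
  then have b: "binding \<tau> \<nu> s" "binding \<tau> \<nu> t" "binding \<tau> \<nu> u" by auto
  note a = b[THEN bindM_arr]
  show ?case using can.can_assoc'[of "bind \<tau> s" "bind \<tau> t" "bind \<tau> u"] a
    by (intro exI[of _ "assoc' (treeI (bind \<tau> s)) (treeI (bind \<tau> t)) (treeI (bind \<tau> u))"]) (simp add: Inv_Assoc_nat)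
next
  case (can_lunit s)
  then have a: "valid (leaves (bind \<tau> s))" "bindM \<nu> s \<in> Arr C" "Dom C (bindM \<nu> s) = treeI (bind \<tau> s)" "Cod C (bindM \<nu> s) = treeI s"
    using bindM_arr by auto
  show ?case using can.can_lunit[OF a(1)] a
    by (intro exI[of _ "LUnit C (treeI (bind \<tau> s))"]) (simp add: LUnit_nat')
next
  case (can_lunit' s)
  note a = bindM_arr[OF can_lunit'.prems]
  have "((Unit C) \<lhd> bindM \<nu> s) \<cdot> Inv C (LUnit C (treeI (bind \<tau> s))) = Inv C (LUnit C (treeI s)) \<cdot>
      (LUnit C (treeI s) \<cdot> ((Unit C) \<lhd> bindM \<nu> s)) \<cdot> Inv C (LUnit C (treeI (bind \<tau> s)))"
    using a by simp
  also have "\<dots> = Inv C (LUnit C (treeI s)) \<cdot> bindM \<nu> s" using a by (subst LUnit_nat') simp_all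
  finally show ?case using can.can_lunit'[of "bind \<tau> s"] a by auto
next
  case (can_runit s)
  then have a: "valid (leaves (bind \<tau> s))" "bindM \<nu> s \<in> Arr C" "Dom C (bindM \<nu> s) = treeI (bind \<tau> s)" "Cod C (bindM \<nu> s) = treeI s"
    using bindM_arr by auto
  show ?case using can.can_runit[OF a(1)] a
    by (intro exI[of _ "RUnit C (treeI (bind \<tau> s))"]) (simp add: RUnit_nat')
next
  case (can_runit' s)
  note a = bindM_arr[OF can_runit'.prems]
  have "(bindM \<nu> s \<rhd> (Unit C)) \<cdot> Inv C (RUnit C (treeI (bind \<tau> s))) = Inv C (RUnit C (treeI s)) \<cdot>
      (RUnit C (treeI s) \<cdot> (bindM \<nu> s \<rhd> (Unit C))) \<cdot> Inv C (RUnit C (treeI (bind \<tau> s)))"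
    using a by simp
  also have "\<dots> = Inv C (RUnit C (treeI s)) \<cdot> bindM \<nu> s" using a by (subst RUnit_nat') simp_all
  finally show ?case using can.can_runit'[of "bind \<tau> s"] a by auto
next
  case (can_sym s t)
  then have b: "binding \<tau> \<nu> s" "binding \<tau> \<nu> t" by auto
  note a = b[THEN bindM_arr]
  show ?case using can.can_sym[of "bind \<tau> s" "bind \<tau> t"] a
    by (intro exI[of _ "Sym C (treeI (bind \<tau> s)) (treeI (bind \<tau> t))"]) (simp add: Sym_nat')
qed

end

section \<open>Locally nameless terms\<close>

fun opn :: "nat \<Rightarrow> var \<Rightarrow> ('g, 'f) tm \<Rightarrow> ('g, 'f) tm" where
  "opn k x (FV y) = FV y"
| "opn k x (BV i) = (if i = k then FV x else BV i)"
| "opn k x (Op f vs) = Op f (map (opn k x) vs)"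
| "opn k x Star = Star"
| "opn k x (ToStar v w) = ToStar (opn k x v) (opn k x w)"
| "opn k x (Tensor v w) = Tensor (opn k x v) (opn k x w)"
| "opn k x (Pm v w) = Pm (opn k x v) (opn (k + 2) x w)"
| "opn k x (Lam A v) = Lam A (opn (k + 1) x v)"
| "opn k x (App v w) = App (opn k x v) (opn k x w)"

fun lc_at :: "nat \<Rightarrow> ('g, 'f) tm \<Rightarrow> bool" where
  "lc_at k (FV y) = True"
| "lc_at k (BV i) = (i < k)"
| "lc_at k (Op f vs) = (\<forall>v\<in>set vs. lc_at k v)"
| "lc_at k Star = True"
| "lc_at k (ToStar v w) = (lc_at k v \<and> lc_at k w)"
| "lc_at k (Tensor v w) = (lc_at k v \<and> lc_at k w)"
| "lc_at k (Pm v w) = (lc_at k v \<and> lc_at (k + 2) w)"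
| "lc_at k (Lam A v) = lc_at (k + 1) v"
| "lc_at k (App v w) = (lc_at k v \<and> lc_at k w)"

fun fv :: "('g, 'f) tm \<Rightarrow> var set" where
  "fv (FV y) = {y}"
| "fv (BV i) = {}"
| "fv (Op f vs) = (\<Union>v\<in>set vs. fv v)"
| "fv Star = {}"
| "fv (ToStar v w) = fv v \<union> fv w"
| "fv (Tensor v w) = fv v \<union> fv w"
| "fv (Pm v w) = fv v \<union> fv w"
| "fv (Lam A v) = fv v"
| "fv (App v w) = fv v \<union> fv w"

lemma finite_fv [simp]: "finite (fv v)"
  by (induction v) auto

lemma opn_lc: "lc_at k v \<Longrightarrow> k \<le> n \<Longrightarrow> opn n x v = v"
  by (induction k v arbitrary: n rule: lc_at.induct) (auto intro: map_idI)

lemma opn_lc_0: "lc_at 0 v \<Longrightarrow> opn n x v = v"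
  by (rule opn_lc) auto

lemma lc_at_mono: "lc_at k v \<Longrightarrow> k \<le> n \<Longrightarrow> lc_at n v"
  by (induction k v arbitrary: n rule: lc_at.induct) auto

lemma opn_close: "lc_at k v \<Longrightarrow> opn k x (close k x v) = v"
  by (induction k x v rule: close.induct) (auto intro: map_idI)

lemma close_opn: "x \<notin> fv v \<Longrightarrow> close k x (opn k x v) = v"
  by (induction k x v rule: opn.induct) (auto intro: map_idI)

lemma opn_close_commute: "x \<noteq> y \<Longrightarrow> i \<noteq> k \<Longrightarrow> opn i x (close k y v) = close k y (opn i x v)"
  by (induction i x v arbitrary: k rule: opn.induct) auto

lemma fv_opn_lower: "y \<in> fv v \<Longrightarrow> y \<in> fv (opn k x v)"
  by (induction k x v rule: opn.induct) auto

lemma fv_opn_upper: "y \<in> fv (opn k x v) \<Longrightarrow> y = x \<or> y \<in> fv v"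
  by (induction k x v rule: opn.induct) (auto split: if_splits)

lemma fv_close [simp]: "fv (close k x v) = fv v - {x}"
  by (induction k x v rule: close.induct) auto

lemma lc_at_opn: "lc_at k (opn k x v) \<Longrightarrow> lc_at (k + 1) v"
  by (induction k x v rule: opn.induct) (auto split: if_splits)

lemma lc_at_opn_iff: "lc_at n (opn k x v) \<Longrightarrow> k < n \<Longrightarrow> lc_at n v"
  by (induction k x v arbitrary: n rule: opn.induct) (auto split: if_splits)

lemma lc_at_opn2: "lc_at 0 (opn 0 y (opn 1 x v)) \<Longrightarrow> lc_at 2 v"
  using lc_at_opn[of 0 y "opn 1 x v"] lc_at_opn_iff[of 2 1 x v] lc_at_mono[of 1 "opn 1 x v" 2] by simp

lemma subst_cong: "(\<And>x. x \<in> fv v \<Longrightarrow> \<sigma> x = \<sigma>' x) \<Longrightarrow> subst \<sigma> v = subst \<sigma>' v"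
  by (induction v) auto

lemma subst_FV [simp]: "subst FV v = v"
  by (induction v) (auto intro: map_idI)

text \<open>Substituted terms are locally closed, so opening does not touch them. Allowing
  \<open>z\<close> to differ from \<open>x\<close> covers renamings as well as substitutions that
  fix a fresh variable.\<close>

lemma subst_opn:
  "(\<And>y. lc_at 0 (\<sigma> y)) \<Longrightarrow> \<sigma> x = FV z \<Longrightarrow> subst \<sigma> (opn k x v) = opn k z (subst \<sigma> v)"
  by (induction k x v rule: opn.induct) (auto simp: opn_lc_0)

lemma lam_opn: "x \<notin> fv b \<Longrightarrow> lam x A (opn 0 x b) = Lam A b"
  by (simp add: lam_def close_opn)

lemma pm_opn:
  assumes "x \<noteq> y" "x \<notin> fv b" "y \<notin> fv b"
  shows "pm v x y (opn 0 y (opn 1 x b)) = Pm v b"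
proof -
  have "y \<notin> fv (opn 1 x b)" using fv_opn_upper assms by blast
  moreover have "close 1 x (opn 0 y (opn 1 x b)) = opn 0 y (close 1 x (opn 1 x b))"
    using assms by (simp add: opn_close_commute)
  ultimately show ?thesis using assms by (simp add: pm_def close_opn)
qed

lemma opn_pm: "lc_at 0 v \<Longrightarrow> x \<noteq> y \<Longrightarrow> opn 0 y (opn 1 x (close 0 y (close 1 x v))) = v"
  by (subst opn_close_commute) (auto simp: opn_close lc_at_mono)

section \<open>Interpreting terms over trees of variables\<close>

context autonomous_category
begin

text \<open>Rule \<open>den_can\<close> absorbs all the structural rules, so that no other rule has to split a context.
  Binders are opened with all but finitely many variables, with one and the same denotation.\<close>

inductive den :: "'o ctree \<Rightarrow> ('o, ('o, 'm) lang_op) tm \<Rightarrow> 'o ty \<Rightarrow> 'm \<Rightarrow> bool" where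
  den_var: "is_type A \<Longrightarrow> den (Leaf x A) (FV x) A (Id C (tyI C A))"
| den_can: "\<lbrakk>den s v A m; can t s f\<rbrakk> \<Longrightarrow> den t v A (m \<cdot> f)"
| den_op: "\<lbrakk>f \<in> Ops (lang_signature C); lang_args C f = [A]; den s v A m\<rbrakk> \<Longrightarrow>
    den s (Op f [v]) (lang_res C f) (opI C f \<cdot> m)"
| den_star: "den Empty Star TUnit (Id C (Unit C))"
| den_to: "\<lbrakk>den s v TUnit m; den t w A n; linear (Node s t)\<rbrakk> \<Longrightarrow>
    den (Node s t) (ToStar v w) A (LUnit C (tyI C A) \<cdot> (m \<otimes>\<^sub>m n))"
| den_tensor: "\<lbrakk>den s v A m; den t w A' n; linear (Node s t)\<rbrakk> \<Longrightarrow>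
    den (Node s t) (Tensor v w) (TTens A A') (m \<otimes>\<^sub>m n)"
| den_pm: "\<lbrakk>den s v (TTens A A') m; finite F;
    \<forall>x y. x \<notin> F \<longrightarrow> y \<notin> F \<longrightarrow> x \<noteq> y \<longrightarrow>
      den (Node (Node t (Leaf x A)) (Leaf y A')) (opn 0 y (opn 1 x b)) D n;
    linear (Node s t)\<rbrakk> \<Longrightarrow>
    den (Node s t) (Pm v b) D (pm_mor (treeI t) (tyI C A) (tyI C A') m n)"
| den_lam: "\<lbrakk>finite F; \<forall>x. x \<notin> F \<longrightarrow> den (Node s (Leaf x A)) (opn 0 x b) A' m\<rbrakk> \<Longrightarrow>
    den s (Lam A b) (TLolli A A') (Curry C (treeI s) (tyI C A) m)"
| den_app: "\<lbrakk>den s v (TLolli A A') m; den t w A n; linear (Node s t)\<rbrakk> \<Longrightarrow>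
    den (Node s t) (App v w) A' (Eval C (tyI C A) (tyI C A') \<cdot> (m \<otimes>\<^sub>m n))"

lemma ex_fresh: "finite F \<Longrightarrow> \<exists>x::var. x \<notin> F"
  using ex_new_if_finite infinite_UNIV_nat by blast

lemma ex_fresh2:
  assumes "finite F"
  obtains x y :: var where "x \<notin> F" "y \<notin> F" "x \<noteq> y"
proof -
  obtain x where "x \<notin> F" using ex_fresh[OF assms] by blast
  moreover obtain y where "y \<notin> insert x F" using ex_fresh[of "insert x F"] assms by auto
  ultimately show ?thesis using that by blast
qed

lemma opI_arr:
  assumes "f \<in> Ops (lang_signature C)" "lang_args C f = [A]"
  shows "opI C f \<in> hom C (tyI C A) (tyI C (lang_res C f))" "is_type (lang_res C f)"
  using assms by (auto simp: lang_signature_def hom_def)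

text \<open>The equation \<open>fv v = labels s\<close> is what later tells which leaves of a node
  belong to which subterm.\<close>

lemma den_props:
  assumes "den s v A m"
  shows "m \<in> Arr C \<and> Dom C m = treeI s \<and> Cod C m = tyI C A \<and> is_type A \<and>
    valid (leaves s) \<and> linear s \<and> lc_at 0 v \<and> fv v = labels s"
  using assms
proof (induction rule: den.induct)
  case (den_can s v A m t f)
  then show ?case
    using can_arr[OF den_can.hyps(2)] can_valid[OF den_can.hyps(2)] can_distinct[OF den_can.hyps(2)]
      mset_eq_setD[OF can_mset[OF den_can.hyps(2)]] by simp
next
  case (den_op f A s v m)
  then show ?case using opI_arr[OF den_op.hyps(1,2)] by (auto simp: hom_def)
next
  case (den_pm s v A A' m F t b D n)
  \<comment> \<open>The names are fresh for \<open>b\<close> and \<open>t\<close> as well, so that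
    the free variables of \<open>b\<close> can be read off from those of the opened body.\<close>
  have "finite (F \<union> fv b \<union> labels t)" using den_pm.hyps(2) by simp
  then obtain x y where xy: "x \<notin> F \<union> fv b \<union> labels t" "y \<notin> F \<union> fv b \<union> labels t" "x \<noteq> y"
    by (rule ex_fresh2)
  then have IH: "n \<in> Arr C \<and> Dom C n = (treeI t \<otimes>\<^sub>o tyI C A) \<otimes>\<^sub>o tyI C A' \<and> Cod C n = tyI C D \<and> is_type D \<and>
      valid (leaves t) \<and> linear t \<and> lc_at 0 (opn 0 y (opn 1 x b)) \<and>
      fv (opn 0 y (opn 1 x b)) = insert y (insert x (labels t))"
    using conjunct2[OF den_pm.IH(2)[rule_format, of x y]] by (simp add: insert_commute)
  have "z \<in> fv b \<longleftrightarrow> z \<in> labels t" for z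
  proof (cases "z = x \<or> z = y")
    case True
    then show ?thesis using xy by blast
  next
    case False
    have "z \<in> fv b \<longleftrightarrow> z \<in> fv (opn 0 y (opn 1 x b))"
      using False fv_opn_lower fv_opn_upper by metis
    also have "\<dots> \<longleftrightarrow> z \<in> labels t" using IH False by simp
    finally show ?thesis .
  qed
  then have "fv b = labels t" by blast
  then show ?case using IH den_pm.IH(1) den_pm.hyps lc_at_opn2[of y x b] by (simp add: image_Un numeral_2_eq_2)
next
  case (den_lam F s A b A' m)
  then obtain x where x: "x \<notin> F \<union> fv b \<union> labels s"
    using ex_fresh[of "F \<union> fv b \<union> labels s"] by auto
  then have IH: "m \<in> Arr C \<and> Dom C m = treeI s \<otimes>\<^sub>o tyI C A \<and> Cod C m = tyI C A' \<and> is_type A' \<and>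
      is_type A \<and>
      valid (leaves s) \<and> linear s \<and> lc_at 0 (opn 0 x b) \<and>
      fv (opn 0 x b) = insert x (labels s)"
    using conjunct2[OF den_lam.IH[rule_format, of x]] by simp
  have "z \<in> fv b \<longleftrightarrow> z \<in> labels s" for z
    using IH x fv_opn_lower[of z b 0 x] fv_opn_upper[of z 0 x b] by (cases "z = x") auto
  then have "fv b = labels s" by blast
  then show ?case using IH lc_at_opn[of 0 x b] by simp
qed (auto simp: image_Un)

lemma den_arr: "den s v A m \<Longrightarrow> m \<in> Arr C \<and> Dom C m = treeI s \<and> Cod C m = tyI C A"
  using den_props by blast

lemma den_valid: "den s v A m \<Longrightarrow> is_type A \<and> valid (leaves s)"
  using den_props by blast

lemma den_distinct: "den s v A m \<Longrightarrow> linear s"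
  using den_props by blast

lemma den_fv: "den s v A m \<Longrightarrow> fv v = labels s"
  using den_props by blast

lemma den_lc: "den s v A m \<Longrightarrow> lc_at 0 v"
  using den_props by blast

lemma den_binding:
  assumes "valid (leaves s)" "\<And>x X. (x, X) \<in> set (leaves s) \<Longrightarrow> den (\<tau> x X) (\<sigma> x) X (\<nu> x X)"
  shows "binding \<tau> \<nu> s"
  unfolding binding_def
proof (intro conjI ballI)
  fix p assume "p \<in> set (leaves s)"
  then show "case p of (x, A) \<Rightarrow> valid (leaves (\<tau> x A)) \<and> \<nu> x A \<in> hom C (treeI (\<tau> x A)) (tyI C A)"
    using den_props[OF assms(2)[of "fst p" "snd p"]] by (simp add: hom_def split_beta)
qed (rule assms(1))

text \<open>With \<open>can_exists\<close>, rule \<open>den_can\<close> makes the shape of a tree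
  irrelevant; only its leaves count.\<close>

lemma den_iso:
  assumes "den s v A m" "mset (leaves t) = mset (leaves s)"
  obtains f where "can t s f" "den t v A (m \<cdot> f)"
proof -
  have "valid (leaves t)" using den_valid[OF assms(1)] mset_eq_setD[OF assms(2)] by (auto simp: valid_def)
  moreover have "linear t"
    using den_distinct[OF assms(1)] assms(2) by (metis mset_eq_imp_distinct_iff mset_map)
  ultimately obtain f where "can t s f" using can_exists assms(2) by blast
  then show ?thesis using that den_can[OF assms(1)] by blast
qed

subsection \<open>Substitution\<close>

text \<open>Substitution is composition. It is proved for simultaneous substitution with arbitrary
  trees \<open>\<tau>\<close> because under a binder it has to be extended by the identity on a
  fresh variable.\<close>

lemma den_subst:
  assumes "den s v A m" "\<And>x. lc_at 0 (\<sigma> x)"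
    "\<And>x X. (x, X) \<in> set (leaves s) \<Longrightarrow> den (\<tau> x X) (\<sigma> x) X (\<nu> x X)"
    "linear (bind \<tau> s)"
  shows "den (bind \<tau> s) (subst \<sigma> v) A (m \<cdot> bindM \<nu> s)"
  using assms
proof (induction arbitrary: \<sigma> \<tau> \<nu> rule: den.induct)
  case (den_var A x)
  then have "den (\<tau> x A) (\<sigma> x) A (\<nu> x A)" by auto
  then show ?case using den_arr[of "\<tau> x A" "\<sigma> x" A "\<nu> x A"] by simp
next
  case (den_can s v A m t f)
  have set: "set (leaves t) = set (leaves s)" using mset_eq_setD[OF can_mset[OF den_can.hyps(2)]] .
  have "linear (bind \<tau> s)"
    using den_can.prems(3) distinct_bind_cong[OF can_mset[OF den_can.hyps(2)]] by blast
  then have IH: "den (bind \<tau> s) (subst \<sigma> v) A (m \<cdot> bindM \<nu> s)"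
    using den_can.IH[of \<sigma> \<tau> \<nu>] den_can.prems set by blast
  have b: "binding \<tau> \<nu> t"
    by (rule den_binding[where \<sigma> = \<sigma>]) (use den_can.prems(2) can_valid[OF den_can.hyps(2)] in simp_all)
  then have b': "binding \<tau> \<nu> s" using binding_can[OF den_can.hyps(2)] by blast
  \<comment> \<open>A rearrangement of leaves becomes a rearrangement of the substituted
    trees.\<close>
  obtain f' where f': "can (bind \<tau> t) (bind \<tau> s) f'" "bindM \<nu> s \<cdot> f' = f \<cdot> bindM \<nu> t"
    using bind_can[OF den_can.hyps(2) b] by blast
  have "den (bind \<tau> t) (subst \<sigma> v) A ((m \<cdot> bindM \<nu> s) \<cdot> f')" using den.den_can[OF IH f'(1)] .
  moreover have "(m \<cdot> bindM \<nu> s) \<cdot> f' = (m \<cdot> f) \<cdot> bindM \<nu> t"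
    using f'(2) can_arr[OF f'(1)] can_arr[OF den_can.hyps(2)] den_arr[OF den_can.hyps(1)] bindM_arr[OF b] bindM_arr[OF b']
    by simp
  ultimately show ?case by simp
next
  case (den_op f A s v m)
  have IH: "den (bind \<tau> s) (subst \<sigma> v) A (m \<cdot> bindM \<nu> s)" using den_op by blast
  have b: "binding \<tau> \<nu> s"
    by (rule den_binding[where \<sigma> = \<sigma>]) (use den_op.prems(2) den_valid[OF den_op.hyps(3)] in simp_all)
  show ?case using den.den_op[OF den_op.hyps(1,2) IH] opI_arr[OF den_op.hyps(1,2)] bindM_arr[OF b]
      den_arr[OF den_op.hyps(3)] by (simp add: hom_def)
next
  case den_star
  then show ?case using den.den_star by simp
next
  case (den_to s v m t w A n)
  have d: "linear (bind \<tau> s)" "linear (bind \<tau> t)" using den_to.prems(3) by auto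
  have b: "binding \<tau> \<nu> (Node s t)"
    by (rule den_binding[where \<sigma> = \<sigma>]) (use den_to.prems(2) den_valid[OF den_to.hyps(1)] den_valid[OF den_to.hyps(2)] in simp_all)
  have IH: "den (bind \<tau> s) (subst \<sigma> v) TUnit (m \<cdot> bindM \<nu> s)" "den (bind \<tau> t) (subst \<sigma> w) A (n \<cdot> bindM \<nu> t)"
    using den_to d by auto
  show ?case using den.den_to[OF IH] den_to.prems(3) bindM_arr[of \<tau> \<nu> s] bindM_arr[of \<tau> \<nu> t] b
      den_arr[OF den_to.hyps(1)] den_arr[OF den_to.hyps(2)] den_valid[OF den_to.hyps(2)] by simp
next
  case (den_tensor s v A m t w A' n)
  have d: "linear (bind \<tau> s)" "linear (bind \<tau> t)" using den_tensor.prems(3) by auto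
  have b: "binding \<tau> \<nu> (Node s t)"
    by (rule den_binding[where \<sigma> = \<sigma>]) (use den_tensor.prems(2) den_valid[OF den_tensor.hyps(1)] den_valid[OF den_tensor.hyps(2)] in simp_all)
  have IH: "den (bind \<tau> s) (subst \<sigma> v) A (m \<cdot> bindM \<nu> s)" "den (bind \<tau> t) (subst \<sigma> w) A' (n \<cdot> bindM \<nu> t)"
    using den_tensor d by auto
  show ?case using den.den_tensor[OF IH] den_tensor.prems(3) bindM_arr[of \<tau> \<nu> s] bindM_arr[of \<tau> \<nu> t] b
      den_arr[OF den_tensor.hyps(1)] den_arr[OF den_tensor.hyps(2)] by simp
next
  case (den_app s v A A' m t w n)
  have d: "linear (bind \<tau> s)" "linear (bind \<tau> t)" using den_app.prems(3) by auto
  have b: "binding \<tau> \<nu> (Node s t)"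
    by (rule den_binding[where \<sigma> = \<sigma>]) (use den_app.prems(2) den_valid[OF den_app.hyps(1)] den_valid[OF den_app.hyps(2)] in simp_all)
  have IH: "den (bind \<tau> s) (subst \<sigma> v) (TLolli A A') (m \<cdot> bindM \<nu> s)" "den (bind \<tau> t) (subst \<sigma> w) A (n \<cdot> bindM \<nu> t)"
    using den_app d by auto
  show ?case using den.den_app[OF IH] den_app.prems(3) bindM_arr[of \<tau> \<nu> s] bindM_arr[of \<tau> \<nu> t] b
      den_arr[OF den_app.hyps(1)] den_arr[OF den_app.hyps(2)] den_valid[OF den_app.hyps(1)] by simp
next
  case (den_lam F s A b A' m)
  let ?F = "F \<union> labels s \<union> labels (bind \<tau> s) \<union> fv b"
  have fin: "finite ?F" using den_lam.hyps by simp
  obtain z0 where z0: "z0 \<notin> ?F" using ex_fresh[OF fin] by blast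
  then have d0: "den (Node s (Leaf z0 A)) (opn 0 z0 b) A' m" using den_lam.IH by blast
  have v: "valid (leaves s)" "is_type A" using den_valid[OF d0] by auto
  have b: "binding \<tau> \<nu> s"
    by (rule den_binding[where \<sigma> = \<sigma>]) (use den_lam.prems(2) v in simp_all)
  note bm = bindM_arr[OF b]
  have "den (Node (bind \<tau> s) (Leaf x A)) (opn 0 x (subst \<sigma> b)) A' (m \<cdot> (bindM \<nu> s \<rhd> (tyI C A)))"
    if x: "x \<notin> ?F" for x
  proof -
    \<comment> \<open>The fresh variable is sent to itself, to its own leaf and to the identity.
      Nothing changes on \<open>s\<close>, where it does not occur.\<close>
    let ?\<sigma> = "\<sigma>(x := FV x)" and ?\<tau> = "\<tau>(x := Leaf x)" and ?\<nu> = "\<nu>(x := \<lambda>A. Id C (tyI C A))"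
    have e: "bind ?\<tau> s = bind \<tau> s" using x by (simp add: bind_fresh)
    have e': "bindM ?\<nu> s = bindM \<nu> s" using x by (simp add: bindM_fresh)
    have "den (bind ?\<tau> (Node s (Leaf x A))) (subst ?\<sigma> (opn 0 x b)) A' (m \<cdot> bindM ?\<nu> (Node s (Leaf x A)))"
    proof (rule den_lam.IH[rule_format, THEN conjunct2, rule_format])
      show "x \<notin> F" using x by blast
      show "lc_at 0 (?\<sigma> y)" for y using den_lam.prems(1) by simp
      show "linear (bind ?\<tau> (Node s (Leaf x A)))" using den_lam.prems(3) x by (auto simp: e)
      show "den (?\<tau> y X) (?\<sigma> y) X (?\<nu> y X)" if "(y, X) \<in> set (leaves (Node s (Leaf x A)))" for y X
      proof -
        from that consider "y = x" "X = A" | "(y, X) \<in> set (leaves s)" by auto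
        then show ?thesis
        proof cases
          case 2
          then have "y \<noteq> x" using x by (auto simp: image_iff)
          then show ?thesis using den_lam.prems(2)[of y X] 2 by simp
        qed (use den.den_var v in auto)
      qed
    qed
    moreover have "subst ?\<sigma> (opn 0 x b) = opn 0 x (subst ?\<sigma> b)"
      using den_lam.prems(1) by (intro subst_opn) auto
    moreover have "subst ?\<sigma> b = subst \<sigma> b" using x by (intro subst_cong) auto
    ultimately show ?thesis by (simp add: e e')
  qed
  then have "den (bind \<tau> s) (Lam A (subst \<sigma> b)) (TLolli A A') (Curry C (treeI (bind \<tau> s)) (tyI C A) (m \<cdot> (bindM \<nu> s \<rhd> (tyI C A))))"
    using den.den_lam[OF fin, of "bind \<tau> s" A "subst \<sigma> b"] by blast
  \<comment> \<open>Naturality of currying moves the substitution out of the body.\<close>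
  moreover have "Curry C (treeI (bind \<tau> s)) (tyI C A) (m \<cdot> (bindM \<nu> s \<rhd> (tyI C A))) =
      Curry C (treeI s) (tyI C A) m \<cdot> bindM \<nu> s"
    by (rule Curry_nat) (use bm den_arr[OF d0] v in simp_all)
  ultimately show ?case by simp
next
  case (den_pm s v A A' m F t b D n)
  have d: "linear (bind \<tau> s)" "linear (bind \<tau> t)" using den_pm.prems(3) by auto
  let ?F = "F \<union> labels t \<union> labels (bind \<tau> t) \<union> fv b"
  have fin: "finite ?F" using den_pm.hyps by simp
  obtain z0 z1 where z0: "z0 \<notin> ?F" "z1 \<notin> ?F" "z0 \<noteq> z1" using ex_fresh2[OF fin] by blast
  then have d0: "den (Node (Node t (Leaf z0 A)) (Leaf z1 A')) (opn 0 z1 (opn 1 z0 b)) D n" using den_pm.IH(2) by blast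
  have v: "valid (leaves t)" "is_type A" "is_type A'" using den_valid[OF d0] by auto
  have b: "binding \<tau> \<nu> (Node s t)"
    by (rule den_binding[where \<sigma> = \<sigma>]) (use den_pm.prems(2) v den_valid[OF den_pm.hyps(1)] in simp_all)
  then have bs: "binding \<tau> \<nu> s" "binding \<tau> \<nu> t" by auto
  note bm = bindM_arr[OF bs(1)] bindM_arr[OF bs(2)]
  let ?n = "n \<cdot> ((bindM \<nu> t \<rhd> (tyI C A)) \<rhd> (tyI C A'))"
  have IH1: "den (bind \<tau> s) (subst \<sigma> v) (TTens A A') (m \<cdot> bindM \<nu> s)"
    using den_pm.IH(1)[of \<sigma> \<tau> \<nu>] den_pm.prems d by auto
  have "den (Node (Node (bind \<tau> t) (Leaf x A)) (Leaf y A')) (opn 0 y (opn 1 x (subst \<sigma> b))) D ?n"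
    if x: "x \<notin> ?F" and y: "y \<notin> ?F" and xy: "x \<noteq> y" for x y
  proof -
    let ?\<sigma> = "\<sigma>(x := FV x, y := FV y)" and ?\<tau> = "\<tau>(x := Leaf x, y := Leaf y)"
      and ?\<nu> = "\<nu>(x := \<lambda>A. Id C (tyI C A), y := \<lambda>A. Id C (tyI C A))"
    let ?t = "Node (Node t (Leaf x A)) (Leaf y A')"
    have e: "bind ?\<tau> t = bind \<tau> t" using x y by (simp add: bind_fresh)
    have e': "bindM ?\<nu> t = bindM \<nu> t" using x y by (simp add: bindM_fresh)
    have "den (bind ?\<tau> ?t) (subst ?\<sigma> (opn 0 y (opn 1 x b))) D (n \<cdot> bindM ?\<nu> ?t)"
    proof (rule den_pm.IH(2)[rule_format, THEN conjunct2, rule_format])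
      show "x \<notin> F" "y \<notin> F" "x \<noteq> y" using x y xy by auto
      show "lc_at 0 (?\<sigma> y)" for y using den_pm.prems(1) by simp
      show "linear (bind ?\<tau> ?t)" using d(2) x y xy by (auto simp: e)
      show "den (?\<tau> z X) (?\<sigma> z) X (?\<nu> z X)" if "(z, X) \<in> set (leaves ?t)" for z X
      proof -
        from that consider "z = y" "X = A'" | "z = x" "X = A" | "(z, X) \<in> set (leaves t)" by auto
        then show ?thesis
        proof cases
          case 3
          then have "z \<noteq> x" "z \<noteq> y" using x y by (auto simp: image_iff)
          then show ?thesis using den_pm.prems(2)[of z X] 3 by simp
        qed (use den.den_var v xy in auto)
      qed
    qed
    moreover have "subst ?\<sigma> (opn 0 y (opn 1 x b)) = opn 0 y (subst ?\<sigma> (opn 1 x b))"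
      using den_pm.prems(1) by (intro subst_opn) auto
    moreover have "subst ?\<sigma> (opn 1 x b) = opn 1 x (subst ?\<sigma> b)"
      using den_pm.prems(1) xy by (intro subst_opn) auto
    moreover have "subst ?\<sigma> b = subst \<sigma> b" using x y by (intro subst_cong) auto
    ultimately show ?thesis using xy by (simp add: e e')
  qed
  then have r: "den (Node (bind \<tau> s) (bind \<tau> t)) (Pm (subst \<sigma> v) (subst \<sigma> b)) D
    (?n \<cdot> assoc' (treeI (bind \<tau> t)) (tyI C A) (tyI C A') \<cdot> Sym C (tyI C A \<otimes>\<^sub>o tyI C A') (treeI (bind \<tau> t)) \<cdot>
      ((m \<cdot> bindM \<nu> s) \<rhd> (treeI (bind \<tau> t))))"
    using den.den_pm[OF IH1 fin, of "bind \<tau> t" "subst \<sigma> b"] den_pm.prems(3) by simp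
  let ?A = "tyI C A" and ?A' = "tyI C A'"
  note a = den_arr[OF den_pm.hyps(1)] den_arr[OF d0] v bm
  have "pm_mor (treeI (bind \<tau> t)) ?A ?A' (m \<cdot> bindM \<nu> s) ?n =
      pm_mor (treeI t) ?A ?A' m n \<cdot> (bindM \<nu> s \<otimes>\<^sub>m bindM \<nu> t)"
    using a by (intro pm_mor_nat) simp_all
  then show ?case using r by simp
qed

end

section \<open>Contexts as trees, and shuffles up to reordering\<close>

fun ctx_tree :: "'g ctx \<Rightarrow> 'g ctree" where
  "ctx_tree [] = Empty"
| "ctx_tree [(x, A)] = Leaf x A"
| "ctx_tree ((x, A) # p # \<Gamma>) = Node (ctx_tree (p # \<Gamma>)) (Leaf x A)"

lemma mset_ctx_tree [simp]: "mset (leaves (ctx_tree \<Gamma>)) = mset \<Gamma>"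
  by (induction \<Gamma> rule: ctx_tree.induct) auto

lemma set_ctx_tree [simp]: "set (leaves (ctx_tree \<Gamma>)) = set \<Gamma>"
  by (metis mset_ctx_tree set_mset_mset)

lemma distinct_ctx_tree [simp]: "linear (ctx_tree \<Gamma>) \<longleftrightarrow> distinct_vars \<Gamma>"
  by (rule mset_eq_imp_distinct_iff) simp

text \<open>The typing rules insist on shuffles that keep the order of variables, whereas a tree
  provides only multisets. Each entry of \<open>\<Gamma>\<close> is assigned to one of the two
  sides.\<close>

lemma shuffle_exists: "mset \<Gamma> = mset l1 + mset l2 \<Longrightarrow>
  \<exists>\<Gamma>1 \<Gamma>2. mset \<Gamma>1 = mset l1 \<and> mset \<Gamma>2 = mset l2 \<and> \<Gamma> \<in> shuffles \<Gamma>1 \<Gamma>2"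
proof (induction \<Gamma> arbitrary: l1 l2)
  case (Cons a \<Gamma>)
  have "a \<in># mset l1 + mset l2" unfolding Cons.prems[symmetric] by simp
  then consider "a \<in> set l1" | "a \<in> set l2" by auto
  then show ?case
  proof cases
    case 1
    then obtain M where "mset l1 = add_mset a M" by (metis multi_member_split set_mset_mset)
    then have "mset \<Gamma> = mset (remove1 a l1) + mset l2" using Cons.prems by simp
    from Cons.IH[OF this] obtain \<Gamma>1 \<Gamma>2 where "mset \<Gamma>1 = mset (remove1 a l1)" "mset \<Gamma>2 = mset l2" "\<Gamma> \<in> shuffles \<Gamma>1 \<Gamma>2"
      by blast
    then show ?thesis using 1 by (intro exI[of _ "a # \<Gamma>1"] exI[of _ \<Gamma>2]) (auto intro: Cons_in_shuffles_leftI)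
  next
    case 2
    then obtain M where "mset l2 = add_mset a M" by (metis multi_member_split set_mset_mset)
    then have "mset \<Gamma> = mset l1 + mset (remove1 a l2)" using Cons.prems by simp
    from Cons.IH[OF this] obtain \<Gamma>1 \<Gamma>2 where "mset \<Gamma>1 = mset l1" "mset \<Gamma>2 = mset (remove1 a l2)" "\<Gamma> \<in> shuffles \<Gamma>1 \<Gamma>2"
      by blast
    then show ?thesis using 2 by (intro exI[of _ \<Gamma>1] exI[of _ "a # \<Gamma>2"]) (auto intro: Cons_in_shuffles_rightI)
  qed
qed simp

lemma mset_shuffles: "E \<in> shuffles \<Gamma> \<Delta> \<Longrightarrow> mset E = mset \<Gamma> + mset \<Delta>"
  by (induction \<Gamma> \<Delta> arbitrary: E rule: shuffles.induct) auto

lemma mset_Sf: "E \<in> Sf \<Gamma>s \<Longrightarrow> mset E = sum_list (map mset \<Gamma>s)"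
  by (induction \<Gamma>s arbitrary: E) (auto dest: mset_shuffles)

context autonomous_category
begin

section \<open>Special substitutions and named binders\<close>

abbreviation idM :: "var \<Rightarrow> 'o ty \<Rightarrow> 'm" where
  "idM \<equiv> \<lambda>_ A. Id C (tyI C A)"

lemma bindM_idM: "valid (leaves s) \<Longrightarrow> bindM idM s = Id C (treeI s)"
  by (induction s) auto

lemma bindM_idM_fresh:
  "valid (leaves s) \<Longrightarrow> x \<notin> labels s \<Longrightarrow> bindM (idM(x := a)) s = Id C (treeI s)"
  "valid (leaves s) \<Longrightarrow> x \<notin> labels s \<Longrightarrow> y \<notin> labels s \<Longrightarrow>
    bindM (idM(x := a, y := b)) s = Id C (treeI s)"
  by (simp_all add: bindM_fresh bindM_idM)

lemma bind_Leaf_fresh: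
  "x \<notin> labels s \<Longrightarrow> bind (Leaf(x := a)) s = s"
  "x \<notin> labels s \<Longrightarrow> y \<notin> labels s \<Longrightarrow> bind (Leaf(x := a, y := b)) s = s"
  by (simp_all add: bind_fresh)

lemma den_leaf: "den s v A m \<Longrightarrow> (x, X) \<in> set (leaves s) \<Longrightarrow> is_type X"
  using den_valid[of s v A m] by (fastforce simp: valid_def)

text \<open>The case of \<open>den_subst\<close> in which every other variable is sent to
  itself.\<close>

lemma den_subst_last:
  assumes v: "den (Node s (Leaf x X)) v A m" and w: "den t w X n" and d: "linear (Node s t)"
  shows "den (Node s t) (v[x ::= w]) A (m \<cdot> (treeI s \<lhd> n))"
proof -
  let ?s = "Node s (Leaf x X)"
  have x: "x \<notin> labels s" using den_distinct[OF v] by auto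
  have vs: "valid (leaves s)" using den_valid[OF v] by simp
  have b: "bind (Leaf(x := \<lambda>_. t)) ?s = Node s t" using x by (simp add: bind_Leaf_fresh)
  have "den (bind (Leaf(x := \<lambda>_. t)) ?s) (v[x ::= w]) A (m \<cdot> bindM (idM(x := \<lambda>_. n)) ?s)"
  proof (rule den_subst[OF v])
    show "lc_at 0 ((FV(x := w)) y)" for y using den_lc[OF w] by simp
    show "den ((Leaf(x := \<lambda>_. t)) y Y) ((FV(x := w)) y) Y ((idM(x := \<lambda>_. n)) y Y)"
      if "(y, Y) \<in> set (leaves ?s)" for y Y
    proof (cases "y = x")
      case True
      then show ?thesis using that x w by (auto simp: image_iff)
    next
      case False
      then show ?thesis using den_var[OF den_leaf[OF v that]] by simp
    qed
    show "linear (bind (Leaf(x := \<lambda>_. t)) ?s)" using d b by simp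
  qed
  then show ?thesis using b x vs by (simp add: bindM_idM_fresh)
qed

lemma den_subst_last2:
  assumes v: "den (Node (Node s (Leaf x X)) (Leaf y Y)) v A m" and w: "den t w X n" and u: "den t' w' Y n'"
    and d: "linear (Node (Node s t) t')"
  shows "den (Node (Node s t) t') (subst (FV(x := w, y := w')) v) A (m \<cdot> ((treeI s \<lhd> n) \<otimes>\<^sub>m n'))"
proof -
  let ?s = "Node (Node s (Leaf x X)) (Leaf y Y)"
  let ?\<tau> = "Leaf(x := \<lambda>_. t, y := \<lambda>_. t')" and ?\<nu> = "idM(x := \<lambda>_. n, y := \<lambda>_. n')" and ?\<sigma> = "FV(x := w, y := w')"
  have x: "x \<notin> labels s" "y \<notin> labels s" "x \<noteq> y" using den_distinct[OF v] by auto
  have vs: "valid (leaves s)" using den_valid[OF v] by simp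
  have b: "bind ?\<tau> ?s = Node (Node s t) t'" using x by (simp add: bind_Leaf_fresh)
  have "den (bind ?\<tau> ?s) (subst ?\<sigma> v) A (m \<cdot> bindM ?\<nu> ?s)"
  proof (rule den_subst[OF v])
    show "lc_at 0 (?\<sigma> y)" for y using den_lc[OF w] den_lc[OF u] by simp
    show "den (?\<tau> z Z) (?\<sigma> z) Z (?\<nu> z Z)" if "(z, Z) \<in> set (leaves ?s)" for z Z
    proof (cases "z = x \<or> z = y")
      case True
      then show ?thesis using that x w u by (auto simp: image_iff)
    next
      case False
      then show ?thesis using den_var[OF den_leaf[OF v that]] by simp
    qed
    show "linear (bind ?\<tau> ?s)" using d b by simp
  qed
  then show ?thesis using b x vs by (simp add: bindM_idM_fresh)
qed

text \<open>All components of this substitution are identities, so the morphism stays the same;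
  injectivity keeps the labels distinct.\<close>

lemma den_rename:
  assumes v: "den s v A m" and \<pi>: "inj \<pi>"
  shows "den (bind (\<lambda>x. Leaf (\<pi> x)) s) (subst (\<lambda>x. FV (\<pi> x)) v) A m"
proof -
  have l: "leaves (bind (\<lambda>x. Leaf (\<pi> x)) t) = map (map_prod \<pi> id) (leaves t)" for t :: "'o ctree"
    by (induction t) auto
  have "den (bind (\<lambda>x. Leaf (\<pi> x)) s) (subst (\<lambda>x. FV (\<pi> x)) v) A (m \<cdot> bindM idM s)"
  proof (rule den_subst[OF v])
    show "linear (bind (\<lambda>x. Leaf (\<pi> x)) s)"
      using den_distinct[OF v] \<pi> distinct_map[of \<pi> "map fst (leaves s)"] unfolding l
      by (simp add: comp_def inj_on_subset[OF \<pi> subset_UNIV])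
  qed (use den_var den_leaf[OF v] in auto)
  then show ?thesis using den_arr[OF v] den_valid[OF v] by (simp add: bindM_idM)
qed

lemma bind_rename_fresh:
  "(\<And>x. x \<in> labels s \<Longrightarrow> \<pi> x = x) \<Longrightarrow> bind (\<lambda>x. Leaf (\<pi> x)) s = s"
  using bind_cong[of s "\<lambda>x. Leaf (\<pi> x)" Leaf] by force

text \<open>The passage from a named binder to the cofinite premise of \<open>den_lam\<close>: by
  renaming, the denotation obtained for one name serves for every fresh name.\<close>

lemma den_lam_intro:
  assumes v: "den (Node s (Leaf x A)) v A' m"
  shows "den s (lam x A v) (TLolli A A') (Curry C (treeI s) (tyI C A) m)"
proof -
  let ?b = "close 0 x v"
  let ?F = "insert x (labels s)"
  have fv: "fv v = insert x (labels s)" using den_fv[OF v] by auto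
  have "den (Node s (Leaf z A)) (opn 0 z ?b) A' m" if z: "z \<notin> ?F" for z
  proof -
    \<comment> \<open>A transposition, since a renaming has to be injective on all variables; the
      plain update \<open>id(x := z)\<close> is not.\<close>
    define \<pi> where "\<pi> = id(x := z, z := x)"
    have "inj \<pi>" by (auto simp: \<pi>_def inj_def)
    have fix\<pi>: "\<pi> y = y" if "y \<in> labels s" for y
      using that z den_distinct[OF v] by (auto simp: \<pi>_def)
    have "subst (\<lambda>x. FV (\<pi> x)) v = subst (\<lambda>x. FV (\<pi> x)) (opn 0 x ?b)"
      using den_lc[OF v] by (simp add: opn_close)
    also have "\<dots> = opn 0 z (subst (\<lambda>x. FV (\<pi> x)) ?b)"
      using z by (intro subst_opn) (auto simp: \<pi>_def)
    also have "subst (\<lambda>x. FV (\<pi> x)) ?b = subst FV ?b"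
      using fix\<pi> fv by (intro subst_cong) auto
    finally show ?thesis
      using den_rename[OF v \<open>inj \<pi>\<close>] bind_rename_fresh[of s \<pi>, OF fix\<pi>] z by (simp add: \<pi>_def)
  qed
  then show ?thesis unfolding lam_def by (intro den_lam[of ?F]) auto
qed

lemma den_pm_intro:
  assumes v: "den s v (TTens A A') m" and w: "den (Node (Node t (Leaf x A)) (Leaf y A')) w D n"
    and d: "linear (Node s t)"
  shows "den (Node s t) (pm v x y w) D (pm_mor (treeI t) (tyI C A) (tyI C A') m n)"
proof -
  let ?b = "close 0 y (close 1 x w)"
  let ?F = "insert x (insert y (labels t))"
  have fv: "fv w = ?F" using den_fv[OF w] by auto
  have xy: "x \<noteq> y" "x \<notin> labels t" "y \<notin> labels t" using den_distinct[OF w] by auto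
  have "den (Node (Node t (Leaf x' A)) (Leaf y' A')) (opn 0 y' (opn 1 x' ?b)) D n"
    if z: "x' \<notin> ?F" "y' \<notin> ?F" "x' \<noteq> y'" for x' y'
  proof -
    \<comment> \<open>Two disjoint transpositions, hence an involution, because the four names are
      distinct.\<close>
    define \<pi> where "\<pi> = id(x := x', x' := x, y := y', y' := y)"
    have "inj \<pi>"
      by (rule inj_on_inverseI[of _ \<pi>]) (use z xy in \<open>auto simp: \<pi>_def\<close>)
    have \<pi>: "\<pi> x = x'" "\<pi> y = y'" using z xy by (auto simp: \<pi>_def)
    have fix\<pi>: "\<pi> z = z" if "z \<in> labels t" for z
      using that z xy by (auto simp: \<pi>_def)
    have "subst (\<lambda>x. FV (\<pi> x)) w = subst (\<lambda>x. FV (\<pi> x)) (opn 0 y (opn 1 x ?b))"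
      using den_lc[OF w] xy by (subst opn_pm) simp_all
    also have "\<dots> = opn 0 y' (subst (\<lambda>x. FV (\<pi> x)) (opn 1 x ?b))"
      using \<pi> by (intro subst_opn) auto
    also have "subst (\<lambda>x. FV (\<pi> x)) (opn 1 x ?b) = opn 1 x' (subst (\<lambda>x. FV (\<pi> x)) ?b)"
      using \<pi> by (intro subst_opn) auto
    also have "subst (\<lambda>x. FV (\<pi> x)) ?b = subst FV ?b"
      using fix\<pi> fv by (intro subst_cong) auto
    finally show ?thesis
      using den_rename[OF w \<open>inj \<pi>\<close>] bind_rename_fresh[of t \<pi>, OF fix\<pi>] \<pi> by simp
  qed
  then show ?thesis unfolding pm_def by (intro den_pm[OF v, of ?F] d) auto
qed

subsection \<open>Uniqueness of denotations\<close>

text \<open>Inversion, as in the lemmas that follow: the uses of \<open>den_can\<close> that end a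
  derivation collapse into one canonical isomorphism or are absorbed into the denotation of a
  subterm.\<close>

lemma den_FV: "den s (FV x) A m \<Longrightarrow> can s (Leaf x A) m"
proof (induction s "FV x :: ('o, ('o, 'm) lang_op) tm" A m rule: den.induct)
  case (den_var A)
  then show ?case using can_id[of "Leaf x A"] by simp
qed (auto intro: can_comp)

lemma den_Op: "den s (Op f vs) A m \<Longrightarrow>
  \<exists>v A' m'. vs = [v] \<and> lang_args C f = [A'] \<and> f \<in> Ops (lang_signature C) \<and> A = lang_res C f \<and> den s v A' m' \<and> m = opI C f \<cdot> m'"
proof (induction s "Op f vs" A m rule: den.induct)
  case (den_can s A m t g)
  then obtain v A' m' where h: "vs = [v]" "lang_args C f = [A']" "f \<in> Ops (lang_signature C)" "A = lang_res C f"
      "den s v A' m'" "m = opI C f \<cdot> m'"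
    by blast
  then have "m \<cdot> g = opI C f \<cdot> (m' \<cdot> g)"
    using den_arr[OF h(5)] can_arr[OF den_can.hyps(3)] opI_arr(1)[OF h(3,2)] by (simp add: hom_def)
  then show ?case using h den.den_can[OF h(5) den_can.hyps(3)] by blast
qed blast

lemma den_Star: "den s Star A m \<Longrightarrow> A = TUnit \<and> can s Empty m"
proof (induction s "Star :: ('o, ('o, 'm) lang_op) tm" A m rule: den.induct)
  case den_star
  then show ?case using can_id[of Empty] by simp
qed (auto intro: can_comp)

lemma den_ToStar: "den s (ToStar v w) A m \<Longrightarrow>
  \<exists>s1 s2 m1 m2 f. can s (Node s1 s2) f \<and> den s1 v TUnit m1 \<and> den s2 w A m2 \<and> m = LUnit C (tyI C A) \<cdot> (m1 \<otimes>\<^sub>m m2) \<cdot> f"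
proof (induction s "ToStar v w" A m rule: den.induct)
  case (den_can s A m t g)
  then obtain s1 s2 m1 m2 f where h: "can s (Node s1 s2) f" "den s1 v TUnit m1" "den s2 w A m2" "m = LUnit C (tyI C A) \<cdot> (m1 \<otimes>\<^sub>m m2) \<cdot> f"
    by blast
  then have "m \<cdot> g = LUnit C (tyI C A) \<cdot> (m1 \<otimes>\<^sub>m m2) \<cdot> (f \<cdot> g)"
    using den_arr[OF h(2)] den_arr[OF h(3)] can_arr[OF den_can.hyps(3)] can_arr[OF h(1)] den_valid[OF h(3)] by simp
  then show ?case using h can_comp[OF den_can.hyps(3) h(1)] by blast
next
  case (den_to s m t A n)
  have "LUnit C (tyI C A) \<cdot> (m \<otimes>\<^sub>m n) = LUnit C (tyI C A) \<cdot> (m \<otimes>\<^sub>m n) \<cdot> Id C (treeI (Node s t))"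
    using den_props[OF den_to.hyps(1)] den_props[OF den_to.hyps(3)] by simp
  moreover have "can (Node s t) (Node s t) (Id C (treeI (Node s t)))"
    using den_valid[OF den_to.hyps(1)] den_valid[OF den_to.hyps(3)] by (intro can_id) simp
  ultimately show ?case using den_to.hyps(1,3) by blast
qed

lemma den_Tensor: "den s (Tensor v w) D m \<Longrightarrow>
  \<exists>s1 s2 A A' m1 m2 f. D = TTens A A' \<and> can s (Node s1 s2) f \<and> den s1 v A m1 \<and> den s2 w A' m2 \<and> m = (m1 \<otimes>\<^sub>m m2) \<cdot> f"
proof (induction s "Tensor v w" D m rule: den.induct)
  case (den_can s D m t g)
  then obtain s1 s2 A A' m1 m2 f where h: "can s (Node s1 s2) f" "den s1 v A m1" "den s2 w A' m2" "D = TTens A A'" "m = (m1 \<otimes>\<^sub>m m2) \<cdot> f"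
    by blast
  then have "m \<cdot> g = (m1 \<otimes>\<^sub>m m2) \<cdot> (f \<cdot> g)"
    using den_arr[OF h(2)] den_arr[OF h(3)] can_arr[OF den_can.hyps(3)] can_arr[OF h(1)] den_valid[OF h(3)] by simp
  then show ?case using h can_comp[OF den_can.hyps(3) h(1)] by blast
next
  case (den_tensor s A m t A' n)
  have "m \<otimes>\<^sub>m n = (m \<otimes>\<^sub>m n) \<cdot> Id C (treeI (Node s t))"
    using den_props[OF den_tensor.hyps(1)] den_props[OF den_tensor.hyps(3)] by simp
  moreover have "can (Node s t) (Node s t) (Id C (treeI (Node s t)))"
    using den_valid[OF den_tensor.hyps(1)] den_valid[OF den_tensor.hyps(3)] by (intro can_id) simp
  ultimately show ?case using den_tensor.hyps(1,3) by blast
qed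

lemma den_App: "den s (App v w) A' m \<Longrightarrow>
  \<exists>s1 s2 A m1 m2 f. can s (Node s1 s2) f \<and> den s1 v (TLolli A A') m1 \<and> den s2 w A m2 \<and>
    m = Eval C (tyI C A) (tyI C A') \<cdot> (m1 \<otimes>\<^sub>m m2) \<cdot> f"
proof (induction s "App v w" A' m rule: den.induct)
  case (den_can s A' m t g)
  then obtain s1 s2 A m1 m2 f where h: "can s (Node s1 s2) f" "den s1 v (TLolli A A') m1" "den s2 w A m2"
      "m = Eval C (tyI C A) (tyI C A') \<cdot> (m1 \<otimes>\<^sub>m m2) \<cdot> f"
    by blast
  then have "m \<cdot> g = Eval C (tyI C A) (tyI C A') \<cdot> (m1 \<otimes>\<^sub>m m2) \<cdot> (f \<cdot> g)"
    using den_arr[OF h(2)] den_arr[OF h(3)] can_arr[OF den_can.hyps(3)] can_arr[OF h(1)] den_valid[OF h(2)] by simp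
  then show ?case using h can_comp[OF den_can.hyps(3) h(1)] by blast
next
  case (den_app s A A' m t n)
  have "Eval C (tyI C A) (tyI C A') \<cdot> (m \<otimes>\<^sub>m n) = Eval C (tyI C A) (tyI C A') \<cdot> (m \<otimes>\<^sub>m n) \<cdot> Id C (treeI (Node s t))"
    using den_props[OF den_app.hyps(1)] den_props[OF den_app.hyps(3)] by simp
  moreover have "can (Node s t) (Node s t) (Id C (treeI (Node s t)))"
    using den_valid[OF den_app.hyps(1)] den_valid[OF den_app.hyps(3)] by (intro can_id) simp
  ultimately show ?case using den_app.hyps(1,3) by blast
qed

text \<open>No isomorphism is left over: by naturality of currying it is absorbed into the body, for
  all fresh names at once.\<close>

lemma den_Lam: "den s (Lam A b) D m \<Longrightarrow>
  \<exists>A' F n. D = TLolli A A' \<and> finite F \<and> (\<forall>x. x \<notin> F \<longrightarrow> den (Node s (Leaf x A)) (opn 0 x b) A' n) \<and>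
    m = Curry C (treeI s) (tyI C A) n"
proof (induction s "Lam A b" D m rule: den.induct)
  case (den_can s D m t g)
  then obtain A' F n where h: "D = TLolli A A'" "finite F" "\<forall>x. x \<notin> F \<longrightarrow> den (Node s (Leaf x A)) (opn 0 x b) A' n"
      "m = Curry C (treeI s) (tyI C A) n"
    by blast
  obtain x where "x \<notin> F" using ex_fresh[OF h(2)] by blast
  with h(3) have d: "den (Node s (Leaf x A)) (opn 0 x b) A' n" by blast
  have A: "is_type A" using den_valid[OF d] by simp
  note a = den_arr[OF d] can_arr[OF den_can.hyps(3)] can_valid[OF den_can.hyps(3)] A
  have "den (Node t (Leaf x A)) (opn 0 x b) A' (n \<cdot> (g \<rhd> (tyI C A)))" if "x \<notin> F" for x
    using den.den_can[OF h(3)[rule_format, OF that] can_tens[OF den_can.hyps(3) can_id[of "Leaf x A"]]] A by simp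
  moreover have "Curry C (treeI t) (tyI C A) (n \<cdot> (g \<rhd> (tyI C A))) = m \<cdot> g"
    unfolding h(4) by (rule Curry_nat) (use a in simp_all)
  ultimately show ?case using h(1,2) by metis
qed blast

lemma den_Pm: "den s (Pm v b) D m \<Longrightarrow>
  \<exists>s1 s2 A A' m1 n f F. can s (Node s1 s2) f \<and> den s1 v (TTens A A') m1 \<and> finite F \<and>
    (\<forall>x y. x \<notin> F \<longrightarrow> y \<notin> F \<longrightarrow> x \<noteq> y \<longrightarrow>
      den (Node (Node s2 (Leaf x A)) (Leaf y A')) (opn 0 y (opn 1 x b)) D n) \<and>
    m = (pm_mor (treeI s2) (tyI C A) (tyI C A') m1 n) \<cdot> f"
proof (induction s "Pm v b" D m rule: den.induct)
  case (den_can s D m t g)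
  then obtain s1 s2 A A' m1 n f F where h: "can s (Node s1 s2) f" "den s1 v (TTens A A') m1" "finite F"
    "\<forall>x y. x \<notin> F \<longrightarrow> y \<notin> F \<longrightarrow> x \<noteq> y \<longrightarrow>
      den (Node (Node s2 (Leaf x A)) (Leaf y A')) (opn 0 y (opn 1 x b)) D n"
    and m: "m = (pm_mor (treeI s2) (tyI C A) (tyI C A') m1 n) \<cdot> f"
    by blast
  obtain x y where "x \<notin> F" "y \<notin> F" "x \<noteq> y" using ex_fresh2[OF h(3)] by blast
  with h(4) have d: "den (Node (Node s2 (Leaf x A)) (Leaf y A')) (opn 0 y (opn 1 x b)) D n" by blast
  have "m \<cdot> g = (pm_mor (treeI s2) (tyI C A) (tyI C A') m1 n) \<cdot> (f \<cdot> g)"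
    unfolding m using den_arr[OF d] den_valid[OF d] den_arr[OF h(2)] can_arr[OF h(1)] can_arr[OF den_can.hyps(3)] den_valid[OF h(2)]
    by simp
  then show ?case using h can_comp[OF den_can.hyps(3) h(1)] by blast
next
  case (den_pm s A A' m F t D n)
  obtain x y where "x \<notin> F" "y \<notin> F" "x \<noteq> y" using ex_fresh2[OF den_pm.hyps(3)] by blast
  with den_pm.hyps(4) have d: "den (Node (Node t (Leaf x A)) (Leaf y A')) (opn 0 y (opn 1 x b)) D n" by blast
  let ?m = "pm_mor (treeI t) (tyI C A) (tyI C A') m n"
  have "?m = ?m \<cdot> Id C (treeI (Node s t))"
    using den_arr[OF d] den_valid[OF d] den_arr[OF den_pm.hyps(1)] den_valid[OF den_pm.hyps(1)] by simp
  moreover have "can (Node s t) (Node s t) (Id C (treeI (Node s t)))"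
    using den_valid[OF d] den_valid[OF den_pm.hyps(1)] by (intro can_id) simp
  moreover have "\<forall>x y. x \<notin> F \<longrightarrow> y \<notin> F \<longrightarrow> x \<noteq> y \<longrightarrow>
      den (Node (Node t (Leaf x A)) (Leaf y A')) (opn 0 y (opn 1 x b)) D n"
    using den_pm.hyps(4) by blast
  ultimately show ?case using den_pm.hyps(1,3) by blast
qed

text \<open>The corresponding halves have the same leaves, so canonical isomorphisms between them
  exist, and by coherence their tensor can only be \<open>f\<close>.\<close>

lemma can_Node_split:
  assumes f: "can (Node s t) (Node s' t') f" and d: "linear (Node s t)"
    and e: "labels s = labels s'"
  shows "\<exists>g h. can s s' g \<and> can t t' h \<and> f = g \<otimes>\<^sub>m h"
proof -
  have d': "linear (Node s' t')" using can_distinct[OF f] d by blast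
  let ?P = "\<lambda>p. fst p \<in> labels s"
  have m: "mset (leaves s) + mset (leaves t) = mset (leaves s') + mset (leaves t')" using can_mset[OF f] by simp
  \<comment> \<open>Restriction to the labels of \<open>s\<close> recovers the left half on both
    sides.\<close>
  have "filter ?P (leaves s @ leaves t) = leaves s"
    using d by (force simp: filter_id_conv filter_empty_conv)
  moreover have "filter ?P (leaves s' @ leaves t') = leaves s'"
    using d' e by (force simp: filter_id_conv filter_empty_conv)
  moreover have "mset (filter ?P (leaves s @ leaves t)) = mset (filter ?P (leaves s' @ leaves t'))"
    using m unfolding mset_filter by simp
  ultimately have s: "mset (leaves s) = mset (leaves s')" by simp
  then have t: "mset (leaves t) = mset (leaves t')" using m by simp
  have v: "valid (leaves s)" "valid (leaves t)" using can_valid[OF f] by auto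
  obtain g where g: "can s s' g" using can_exists[OF v(1) _ s] d by auto
  obtain h where h: "can t t' h" using can_exists[OF v(2) _ t] d by auto
  have "f = g \<otimes>\<^sub>m h" using coherence[OF f can_tens[OF g h] d] .
  then show ?thesis using g h by blast
qed

text \<open>The free variables of \<open>v\<close> fix the labels of both left subtrees, so the
  isomorphism between the nodes splits, and each half is absorbed by its induction
  hypothesis.\<close>

lemma den_unique_Node:
  assumes d: "den s v A m" "den t w D n" "linear (Node s t)"
    and e: "den s' v A' m'" "den t' w D' n'" "can (Node s t) (Node s' t') f"
    and IH: "\<And>A' m'. den s v A' m' \<Longrightarrow> A = A' \<and> m = m'" "\<And>D' n'. den t w D' n' \<Longrightarrow> D = D' \<and> n = n'"
  shows "A = A' \<and> D = D' \<and> m \<otimes>\<^sub>m n = (m' \<otimes>\<^sub>m n') \<cdot> f"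
proof -
  have "labels s = labels s'" using den_fv[OF d(1)] den_fv[OF e(1)] by simp
  from can_Node_split[OF e(3) d(3) this] obtain g h where g: "can s s' g" "can t t' h" "f = g \<otimes>\<^sub>m h" by blast
  have "A = A' \<and> m = m' \<cdot> g" "D = D' \<and> n = n' \<cdot> h" using IH den_can[OF e(1) g(1)] den_can[OF e(2) g(2)] by blast+
  then show ?thesis using g(3) den_arr[OF e(1)] den_arr[OF e(2)] can_arr[OF g(1)] can_arr[OF g(2)] by simp
qed

text \<open>Two derivations may distribute the leaves over different trees, but only up to a
  canonical isomorphism, which the inversion lemmas expose. The type is part of the claim because
  \<open>Pm\<close> does not record the types of its two variables.\<close>

theorem den_unique:
  assumes "den s v A m" "den s v A' m'"
  shows "A = A' \<and> m = m'"
  using assms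
proof (induction arbitrary: A' m' rule: den.induct)
  case (den_var A x)
  then have c: "can (Leaf x A) (Leaf x A') m'" using den_FV by blast
  then have e: "A = A'" using can_mset[OF c] by simp
  then show ?case using coherence[OF c] can_id[of "Leaf x A"] den_var.hyps by simp
next
  case (den_can s v A m t f)
  obtain g where g: "can s t g" using can_inverse[OF den_can.hyps(2)] by blast
  have IH: "A = A'" "m = m' \<cdot> g" using den_can.IH[OF den.den_can[OF den_can.prems g]] by auto
  \<comment> \<open>The round trip is canonical from a linear tree to itself, hence the
    identity.\<close>
  have "can t t (g \<cdot> f)" using can_comp[OF den_can.hyps(2) g] .
  then have "g \<cdot> f = Id C (treeI t)"
    using coherence can_id den_distinct[OF den_can.prems] den_valid[OF den_can.prems] by blast
  then show ?case using IH can_arr[OF den_can.hyps(2)] can_arr[OF g] den_arr[OF den_can.prems] by simp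
next
  case (den_op f A s v m)
  obtain A1 m1 where h: "lang_args C f = [A1]" "A' = lang_res C f" "den s v A1 m1" "m' = opI C f \<cdot> m1"
    using den_Op[OF den_op.prems] by blast
  then show ?case using den_op.IH[OF h(3)] by simp
next
  case den_star
  then have c: "A' = TUnit" "can Empty Empty m'" using den_Star by blast+
  then show ?case using coherence[OF c(2) can_id[of Empty]] by simp
next
  case (den_to s v m t w A n)
  obtain s1 s2 m1 m2 f where h: "can (Node s t) (Node s1 s2) f" "den s1 v TUnit m1" "den s2 w A' m2"
      "m' = LUnit C (tyI C A') \<cdot> (m1 \<otimes>\<^sub>m m2) \<cdot> f"
    using den_ToStar[OF den_to.prems] by blast
  then show ?case using den_unique_Node[OF den_to.hyps h(2,3,1) den_to.IH] by simp
next
  case (den_tensor s v A m t w B n)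
  obtain s1 s2 A1 A2 m1 m2 f where h: "can (Node s t) (Node s1 s2) f" "den s1 v A1 m1" "den s2 w A2 m2"
      "m' = (m1 \<otimes>\<^sub>m m2) \<cdot> f" "A' = TTens A1 A2"
    using den_Tensor[OF den_tensor.prems] by blast
  then show ?case using den_unique_Node[OF den_tensor.hyps h(2,3,1) den_tensor.IH] by simp
next
  case (den_app s v A B m t w n)
  obtain s1 s2 A1 m1 m2 f where h: "can (Node s t) (Node s1 s2) f" "den s1 v (TLolli A1 A') m1" "den s2 w A1 m2"
      "m' = Eval C (tyI C A1) (tyI C A') \<cdot> (m1 \<otimes>\<^sub>m m2) \<cdot> f"
    using den_App[OF den_app.prems] by blast
  then show ?case using den_unique_Node[OF den_app.hyps h(2,3,1) den_app.IH] by simp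
next
  case (den_lam F s A b B m)
  obtain B' F' n where h: "A' = TLolli A B'" "finite F'" "\<forall>x. x \<notin> F' \<longrightarrow> den (Node s (Leaf x A)) (opn 0 x b) B' n"
      "m' = Curry C (treeI s) (tyI C A) n"
    using den_Lam[OF den_lam.prems] by blast
  obtain x where "x \<notin> F \<union> F'" using ex_fresh[of "F \<union> F'"] h(2) den_lam.hyps by blast
  then have "B = B' \<and> m = n" using den_lam.IH[rule_format, of x] h(3) by blast
  then show ?case using h by simp
next
  case (den_pm s v A B m F t b D n)
  obtain s1 s2 A1 A2 m1 n' f F' where h: "can (Node s t) (Node s1 s2) f" "den s1 v (TTens A1 A2) m1" "finite F'"
    "\<forall>x y. x \<notin> F' \<longrightarrow> y \<notin> F' \<longrightarrow> x \<noteq> y \<longrightarrow>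
      den (Node (Node s2 (Leaf x A1)) (Leaf y A2)) (opn 0 y (opn 1 x b)) A' n'"
    and m: "m' = (pm_mor (treeI s2) (tyI C A1) (tyI C A2) m1 n') \<cdot> f"
    using den_Pm[OF den_pm.prems] by blast
  have "labels s = labels s1" using den_fv[OF h(2)] den_fv[OF den_pm.hyps(1)] by simp
  from can_Node_split[OF h(1) den_pm.hyps(3) this] obtain g k where g: "can s s1 g" "can t s2 k" "f = g \<otimes>\<^sub>m k" by blast
  have A: "A = A1" "B = A2" "m = m1 \<cdot> g" using den_pm.IH(1)[OF den_can[OF h(2) g(1)]] by auto
  have "finite (F \<union> F')" using h(3) den_pm.hyps(2) by blast
  \<comment> \<open>Names fresh for both derivations make the two bodies comparable.\<close>
  then obtain x y where xy: "x \<notin> F \<union> F'" "y \<notin> F \<union> F'" "x \<noteq> y" by (rule ex_fresh2)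
  then have d: "den (Node (Node s2 (Leaf x A)) (Leaf y B)) (opn 0 y (opn 1 x b)) A' n'" using h(4) A by blast
  let ?A = "tyI C A" and ?B = "tyI C B"
  have v: "is_type A" "is_type B" using den_valid[OF d] by auto
  have "can (Node (Node t (Leaf x A)) (Leaf y B)) (Node (Node s2 (Leaf x A)) (Leaf y B)) ((k \<rhd> ?A) \<rhd> ?B)"
    using can_tens[OF can_tens[OF g(2) can_id[of "Leaf x A"]] can_id[of "Leaf y B"]] v by simp
  from den_can[OF d this] have n: "D = A'" "n = n' \<cdot> ((k \<rhd> ?A) \<rhd> ?B)"
    using den_pm.IH(2)[rule_format, of x y] xy by auto
  note a = den_arr[OF d] den_arr[OF h(2)] can_arr[OF g(1)] can_arr[OF g(2)] v A can_valid[OF g(2)]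
  have "pm_mor (treeI t) ?A ?B (m1 \<cdot> g) (n' \<cdot> ((k \<rhd> ?A) \<rhd> ?B)) = pm_mor (treeI s2) ?A ?B m1 n' \<cdot> (g \<otimes>\<^sub>m k)"
    using a by (intro pm_mor_nat) simp_all
  then show ?case using n A m g(3) by simp
qed

end

section \<open>Denotations of typed terms\<close>

context autonomous_category
begin

text \<open>For the sake of this equation \<open>ctx_tree\<close> copies the bracketing of
  \<open>ctxI\<close>, with no unit in a nonempty context.\<close>

lemma treeI_ctx_tree [simp]: "treeI (ctx_tree \<Gamma>) = ctxI C \<Gamma>"
  by (induction \<Gamma> rule: ctx_tree.induct) auto

lemma valid_ctx_tree [simp]: "valid (leaves (ctx_tree \<Gamma>)) \<longleftrightarrow> valid \<Gamma>"
  by (simp add: valid_def)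

lemma ctxI_Ob [simp]: "valid \<Gamma> \<Longrightarrow> ctxI C \<Gamma> \<in> Ob C"
  using treeI_Ob[of "ctx_tree \<Gamma>"] by simp

text \<open>By coherence any canonical morphism backwards is the inverse, as both round trips are
  canonical.\<close>

lemma can_Inv: "can s t f \<Longrightarrow> linear s \<Longrightarrow> can t s (Inv C f)"
proof -
  assume f: "can s t f" and d: "linear s"
  have d': "linear t" using can_distinct[OF f] d by blast
  obtain g where g: "can t s g" using can_inverse[OF f] by blast
  note a = can_arr[OF f] can_arr[OF g] can_valid[OF f]
  have "g \<cdot> f = Id C (treeI s)" "f \<cdot> g = Id C (treeI t)"
    using coherence[OF can_comp[OF f g] can_id d] coherence[OF can_comp[OF g f] can_id d'] a by auto
  then have "Inv C f = g" using a by (intro Inv_eqI'[of _ "treeI s" "treeI t"]) (auto simp: hom_def)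
  then show ?thesis using g by simp
qed

lemma can_join1:
  assumes "valid \<Gamma>" "is_type A"
  shows "can (Node (ctx_tree \<Gamma>) (Leaf x A)) (ctx_tree ((x, A) # \<Gamma>)) (join1 C \<Gamma> A)"
proof (cases \<Gamma>)
  case Nil
  then show ?thesis using can_lunit[of "Leaf x A"] assms by (simp add: join1_def)
next
  case (Cons p \<Gamma>')
  then show ?thesis using can_id[of "Node (ctx_tree \<Gamma>) (Leaf x A)"] assms by (simp add: join1_def)
qed

text \<open>All that is used of \<open>split\<close> is that it is canonical; coherence makes its
  recursion irrelevant afterwards.\<close>

lemma can_split:
  "E \<in> shuffles \<Gamma> \<Delta> \<Longrightarrow> distinct_vars E \<Longrightarrow> valid E \<Longrightarrow>
    can (ctx_tree E) (Node (ctx_tree \<Gamma>) (ctx_tree \<Delta>)) (split C E \<Gamma> \<Delta>)"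
proof (induction E arbitrary: \<Gamma> \<Delta>)
  case Nil
  then have "\<Gamma> = []" "\<Delta> = []" by auto
  then show ?case using can_lunit'[of Empty] by simp
next
  case (Cons p E)
  obtain x A where p: "p = (x, A)" by (cases p)
  have A: "is_type A" and vE: "valid E" and dE: "distinct_vars E" and xE: "x \<notin> fst ` set E"
    using Cons.prems p by auto
  have ms: "mset (p # E) = mset \<Gamma> + mset \<Delta>" using mset_shuffles[OF Cons.prems(1)] .
  have "set (p # E) = set \<Gamma> \<union> set \<Delta>" using ms by (metis set_mset_mset set_mset_union)
  then have v: "valid \<Gamma>" "valid \<Delta>" using Cons.prems(3) unfolding valid_def by blast+
  then have vt: "valid (tl \<Gamma>)" "valid (tl \<Delta>)" by (cases \<Gamma>; cases \<Delta>; simp)+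
  have j: "can (ctx_tree (p # E)) (Node (ctx_tree E) (Leaf x A)) (Inv C (join1 C E A))"
    unfolding p by (rule can_Inv[OF can_join1[OF vE A]]) (use dE xE in auto)
  have X: "can (Leaf x A) (Leaf x A) (Id C (tyI C A))" using can_id[of "Leaf x A"] A by simp
  show ?case
  proof (cases "\<Gamma> \<noteq> [] \<and> hd \<Gamma> = (x, A)")
    case True
    then obtain \<Gamma>' where \<Gamma>: "\<Gamma> = (x, A) # \<Gamma>'" by (cases \<Gamma>) auto
    have mE: "mset E = mset \<Gamma>' + mset \<Delta>" using ms p \<Gamma> by simp
    \<comment> \<open>Distinctness excludes that the first entry of \<open>E\<close> was taken from
      \<open>\<Delta>\<close>.\<close>
    have "p \<notin> set \<Delta>"
    proof
      assume "p \<in> set \<Delta>"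
      then have "p \<in># mset E" unfolding mE by simp
      then show False using xE p by (auto simp: image_iff)
    qed
    then have E: "E \<in> shuffles \<Gamma>' \<Delta>" using Cons.prems(1) \<Gamma> p by (cases \<Delta>) (auto simp: Cons_in_shuffles_iff)
    note IH = Cons.IH[OF E dE vE]
    note G = can_id[of "ctx_tree \<Gamma>'"] and D = can_id[of "ctx_tree \<Delta>"]
    have "can (ctx_tree (p # E)) (Node (ctx_tree ((x, A) # \<Gamma>')) (ctx_tree \<Delta>))
      ((join1 C \<Gamma>' A \<rhd> (treeI (ctx_tree \<Delta>))) \<cdot> assoc' (treeI (ctx_tree \<Gamma>')) (treeI (Leaf x A)) (treeI (ctx_tree \<Delta>)) \<cdot>
        ((treeI (ctx_tree \<Gamma>')) \<lhd> Sym C (treeI (ctx_tree \<Delta>)) (treeI (Leaf x A))) \<cdot>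
        Assoc C (treeI (ctx_tree \<Gamma>')) (treeI (ctx_tree \<Delta>)) (treeI (Leaf x A)) \<cdot>
        (split C E \<Gamma>' \<Delta> \<rhd> (tyI C A)) \<cdot> Inv C (join1 C E A))"
      by (rule can_comp[OF can_comp[OF can_comp[OF can_comp[OF can_comp[OF j can_tens[OF IH X]] can_assoc]
            can_tens[OF G can_sym]] can_assoc'] can_tens[OF can_join1 D]])
        (use v vt A \<Gamma> in auto)
    then show ?thesis using True \<Gamma> p by (simp add: Let_def)
  next
    case False
    then obtain \<Delta>' where \<Delta>: "\<Delta> = (x, A) # \<Delta>'" and E: "E \<in> shuffles \<Gamma> \<Delta>'"
      using Cons.prems(1) p by (cases \<Delta>) (auto simp: Cons_in_shuffles_iff)
    note IH = Cons.IH[OF E dE vE]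
    note G = can_id[of "ctx_tree \<Gamma>"]
    have "can (ctx_tree (p # E)) (Node (ctx_tree \<Gamma>) (ctx_tree ((x, A) # \<Delta>')))
      (((treeI (ctx_tree \<Gamma>)) \<lhd> join1 C \<Delta>' A) \<cdot>
        Assoc C (treeI (ctx_tree \<Gamma>)) (treeI (ctx_tree \<Delta>')) (treeI (Leaf x A)) \<cdot>
        (split C E \<Gamma> \<Delta>' \<rhd> (tyI C A)) \<cdot> Inv C (join1 C E A))"
      by (rule can_comp[OF can_comp[OF can_comp[OF j can_tens[OF IH X]] can_assoc] can_tens[OF G can_join1]])
        (use v vt A \<Delta> in auto)
    then show ?thesis using False \<Delta> p by (auto simp: Let_def)
  qed
qed

lemma valid_shuffle: "E \<in> shuffles \<Gamma> \<Delta> \<Longrightarrow> valid \<Gamma> \<Longrightarrow> valid \<Delta> \<Longrightarrow> valid E"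
  using mset_shuffles[of E \<Gamma> \<Delta>] by (metis set_append set_mset_mset set_mset_union valid_def valid_simps(3))

lemma distinct_Node_ctx_tree:
  "mset E = mset (leaves s) + mset (leaves t) \<Longrightarrow> distinct_vars E \<longleftrightarrow> linear (Node s t)"
  by (rule mset_eq_imp_distinct_iff) simp

lemma can_split_den:
  assumes "E \<in> shuffles \<Gamma> \<Delta>" "distinct_vars E" "den (ctx_tree \<Gamma>) v A m" "valid \<Delta>"
  shows "can (ctx_tree E) (Node (ctx_tree \<Gamma>) (ctx_tree \<Delta>)) (split C E \<Gamma> \<Delta>)"
    "linear (Node (ctx_tree \<Gamma>) (ctx_tree \<Delta>))"
proof -
  show s: "can (ctx_tree E) (Node (ctx_tree \<Gamma>) (ctx_tree \<Delta>)) (split C E \<Gamma> \<Delta>)"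
    using can_split[OF assms(1,2)] valid_shuffle[OF assms(1)] den_valid[OF assms(3)] assms(4) by simp
  show "linear (Node (ctx_tree \<Gamma>) (ctx_tree \<Delta>))" using can_distinct[OF s] assms(2) by simp
qed

text \<open>A clause of \<open>interp\<close> that splits or extends a context is a rule of
  \<open>den\<close> combined with \<open>den_can\<close> for \<open>split\<close> or
  \<open>join1\<close>.\<close>

lemma interp_den: "interp C \<Gamma> v A m \<Longrightarrow> den (ctx_tree \<Gamma>) v A m"
proof (induction rule: interp.induct)
  case (in_op f A \<Gamma> v m)
  then show ?case by (intro den_op)
next
  case (in_hyp A x)
  then show ?case using den_var by simp
next
  case in_star
  then show ?case using den_star by simp
next
  case (in_to \<Gamma> v m \<Delta> w A n E)
  note d = in_to.IH
  have "valid \<Delta>" using den_valid[OF d(2)] by simp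
  note s = can_split_den[OF in_to.hyps(3,4) d(1) this]
  from den_can[OF den_to[OF d s(2)] s(1)] show ?case
    using den_arr[OF d(1)] den_arr[OF d(2)] den_valid[OF d(2)] can_arr[OF s(1)] by simp
next
  case (in_tensor \<Gamma> v A m \<Delta> w B n E)
  note d = in_tensor.IH
  have "valid \<Delta>" using den_valid[OF d(2)] by simp
  note s = can_split_den[OF in_tensor.hyps(3,4) d(1) this]
  from den_can[OF den_tensor[OF d s(2)] s(1)] show ?case .
next
  case (in_pm \<Gamma> v A B m y x \<Delta> w D n E)
  note d = in_pm.IH
  have v: "valid \<Delta>" "is_type A" "is_type B" "valid \<Gamma>"
    using den_valid[OF d(2)] den_valid[OF d(1)] by simp_all
  note s = can_split_den[OF in_pm.hyps(3,4) d(1) v(1)]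
  have j: "can (Node (Node (ctx_tree \<Delta>) (Leaf x A)) (Leaf y B)) (ctx_tree ((y, B) # (x, A) # \<Delta>)) (join1 C \<Delta> A \<rhd> (tyI C B))"
    using can_tens[OF can_join1[OF v(1,2), of x] can_id[of "Leaf y B"]] v by simp
  from den_can[OF den_pm_intro[OF d(1) den_can[OF d(2) j] s(2)] s(1)] show ?case
    using den_arr[OF d(1)] den_arr[OF d(2)] v can_arr[OF s(1)] can_arr[OF can_join1[OF v(1,2), of x]] by simp
next
  case (in_lam x A \<Gamma> v B m)
  note d = in_lam.IH
  have v: "valid \<Gamma>" "is_type A"
    using den_valid[OF d] by simp_all
  from den_lam_intro[OF den_can[OF d can_join1[OF v]]] show ?case by simp
next
  case (in_app \<Gamma> v A B m \<Delta> w n E)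
  note d = in_app.IH
  have "valid \<Delta>" using den_valid[OF d(2)] by simp
  note s = can_split_den[OF in_app.hyps(3,4) d(1) this]
  from den_can[OF den_app[OF d s(2)] s(1)] show ?case
    using den_arr[OF d(1)] den_arr[OF d(2)] den_valid[OF d(1)] can_arr[OF s(1)] by simp
qed

lemma Lang_sel [simp]:
  "Ops (Lang B C) = Ops (lang_signature C)" "Args (Lang B C) = lang_args C" "Res (Lang B C) = lang_res C"
  "Args (lang_signature C) = lang_args C" "Res (lang_signature C) = lang_res C"
  "types (Lang B C) = {A. is_type A}" "types (lang_signature C) = {A. is_type A}"
  by (auto simp: Lang_def lang_signature_def types_def)

lemma lang_args_single: "\<exists>A. lang_args C f = [A]"
  by (cases f) auto

lemma typed_interp: "typed (Lang B C) \<Gamma> v A \<Longrightarrow> \<exists>m. interp C \<Gamma> v A m"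
proof (induction rule: typed.induct)
  case (ty_op f vs \<Gamma>s E)
  obtain A where A: "lang_args C f = [A]" using lang_args_single by blast
  then obtain v \<Gamma> where "vs = [v]" "\<Gamma>s = [\<Gamma>]" using ty_op.hyps(2,3) by (auto simp: length_Suc_conv)
  moreover then obtain m where "interp C \<Gamma> v A m" using ty_op.IH A by auto
  ultimately show ?case using in_op[of f C A E v m] ty_op.hyps A by auto
next
  case (ty_hyp A x)
  then show ?case using in_hyp[of A C x] by auto
next
  case (ty_to \<Gamma> v \<Delta> w A E)
  then show ?case using in_to[of C \<Gamma> v _ \<Delta> w A _ E] by (auto simp del: interp.simps)
next
  case (ty_tensor \<Gamma> v A \<Delta> w D E)
  then show ?case using in_tensor[of C \<Gamma> v A _ \<Delta> w D _ E] by auto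
next
  case (ty_pm \<Gamma> v A D y x \<Delta> w D' E)
  then show ?case using in_pm[of C \<Gamma> v A D _ y x \<Delta> w D' _ E] by auto
next
  case (ty_app \<Gamma> v A D \<Delta> w E)
  then show ?case using in_app[of C \<Gamma> v A D _ \<Delta> w _ E] by auto
qed (blast intro: interp.intros)+

lemma typed_den: "typed (Lang B C) \<Gamma> v A \<Longrightarrow> \<exists>m. den (ctx_tree \<Gamma>) v A m"
  using typed_interp interp_den by blast

lemma typed_den_tree:
  assumes "typed (Lang B C) \<Gamma> v A" "mset (leaves t) = mset \<Gamma>"
  shows "\<exists>m. den t v A m"
  using typed_den[OF assms(1)] assms(2) den_iso[of "ctx_tree \<Gamma>" v A _ t] by fastforce

text \<open>Keeping the last variables as separate leaves avoids the case distinction that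
  \<open>join1\<close> makes for an empty rest.\<close>

lemma typed_den_last:
  "typed (Lang B C) ((x, A) # \<Gamma>) v D \<Longrightarrow> \<exists>m. den (Node (ctx_tree \<Gamma>) (Leaf x A)) v D m"
  "typed (Lang B C) ((y, A') # (x, A) # \<Gamma>) v D \<Longrightarrow>
    \<exists>m. den (Node (Node (ctx_tree \<Gamma>) (Leaf x A)) (Leaf y A')) v D m"
  by (erule typed_den_tree, simp add: add_mset_commute)+

lemma shuffle_Node:
  assumes "mset \<Gamma> = mset (leaves (Node s t))" "linear (Node s t)"
  obtains \<Gamma>1 \<Gamma>2 where "mset \<Gamma>1 = mset (leaves s)" "mset \<Gamma>2 = mset (leaves t)" "\<Gamma> \<in> Sf [\<Gamma>1, \<Gamma>2]" "distinct_vars \<Gamma>"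
  using shuffle_exists[of \<Gamma> "leaves s" "leaves t"] distinct_Node_ctx_tree[of \<Gamma> s t] assms by auto

text \<open>This replaces a substitution lemma for typing: a composite in \<open>Syn\<close> is
  typable because it has a denotation.\<close>

lemma den_typed:
  "den s v A m \<Longrightarrow> mset \<Gamma> = mset (leaves s) \<Longrightarrow> typed (lang_signature C) \<Gamma> v A"
proof (induction arbitrary: \<Gamma> rule: den.induct)
  case (den_var A x)
  then show ?case by (auto intro: ty_hyp)
next
  case (den_can s v A m t f)
  then show ?case using can_mset by metis
next
  case (den_op f A s v m)
  have "distinct_vars \<Gamma>"
    using den_distinct[OF den_op.hyps(3)] mset_eq_imp_distinct_iff[of "map fst \<Gamma>" "map fst (leaves s)"] den_op.prems by simp
  then have "typed (lang_signature C) \<Gamma> (Op f [v]) (Res (lang_signature C) f)"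
    using den_op by (intro ty_op[where \<Gamma>s = "[\<Gamma>]"]) auto
  then show ?case by simp
next
  case den_star
  then show ?case using ty_star by simp
next
  case (den_to s v m t w A n)
  obtain \<Gamma>1 \<Gamma>2 where G: "mset \<Gamma>1 = mset (leaves s)" "mset \<Gamma>2 = mset (leaves t)" "\<Gamma> \<in> Sf [\<Gamma>1, \<Gamma>2]" "distinct_vars \<Gamma>"
    using shuffle_Node[OF den_to.prems den_to.hyps(3)] .
  then show ?case using den_to.IH by (intro ty_to[of _ \<Gamma>1 _ \<Gamma>2]) auto
next
  case (den_tensor s v A m t w A' n)
  obtain \<Gamma>1 \<Gamma>2 where G: "mset \<Gamma>1 = mset (leaves s)" "mset \<Gamma>2 = mset (leaves t)" "\<Gamma> \<in> Sf [\<Gamma>1, \<Gamma>2]" "distinct_vars \<Gamma>"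
    using shuffle_Node[OF den_tensor.prems den_tensor.hyps(3)] .
  then show ?case using den_tensor.IH by (intro ty_tensor[of _ \<Gamma>1 _ _ \<Gamma>2]) auto
next
  case (den_app s v A A' m t w n)
  obtain \<Gamma>1 \<Gamma>2 where G: "mset \<Gamma>1 = mset (leaves s)" "mset \<Gamma>2 = mset (leaves t)" "\<Gamma> \<in> Sf [\<Gamma>1, \<Gamma>2]" "distinct_vars \<Gamma>"
    using shuffle_Node[OF den_app.prems den_app.hyps(3)] .
  then show ?case using den_app.IH by (intro ty_app[of _ \<Gamma>1 _ A _ \<Gamma>2]) auto
next
  case (den_lam F s A b A' m)
  have "finite (F \<union> fv b)" using den_lam.hyps by simp
  then obtain x where x: "x \<notin> F \<union> fv b" using ex_fresh by blast
  have "typed (lang_signature C) ((x, A) # \<Gamma>) (opn 0 x b) A'"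
    using den_lam.IH[rule_format, of x] x den_lam.prems by simp
  then have "typed (lang_signature C) \<Gamma> (lam x A (opn 0 x b)) (TLolli A A')" by (rule ty_lam)
  then show ?case using x by (simp add: lam_opn)
next
  case (den_pm s v A A' m F t b D n)
  obtain \<Gamma>1 \<Gamma>2 where G: "mset \<Gamma>1 = mset (leaves s)" "mset \<Gamma>2 = mset (leaves t)" "\<Gamma> \<in> Sf [\<Gamma>1, \<Gamma>2]" "distinct_vars \<Gamma>"
    using shuffle_Node[OF den_pm.prems den_pm.hyps(3)] .
  have "finite (F \<union> fv b)" using den_pm.hyps by simp
  then obtain x y where x: "x \<notin> F \<union> fv b" "y \<notin> F \<union> fv b" "x \<noteq> y" by (rule ex_fresh2)
  have "typed (lang_signature C) ((y, A') # (x, A) # \<Gamma>2) (opn 0 y (opn 1 x b)) D"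
    using den_pm.IH(2)[rule_format, of x y] x G by simp
  then have "typed (lang_signature C) \<Gamma> (pm v x y (opn 0 y (opn 1 x b))) D"
    using den_pm.IH(1) G by (intro ty_pm[of _ \<Gamma>1 _ A A' _ _ \<Gamma>2]) auto
  then show ?case using pm_opn[of x y b v] x by simp
qed

end

section \<open>Soundness\<close>

lemma quantale_mult_left:
  fixes a b x :: "'v::continuous_quantale"
  assumes "a \<le> b"
  shows "x * a \<le> x * b"
proof -
  have "x * b = sup (x * a) (x * b)"
    using mult_Sup[of x "{a, b}"] assms by (simp add: sup_absorb2)
  then show ?thesis by (metis sup.cobounded1)
qed

lemma quantale_mult:
  fixes a b x y :: "'v::continuous_quantale"
  assumes "a \<le> b" "x \<le> y"
  shows "a * x \<le> b * y"
  using quantale_mult_left[OF assms(1), of x] quantale_mult_left[OF assms(2), of b]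
  by (simp add: mult.commute)

lemma le_one_quantale: "(q::'v::continuous_quantale) \<le> 1"
  by (simp add: one_eq_top)

text \<open>The cover of \<open>q\<close> by the singleton of \<open>q\<close> already forces
  it.\<close>

lemma way_below_le: "(r::'v::continuous_quantale) \<lless> q \<Longrightarrow> r \<le> q"
proof -
  assume "r \<lless> q"
  then obtain A where "A \<subseteq> {q}" "r \<le> Sup A" unfolding way_below_def by (metis Sup_insert Sup_empty sup_bot_right order_refl)
  then show ?thesis by (metis Sup_subset_mono ccpo_Sup_singleton order_trans)
qed

context autonomous_category
begin

section \<open>Approximate equality of denotations\<close>

definition near :: "'v \<Rightarrow> 'o ctree \<Rightarrow> ('o, ('o, 'm) lang_op) tm \<Rightarrow> ('o, ('o, 'm) lang_op) tm \<Rightarrow> 'o ty \<Rightarrow> bool" where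
  "near q s v w A \<longleftrightarrow> (\<exists>m n. den s v A m \<and> den s w A n \<and> q \<le> Dist C m n)"

lemma den_hom: "den s v A m \<Longrightarrow> m \<in> hom C (treeI s) (tyI C A)"
  using den_arr by (auto simp: hom_def)

lemma Dist_Comp_left: "f \<in> hom C X Y \<Longrightarrow> f' \<in> hom C X Y \<Longrightarrow> g \<in> hom C Y Z \<Longrightarrow> Dist C f f' \<le> Dist C (g \<cdot> f) (g \<cdot> f')"
  using Dist_Comp[of f X Y f' g Z g] Dist_refl[of g] homD(1)[of g Y Z] quantale_mult[of 1 "Dist C g g" "Dist C f f'" "Dist C f f'"]
  by auto

lemma Dist_Comp_right: "f \<in> hom C X Y \<Longrightarrow> g \<in> hom C Y Z \<Longrightarrow> g' \<in> hom C Y Z \<Longrightarrow> Dist C g g' \<le> Dist C (g \<cdot> f) (g' \<cdot> f)"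
  using Dist_Comp[of f X Y f g Z g'] Dist_refl[of f] homD(1)[of f X Y] quantale_mult[of "Dist C g g'" "Dist C g g'" 1 "Dist C f f"]
  by auto

lemma near_tree:
  assumes "near q s v w A" "mset (leaves t) = mset (leaves s)"
  shows "near q t v w A"
proof -
  obtain m n where h: "den s v A m" "den s w A n" "q \<le> Dist C m n" using assms(1) by (auto simp: near_def)
  obtain f where f: "can t s f" using den_iso[OF h(1) assms(2)] by blast
  have "f \<in> hom C (treeI t) (treeI s)" using can_arr[OF f] by (simp add: hom_def)
  then have "Dist C m n \<le> Dist C (m \<cdot> f) (n \<cdot> f)" using Dist_Comp_right den_hom h by blast
  then show ?thesis using den_can[OF h(1) f] den_can[OF h(2) f] h(3) unfolding near_def by (meson order_trans)
qed

text \<open>The label is arbitrary because distances from a morphism to itself are at least 1, the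
  top element; so conversions may carry the label \<open>top\<close>.\<close>

lemma near_refl: "den s v A m \<Longrightarrow> den s w A m \<Longrightarrow> near q s v w A"
  using Dist_refl[of m] den_arr[of s v A m] le_one_quantale[of q] unfolding near_def by (meson order_trans)

section \<open>Validity of the conversions\<close>

definition same_den :: "'o ctree \<Rightarrow> ('o, ('o, 'm) lang_op) tm \<Rightarrow> ('o, ('o, 'm) lang_op) tm \<Rightarrow> 'o ty \<Rightarrow> bool" where
  "same_den s v w A \<longleftrightarrow> (\<exists>m. den s v A m \<and> den s w A m)"

lemma same_denI: "den s v A m \<Longrightarrow> den s w A n \<Longrightarrow> m = n \<Longrightarrow> same_den s v w A"
  unfolding same_den_def by blast

lemma same_den_tree: "same_den s v w A \<Longrightarrow> mset (leaves t) = mset (leaves s) \<Longrightarrow> same_den t v w A"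
  using den_iso den_can unfolding same_den_def by metis

text \<open>Naturality of the associator and of the symmetry slides \<open>m\<close> and
  \<open>n\<close> through the rearrangement of the three contexts.\<close>

lemma beta_tensor_den:
  assumes v: "den s v A m" and w: "den t w B n" and u: "den (Node (Node r (Leaf x A)) (Leaf y B)) u D k"
    and d: "linear (Node (Node s t) r)"
  shows "same_den (Node (Node s t) r) (pm (Tensor v w) x y u) (subst (FV(x := v, y := w)) u) D"
proof (rule same_denI)
  let ?S = "treeI s" and ?T = "treeI t" and ?R = "treeI r" and ?A = "tyI C A" and ?B = "tyI C B"
  note a = den_arr[OF v] den_arr[OF w] den_arr[OF u] den_valid[OF v] den_valid[OF w] den_valid[OF u]
  show "den (Node (Node s t) r) (pm (Tensor v w) x y u) D (pm_mor ?R ?A ?B (m \<otimes>\<^sub>m n) k)"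
    using d by (intro den_pm_intro[OF den_tensor[OF v w] u]) auto
  \<comment> \<open>Substitution leaves the context of the body first, the pattern match has it
    last.\<close>
  have "can (Node (Node s t) r) (Node (Node r s) t) (assoc' ?R ?S ?T \<cdot> Sym C (treeI (Node s t)) ?R)"
    using a by (intro can_comp[OF can_sym can_assoc']) auto
  then show "den (Node (Node s t) r) (subst (FV(x := v, y := w)) u) D
      ((k \<cdot> ((?R \<lhd> m) \<otimes>\<^sub>m n)) \<cdot> assoc' ?R ?S ?T \<cdot> Sym C (treeI (Node s t)) ?R)"
    using d by (intro den_can[OF den_subst_last2[OF u v w]]) auto
  have "(k \<cdot> ((?R \<lhd> m) \<otimes>\<^sub>m n)) \<cdot> assoc' ?R ?S ?T \<cdot> Sym C (?S \<otimes>\<^sub>o ?T) ?R =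
      k \<cdot> (((?R \<lhd> m) \<otimes>\<^sub>m n) \<cdot> assoc' ?R ?S ?T) \<cdot> Sym C (?S \<otimes>\<^sub>o ?T) ?R"
    using a by simp
  also have "\<dots> = k \<cdot> assoc' ?R ?A ?B \<cdot> ((?R \<lhd> (m \<otimes>\<^sub>m n)) \<cdot> Sym C (?S \<otimes>\<^sub>o ?T) ?R)"
    using reassoc[OF Inv_Assoc_nat_refl[of "Id C ?R" m n], of "Sym C (?S \<otimes>\<^sub>o ?T) ?R"] a by simp
  also have "\<dots> = pm_mor ?R ?A ?B (m \<otimes>\<^sub>m n) k"
    using Sym_nat_refl[of "m \<otimes>\<^sub>m n" "Id C ?R"] a by simp
  finally show "pm_mor ?R ?A ?B (m \<otimes>\<^sub>m n) k =
      (k \<cdot> ((?R \<lhd> m) \<otimes>\<^sub>m n)) \<cdot> assoc' ?R ?S ?T \<cdot> Sym C (treeI (Node s t)) ?R"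
    by simp
qed

text \<open>Substituting the pair of \<open>x\<close> and \<open>y\<close> needs a change of
  brackets, which cancels the \<open>assoc'\<close> in \<open>pm_mor\<close>; what remains is
  naturality of the symmetry in \<open>m\<close>.\<close>

lemma eta_tensor_den:
  assumes v: "den s v (TTens A B) m" and u: "den (Node t (Leaf z (TTens A B))) u D k"
    and d: "linear (Node s t)" and xy: "x \<noteq> y" "x \<notin> labels t" "y \<notin> labels t"
  shows "same_den (Node s t) (pm v x y (u[z ::= Tensor (FV x) (FV y)])) (u[z ::= v]) D"
proof (rule same_denI)
  let ?S = "treeI s" and ?T = "treeI t" and ?A = "tyI C A" and ?B = "tyI C B"
  note a = den_arr[OF v] den_arr[OF u] den_valid[OF v] den_valid[OF u]
  have A: "is_type A" "is_type B" using a by auto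
  have dt: "linear t" using d by simp
  have "den (Node (Leaf x A) (Leaf y B)) (Tensor (FV x) (FV y)) (TTens A B) (?A \<lhd> Id C ?B)"
    using xy by (intro den_tensor den_var A) auto
  from den_subst_last[OF u this]
  have "den (Node t (Node (Leaf x A) (Leaf y B))) (u[z ::= Tensor (FV x) (FV y)]) D k"
    using xy dt a by simp
  from den_can[OF this can_assoc[of t "Leaf x A" "Leaf y B"]]
  have "den (Node (Node t (Leaf x A)) (Leaf y B)) (u[z ::= Tensor (FV x) (FV y)]) D (k \<cdot> Assoc C ?T ?A ?B)"
    using a by simp
  from den_pm_intro[OF v this d]
  show "den (Node s t) (pm v x y (u[z ::= Tensor (FV x) (FV y)])) D
    (pm_mor ?T ?A ?B m (k \<cdot> Assoc C ?T ?A ?B))" .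
  have d': "linear (Node t s)" using d by auto
  from den_can[OF den_subst_last[OF u v d'] can_sym[of s t]]
  show "den (Node s t) (u[z ::= v]) D ((k \<cdot> (?T \<lhd> m)) \<cdot> Sym C ?S ?T)" using a by simp
  show "pm_mor ?T ?A ?B m (k \<cdot> Assoc C ?T ?A ?B) =
    (k \<cdot> (?T \<lhd> m)) \<cdot> Sym C ?S ?T"
    using a Sym_nat_refl[of m "Id C ?T"] by simp
qed

lemma beta_unit_den:
  assumes v: "den s v A m"
  shows "same_den s (ToStar Star v) v A"
proof -
  have "same_den (Node Empty s) (ToStar Star v) v A"
  proof (rule same_denI)
    show "den (Node Empty s) (ToStar Star v) A (LUnit C (tyI C A) \<cdot> ((Unit C) \<lhd> m))"
      using den_distinct[OF v] by (intro den_to[OF den_star v]) auto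
    show "den (Node Empty s) v A (m \<cdot> LUnit C (treeI s))"
      using den_valid[OF v] by (intro den_can[OF v can_lunit]) auto
    show "LUnit C (tyI C A) \<cdot> ((Unit C) \<lhd> m) = m \<cdot> LUnit C (treeI s)"
      using den_arr[OF v] by (simp add: LUnit_nat')
  qed
  then show ?thesis by (rule same_den_tree) simp
qed

text \<open>The right unit that comes from substituting \<open>Star\<close> and the left unit of
  \<open>ToStar\<close> combine into a symmetry, by \<open>RUnit_Sym\<close>.\<close>

lemma eta_unit_den:
  assumes v: "den s v TUnit m" and w: "den (Node t (Leaf z TUnit)) w A k"
    and d: "linear (Node s t)"
  shows "same_den (Node s t) (ToStar v (w[z ::= Star])) (w[z ::= v]) A"
proof (rule same_denI)
  let ?S = "treeI s" and ?T = "treeI t" and ?I = "Unit C"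
  note a = den_arr[OF v] den_arr[OF w] den_valid[OF v] den_valid[OF w]
  have "den (Node t Empty) (w[z ::= Star]) A k"
    using den_subst_last[OF w den_star] d a by simp
  from den_can[OF this can_runit'] have "den t (w[z ::= Star]) A (k \<cdot> Inv C (RUnit C ?T))" using a by simp
  from den_to[OF v this d]
  show "den (Node s t) (ToStar v (w[z ::= Star])) A (LUnit C (tyI C A) \<cdot> (m \<otimes>\<^sub>m (k \<cdot> Inv C (RUnit C ?T))))" .
  have d': "linear (Node t s)" using d by auto
  from den_can[OF den_subst_last[OF w v d'] can_sym[of s t]]
  show "den (Node s t) (w[z ::= v]) A ((k \<cdot> (?T \<lhd> m)) \<cdot> Sym C ?S ?T)" using a by simp
  have "LUnit C (tyI C A) \<cdot> (m \<otimes>\<^sub>m (k \<cdot> Inv C (RUnit C ?T))) =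
    (LUnit C (tyI C A) \<cdot> (?I \<lhd> (k \<cdot> Inv C (RUnit C ?T)))) \<cdot> (m \<rhd> ?T)"
    using a by simp
  also have "\<dots> = k \<cdot> Inv C (RUnit C ?T) \<cdot> LUnit C ?T \<cdot> (m \<rhd> ?T)"
    using a by (subst LUnit_nat') simp_all
  also have "\<dots> = k \<cdot> Sym C ?I ?T \<cdot> (m \<rhd> ?T)"
    using a by (subst RUnit_Sym[symmetric]) simp_all
  also have "\<dots> = (k \<cdot> (?T \<lhd> m)) \<cdot> Sym C ?S ?T"
    using a Sym_nat_refl[of m "Id C ?T"] by simp
  finally show "LUnit C (tyI C A) \<cdot> (m \<otimes>\<^sub>m (k \<cdot> Inv C (RUnit C ?T))) = (k \<cdot> (?T \<lhd> m)) \<cdot> Sym C ?S ?T" .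
qed

lemma beta_lam_den:
  assumes v: "den (Node s (Leaf x A)) v B m" and w: "den t w A n" and d: "linear (Node s t)"
  shows "same_den (Node s t) (App (lam x A v) w) (v[x ::= w]) B"
proof (rule same_denI)
  let ?S = "treeI s" and ?A = "tyI C A" and ?B = "tyI C B"
  note a = den_arr[OF v] den_arr[OF w] den_valid[OF v] den_valid[OF w]
  show "den (Node s t) (App (lam x A v) w) B (Eval C ?A ?B \<cdot> (Curry C ?S ?A m \<otimes>\<^sub>m n))"
    by (rule den_app[OF den_lam_intro[OF v] w d])
  show "den (Node s t) (v[x ::= w]) B (m \<cdot> (?S \<lhd> n))"
    by (rule den_subst_last[OF v w d])
  have "Eval C ?A ?B \<cdot> (Curry C ?S ?A m \<otimes>\<^sub>m n) = (Eval C ?A ?B \<cdot> (Curry C ?S ?A m \<rhd> ?A)) \<cdot> (?S \<lhd> n)"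
    using a by simp
  also have "\<dots> = m \<cdot> (?S \<lhd> n)"
    using a by (subst Eval_Curry) simp_all
  finally show "Eval C ?A ?B \<cdot> (Curry C ?S ?A m \<otimes>\<^sub>m n) = m \<cdot> (?S \<lhd> n)" .
qed

lemma eta_lam_den:
  assumes v: "den s v (TLolli A B) m" and x: "x \<notin> labels s"
  shows "same_den s (lam x A (App v (FV x))) v (TLolli A B)"
proof (rule same_denI)
  let ?A = "tyI C A" and ?B = "tyI C B"
  note a = den_arr[OF v] den_valid[OF v]
  have "den (Node s (Leaf x A)) (App v (FV x)) B (Eval C ?A ?B \<cdot> (m \<rhd> ?A))"
    using a x den_distinct[OF v] by (intro den_app[OF v den_var]) auto
  then show "den s (lam x A (App v (FV x))) (TLolli A B) (Curry C (treeI s) ?A (Eval C ?A ?B \<cdot> (m \<rhd> ?A)))"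
    by (rule den_lam_intro)
  show "den s v (TLolli A B) m" by (rule v)
  show "Curry C (treeI s) ?A (Eval C ?A ?B \<cdot> (m \<rhd> ?A)) = m"
    using a by (intro Curry_Eval) auto
qed

text \<open>Over \<open>Node s (Node r t)\<close> the two sides differ by moving \<open>s\<close>
  past \<open>r\<close>; once \<open>v\<close> has turned \<open>s\<close> into the unit,
  \<open>twist_Unit\<close> makes this trivial.\<close>

lemma cc_unit_den:
  assumes v: "den s v TUnit m" and w: "den t w A n" and u: "den (Node r (Leaf z A)) u B k"
    and d: "linear (Node s (Node r t))"
  shows "same_den (Node s (Node r t)) (u[z ::= ToStar v w]) (ToStar v (u[z ::= w])) B"
proof (rule same_denI)
  let ?S = "treeI s" and ?T = "treeI t" and ?R = "treeI r" and ?A = "tyI C A" and ?B = "tyI C B"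
  note a = den_arr[OF v] den_arr[OF w] den_arr[OF u] den_valid[OF v] den_valid[OF w] den_valid[OF u]
  have d1: "linear (Node s t)" "linear (Node r t)" "linear (Node r (Node s t))"
    using d by auto
  from den_can[OF den_subst_last[OF u den_to[OF v w d1(1)] d1(3)] can_twist[of s r t]]
  show "den (Node s (Node r t)) (u[z ::= ToStar v w]) B ((k \<cdot> (?R \<lhd> (LUnit C ?A \<cdot> (m \<otimes>\<^sub>m n)))) \<cdot> twist ?S ?R ?T)"
    using a by simp
  from den_to[OF v den_subst_last[OF u w d1(2)] d]
  show "den (Node s (Node r t)) (ToStar v (u[z ::= w])) B (LUnit C ?B \<cdot> (m \<otimes>\<^sub>m (k \<cdot> (?R \<lhd> n))))" .
  have "(k \<cdot> (?R \<lhd> (LUnit C ?A \<cdot> (m \<otimes>\<^sub>m n)))) \<cdot> twist ?S ?R ?T =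
    k \<cdot> (?R \<lhd> LUnit C ?A) \<cdot> ((?R \<lhd> (m \<otimes>\<^sub>m n)) \<cdot> twist ?S ?R ?T)"
    using a by simp
  also have "\<dots> = k \<cdot> ((?R \<lhd> LUnit C ?A) \<cdot> twist (Unit C) ?R ?A) \<cdot> (m \<otimes>\<^sub>m (?R \<lhd> n))"
    using twist_nat_refl[of m "Id C ?R" n, symmetric] a by simp
  also have "\<dots> = (k \<cdot> LUnit C (?R \<otimes>\<^sub>o ?A)) \<cdot> (m \<otimes>\<^sub>m (?R \<lhd> n))"
    using a by (subst twist_Unit) simp_all
  also have "\<dots> = (LUnit C ?B \<cdot> ((Unit C) \<lhd> k)) \<cdot> (m \<otimes>\<^sub>m (?R \<lhd> n))"
    using a by (subst LUnit_nat') simp_all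
  also have "\<dots> = LUnit C ?B \<cdot> (m \<otimes>\<^sub>m (k \<cdot> (?R \<lhd> n)))"
    using a by simp
  finally show "(k \<cdot> (?R \<lhd> (LUnit C ?A \<cdot> (m \<otimes>\<^sub>m n)))) \<cdot> twist ?S ?R ?T = LUnit C ?B \<cdot> (m \<otimes>\<^sub>m (k \<cdot> (?R \<lhd> n)))" .
qed

text \<open>An instance of coherence for four objects, which become leaves with the labels 0 to 3.\<close>

lemma cc_tensor_coherence:
  assumes [simp]: "R \<in> Ob C" "T \<in> Ob C" "X \<in> Ob C" "Y \<in> Ob C"
  shows "(R \<lhd> (assoc' T X Y \<cdot> Sym C (X \<otimes>\<^sub>o Y) T)) \<cdot> twist (X \<otimes>\<^sub>o Y) R T =
    (Assoc C R (T \<otimes>\<^sub>o X) Y \<cdot> (Assoc C R T X \<rhd> Y)) \<cdot> assoc' (R \<otimes>\<^sub>o T) X Y \<cdot> Sym C (X \<otimes>\<^sub>o Y) (R \<otimes>\<^sub>o T)"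
proof -
  let ?r = "Leaf 0 (Ground R)" and ?t = "Leaf 1 (Ground T)" and ?x = "Leaf 2 (Ground X)" and ?y = "Leaf 3 (Ground Y)"
  have "can (Node (Node ?x ?y) (Node ?r ?t)) (Node ?r (Node (Node ?t ?x) ?y))
    (((treeI ?r) \<lhd> (assoc' (treeI ?t) (treeI ?x) (treeI ?y) \<cdot> Sym C (treeI (Node ?x ?y)) (treeI ?t))) \<cdot>
      twist (treeI (Node ?x ?y)) (treeI ?r) (treeI ?t))"
    by (intro can_comp[OF can_twist] can_tens can_comp[OF can_sym can_assoc'] can_id) auto
  moreover have "can (Node (Node ?x ?y) (Node ?r ?t)) (Node ?r (Node (Node ?t ?x) ?y))
    ((Assoc C (treeI ?r) (treeI (Node ?t ?x)) (treeI ?y) \<cdot> (Assoc C (treeI ?r) (treeI ?t) (treeI ?x) \<rhd> (treeI ?y))) \<cdot>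
      assoc' (treeI (Node ?r ?t)) (treeI ?x) (treeI ?y) \<cdot> Sym C (treeI (Node ?x ?y)) (treeI (Node ?r ?t)))"
    by (intro can_comp[OF can_comp[OF can_sym can_assoc'] can_comp[OF can_tens[OF can_assoc can_id] can_assoc]]) auto
  ultimately show ?thesis
    using coherence by fastforce
qed

text \<open>After \<open>m\<close>, \<open>n\<close> and \<open>k\<close> are pulled out, the two
  sides differ in structure maps on four objects, and these agree by
  \<open>cc_tensor_coherence\<close>.\<close>

lemma cc_tensor_den:
  assumes v: "den s v (TTens A B) m" and w: "den (Node (Node t (Leaf x A)) (Leaf y B)) w D n"
    and u: "den (Node r (Leaf z D)) u D' k"
    and d: "linear (Node s (Node r t))"
    and xy: "x \<notin> labels r" "y \<notin> labels r"
  shows "same_den (Node s (Node r t)) (u[z ::= pm v x y w]) (pm v x y (u[z ::= w])) D'"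
proof (rule same_denI)
  let ?S = "treeI s" and ?T = "treeI t" and ?R = "treeI r" and ?A = "tyI C A" and ?B = "tyI C B"
  let ?c = "Assoc C ?R (?T \<otimes>\<^sub>o ?A) ?B \<cdot> (Assoc C ?R ?T ?A \<rhd> ?B)"
  note a = den_arr[OF v] den_arr[OF w] den_arr[OF u] den_valid[OF v] den_valid[OF w] den_valid[OF u]
  have A: "is_type A" "is_type B" using a by auto
  have d1: "linear (Node s t)" "linear (Node r (Node s t))"
    using d by auto
  have d2: "distinct_vars (leaves (Node r (Node (Node t (Leaf x A)) (Leaf y B))))"
    using d den_distinct[OF w] xy by auto
  from den_can[OF den_subst_last[OF u den_pm_intro[OF v w d1(1)] d1(2)] can_twist[of s r t]]
  show "den (Node s (Node r t)) (u[z ::= pm v x y w]) D' ((k \<cdot> (?R \<lhd> (n \<cdot> assoc' ?T ?A ?B \<cdot> Sym C (?A \<otimes>\<^sub>o ?B) ?T \<cdot>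
      (m \<rhd> ?T)))) \<cdot> twist ?S ?R ?T)"
    using a by simp
  have "can (Node (Node (Node r t) (Leaf x A)) (Leaf y B)) (Node r (Node (Node t (Leaf x A)) (Leaf y B)))
    (Assoc C ?R (treeI (Node t (Leaf x A))) (treeI (Leaf y B)) \<cdot> (Assoc C ?R ?T (treeI (Leaf x A)) \<rhd> (treeI (Leaf y B))))"
    using a by (intro can_comp[OF can_tens[OF can_assoc can_id] can_assoc]) auto
  from den_pm_intro[OF v den_can[OF den_subst_last[OF u w d2] this] d]
  show "den (Node s (Node r t)) (pm v x y (u[z ::= w])) D' (((k \<cdot> (?R \<lhd> n)) \<cdot> ?c) \<cdot> assoc' (?R \<otimes>\<^sub>o ?T) ?A ?B \<cdot>
     Sym C (?A \<otimes>\<^sub>o ?B) (?R \<otimes>\<^sub>o ?T) \<cdot> (m \<rhd> (?R \<otimes>\<^sub>o ?T)))"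
    by simp
  have "(k \<cdot> (?R \<lhd> (pm_mor ?T ?A ?B m n))) \<cdot> twist ?S ?R ?T =
    k \<cdot> (?R \<lhd> n) \<cdot> (?R \<lhd> (assoc' ?T ?A ?B \<cdot> Sym C (?A \<otimes>\<^sub>o ?B) ?T)) \<cdot> ((?R \<lhd> (m \<rhd> ?T)) \<cdot> twist ?S ?R ?T)"
    using a by simp
  also have "\<dots> = k \<cdot> (?R \<lhd> n) \<cdot> ((?R \<lhd> (assoc' ?T ?A ?B \<cdot> Sym C (?A \<otimes>\<^sub>o ?B) ?T)) \<cdot> twist (?A \<otimes>\<^sub>o ?B) ?R ?T) \<cdot>
      (m \<rhd> (?R \<otimes>\<^sub>o ?T))"
    using twist_nat_refl[of m "Id C ?R" "Id C ?T", symmetric] a by simp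
  also have "\<dots> = ((k \<cdot> (?R \<lhd> n)) \<cdot> ?c) \<cdot> assoc' (?R \<otimes>\<^sub>o ?T) ?A ?B \<cdot>
     Sym C (?A \<otimes>\<^sub>o ?B) (?R \<otimes>\<^sub>o ?T) \<cdot> (m \<rhd> (?R \<otimes>\<^sub>o ?T))"
    using a by (subst cc_tensor_coherence) simp_all
  finally show "(k \<cdot> (?R \<lhd> (pm_mor ?T ?A ?B m n))) \<cdot> twist ?S ?R ?T =
    ((k \<cdot> (?R \<lhd> n)) \<cdot> ?c) \<cdot> assoc' (?R \<otimes>\<^sub>o ?T) ?A ?B \<cdot>
     Sym C (?A \<otimes>\<^sub>o ?B) (?R \<otimes>\<^sub>o ?T) \<cdot> (m \<rhd> (?R \<otimes>\<^sub>o ?T))" .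
qed

lemma same_den_ctx: "same_den t v w A \<Longrightarrow> mset (leaves t) = mset E \<Longrightarrow> same_den (ctx_tree E) v w A"
  by (erule same_den_tree) (simp only: mset_ctx_tree)

lemma near_ctx: "near q t v w A \<Longrightarrow> mset (leaves t) = mset E \<Longrightarrow> near q (ctx_tree E) v w A"
  by (erule near_tree) (simp only: mset_ctx_tree)

lemma distinct_leaves: "mset (leaves t) = mset E \<Longrightarrow> distinct_vars E \<Longrightarrow> linear t"
  using mset_eq_imp_distinct_iff[of "map fst (leaves t)" "map fst E"] by simp

text \<open>Each conversion has been verified over the tree that suits it; a change of tree leads to
  the context.\<close>

lemma conv_den: "conv (Lang B C) E v w A \<Longrightarrow> same_den (ctx_tree E) v w A"
proof (induction rule: conv.induct)
  case (beta_tensor \<Gamma> v A \<Delta> w D y x \<Theta> u D' E)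
  let ?t = "Node (Node (ctx_tree \<Gamma>) (ctx_tree \<Delta>)) (ctx_tree \<Theta>)"
  have m: "mset (leaves ?t) = mset E" using mset_Sf[OF beta_tensor.hyps(4)] by simp
  obtain a where a: "den (ctx_tree \<Gamma>) v A a" using typed_den[OF beta_tensor.hyps(1)] by blast
  obtain b where b: "den (ctx_tree \<Delta>) w D b" using typed_den[OF beta_tensor.hyps(2)] by blast
  obtain c where c: "den (Node (Node (ctx_tree \<Theta>) (Leaf x A)) (Leaf y D)) u D' c"
    using typed_den_last(2)[OF beta_tensor.hyps(3)] by blast
  show ?case by (rule same_den_ctx[OF beta_tensor_den[OF a b c distinct_leaves[OF m beta_tensor.hyps(5)]] m])
next
  case (eta_tensor \<Gamma> v A D z \<Delta> u D' y x E)
  let ?t = "Node (ctx_tree \<Gamma>) (ctx_tree \<Delta>)"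
  have m: "mset (leaves ?t) = mset E" using mset_Sf[OF eta_tensor.hyps(4)] by simp
  obtain a where a: "den (ctx_tree \<Gamma>) v (TTens A D) a" using typed_den[OF eta_tensor.hyps(1)] by blast
  obtain b where b: "den (Node (ctx_tree \<Delta>) (Leaf z (TTens A D))) u D' b"
    using typed_den_last(1)[OF eta_tensor.hyps(2)] by blast
  have "same_den ?t (pm v x y (u[z ::= Tensor (FV x) (FV y)])) (u[z ::= v]) D'"
    using eta_tensor.hyps(3) by (intro eta_tensor_den[OF a b distinct_leaves[OF m eta_tensor.hyps(5)]]) auto
  then show ?case by (rule same_den_ctx[OF _ m])
next
  case (beta_unit \<Gamma> v A)
  then show ?case using typed_den beta_unit_den by blast
next
  case (eta_unit \<Gamma> v z \<Delta> w A E)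
  let ?t = "Node (ctx_tree \<Gamma>) (ctx_tree \<Delta>)"
  have m: "mset (leaves ?t) = mset E" using mset_Sf[OF eta_unit.hyps(3)] by simp
  obtain a where a: "den (ctx_tree \<Gamma>) v TUnit a" using typed_den[OF eta_unit.hyps(1)] by blast
  obtain b where b: "den (Node (ctx_tree \<Delta>) (Leaf z TUnit)) w A b"
    using typed_den_last(1)[OF eta_unit.hyps(2)] by blast
  show ?case by (rule same_den_ctx[OF eta_unit_den[OF a b distinct_leaves[OF m eta_unit.hyps(4)]] m])
next
  case (beta_lam x A \<Gamma> v D \<Delta> w E)
  let ?t = "Node (ctx_tree \<Gamma>) (ctx_tree \<Delta>)"
  have m: "mset (leaves ?t) = mset E" using mset_Sf[OF beta_lam.hyps(3)] by simp
  obtain a where a: "den (Node (ctx_tree \<Gamma>) (Leaf x A)) v D a"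
    using typed_den_last(1)[OF beta_lam.hyps(1)] by blast
  obtain b where b: "den (ctx_tree \<Delta>) w A b" using typed_den[OF beta_lam.hyps(2)] by blast
  show ?case by (rule same_den_ctx[OF beta_lam_den[OF a b distinct_leaves[OF m beta_lam.hyps(4)]] m])
next
  case (eta_lam \<Gamma> v A D x)
  obtain a where a: "den (ctx_tree \<Gamma>) v (TLolli A D) a" using typed_den[OF eta_lam.hyps(1)] by blast
  show ?case using eta_lam.hyps(2) by (intro eta_lam_den[OF a]) auto
next
  case (cc_unit \<Gamma> v \<Delta> w A z \<Theta> u D E)
  let ?t = "Node (ctx_tree \<Gamma>) (Node (ctx_tree \<Theta>) (ctx_tree \<Delta>))"
  have m: "mset (leaves ?t) = mset E" using mset_Sf[OF cc_unit.hyps(4)] by simp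
  obtain a where a: "den (ctx_tree \<Gamma>) v TUnit a" using typed_den[OF cc_unit.hyps(1)] by blast
  obtain b where b: "den (ctx_tree \<Delta>) w A b" using typed_den[OF cc_unit.hyps(2)] by blast
  obtain c where c: "den (Node (ctx_tree \<Theta>) (Leaf z A)) u D c"
    using typed_den_last(1)[OF cc_unit.hyps(3)] by blast
  show ?case by (rule same_den_ctx[OF cc_unit_den[OF a b c distinct_leaves[OF m cc_unit.hyps(5)]] m])
next
  case (cc_tensor \<Gamma> v A D y x \<Delta> w D' z \<Theta> u D'' E)
  let ?t = "Node (ctx_tree \<Gamma>) (Node (ctx_tree \<Theta>) (ctx_tree \<Delta>))"
  have m: "mset (leaves ?t) = mset E" using mset_Sf[OF cc_tensor.hyps(5)] by simp
  obtain a where a: "den (ctx_tree \<Gamma>) v (TTens A D) a" using typed_den[OF cc_tensor.hyps(1)] by blast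
  obtain b where b: "den (Node (Node (ctx_tree \<Delta>) (Leaf x A)) (Leaf y D)) w D' b"
    using typed_den_last(2)[OF cc_tensor.hyps(2)] by blast
  obtain c where c: "den (Node (ctx_tree \<Theta>) (Leaf z D')) u D'' c"
    using typed_den_last(1)[OF cc_tensor.hyps(3)] by blast
  have "same_den ?t (u[z ::= pm v x y w]) (pm v x y (u[z ::= w])) D''"
    using cc_tensor.hyps(4) by (intro cc_tensor_den[OF a b c distinct_leaves[OF m cc_tensor.hyps(6)]]) auto
  then show ?case by (rule same_den_ctx[OF _ m])
qed

section \<open>Distances under the derivation rules\<close>

lemma near_trans:
  assumes "near q s v w A" "near r s w u A"
  shows "near (q * r) s v u A"
proof -
  obtain a b where 1: "den s v A a" "den s w A b" "q \<le> Dist C a b" using assms(1) by (auto simp: near_def)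
  obtain b' c where 2: "den s w A b'" "den s u A c" "r \<le> Dist C b' c" using assms(2) by (auto simp: near_def)
  \<comment> \<open>Uniqueness makes the two denotations of the middle term agree.\<close>
  have "b' = b" using den_unique 1(2) 2(1) by blast
  then have "q * r \<le> Dist C a b * Dist C b c" using 1(3) 2(3) quantale_mult by blast
  also have "\<dots> \<le> Dist C a c" using Dist_triangle[OF den_hom[OF 1(1)] den_hom[OF 1(2)] den_hom[OF 2(2)]] .
  finally show ?thesis using 1 2 unfolding near_def by blast
qed

text \<open>The common part of \<open>ToStar\<close>, \<open>Tensor\<close> and \<open>App\<close>,
  which differ only in the morphism \<open>g\<close> applied after the tensor.\<close>

lemma near_binary:
  assumes "near q s v w A" "near r t v' w' A'" and g: "g \<in> hom C (tyI C A \<otimes>\<^sub>o tyI C A') (tyI C D)"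
    and K: "\<And>v v' m n. den s v A m \<Longrightarrow> den t v' A' n \<Longrightarrow> den (Node s t) (K v v') D (g \<cdot> (m \<otimes>\<^sub>m n))"
  shows "near (q * r) (Node s t) (K v v') (K w w') D"
proof -
  obtain a b where 1: "den s v A a" "den s w A b" "q \<le> Dist C a b" using assms(1) by (auto simp: near_def)
  obtain a' b' where 2: "den t v' A' a'" "den t w' A' b'" "r \<le> Dist C a' b'" using assms(2) by (auto simp: near_def)
  note h = den_hom[OF 1(1)] den_hom[OF 1(2)] den_hom[OF 2(1)] den_hom[OF 2(2)]
  have "q * r \<le> Dist C a b * Dist C a' b'" using 1(3) 2(3) quantale_mult by blast
  also have "\<dots> \<le> Dist C (a \<otimes>\<^sub>m a') (b \<otimes>\<^sub>m b')" using Dist_TensM[OF h] .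
  also have "\<dots> \<le> Dist C (g \<cdot> (a \<otimes>\<^sub>m a')) (g \<cdot> (b \<otimes>\<^sub>m b'))"
    using Dist_Comp_left[OF TensM_hom[OF h(1,3)] TensM_hom[OF h(2,4)] g] .
  finally show ?thesis using K 1 2 unfolding near_def by blast
qed

lemma near_ToStar:
  assumes "near q s v w TUnit" "near r t v' w' A" "linear (Node s t)"
  shows "near (q * r) (Node s t) (ToStar v v') (ToStar w w') A"
proof (rule near_binary[OF assms(1,2)])
  show "LUnit C (tyI C A) \<in> hom C (tyI C TUnit \<otimes>\<^sub>o tyI C A) (tyI C A)"
    using assms(2) den_valid unfolding near_def by (auto simp: hom_def)
qed (rule den_to[OF _ _ assms(3)])

lemma near_Tensor:
  assumes "near q s v w A" "near r t v' w' A'" "linear (Node s t)"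
  shows "near (q * r) (Node s t) (Tensor v v') (Tensor w w') (TTens A A')"
proof (rule near_binary[OF assms(1,2)])
  show "Id C (tyI C (TTens A A')) \<in> hom C (tyI C A \<otimes>\<^sub>o tyI C A') (tyI C (TTens A A'))"
    using assms(1,2) den_valid unfolding near_def by (auto simp: hom_def)
  fix v v' m n assume d: "den s v A m" "den t v' A' n"
  show "den (Node s t) (Tensor v v') (TTens A A') (Id C (tyI C (TTens A A')) \<cdot> (m \<otimes>\<^sub>m n))"
    using den_tensor[OF d assms(3)] den_arr[OF d(1)] den_arr[OF d(2)] by simp
qed

lemma near_App:
  assumes "near q s v w (TLolli A A')" "near r t v' w' A" "linear (Node s t)"
  shows "near (q * r) (Node s t) (App v v') (App w w') A'"
proof (rule near_binary[OF assms(1,2)])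
  show "Eval C (tyI C A) (tyI C A') \<in> hom C (tyI C (TLolli A A') \<otimes>\<^sub>o tyI C A) (tyI C A')"
    using assms(1) den_valid unfolding near_def by (fastforce simp: hom_def)
qed (rule den_app[OF _ _ assms(3)])

lemma near_lam:
  assumes "near q (Node s (Leaf x A)) v w A'"
  shows "near q s (lam x A v) (lam x A w) (TLolli A A')"
proof -
  obtain a b where h: "den (Node s (Leaf x A)) v A' a" "den (Node s (Leaf x A)) w A' b" "q \<le> Dist C a b"
    using assms(1) by (auto simp: near_def)
  have "Dist C a b \<le> Dist C (Curry C (treeI s) (tyI C A) a) (Curry C (treeI s) (tyI C A) b)"
    using den_hom[OF h(1)] den_hom[OF h(2)] den_valid[OF h(1)] by (intro Dist_Curry[where Z = "tyI C A'"]) simp_all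
  then show ?thesis using den_lam_intro[OF h(1)] den_lam_intro[OF h(2)] h(3) order_trans unfolding near_def by blast
qed

lemma near_pm:
  assumes "near q s v w (TTens A A')" "near r (Node (Node t (Leaf x A)) (Leaf y A')) v' w' D"
    and d: "linear (Node s t)"
  shows "near (q * r) (Node s t) (pm v x y v') (pm w x y w') D"
proof -
  obtain a b where 1: "den s v (TTens A A') a" "den s w (TTens A A') b" "q \<le> Dist C a b"
    using assms(1) by (auto simp: near_def)
  obtain a' b' where 2: "den (Node (Node t (Leaf x A)) (Leaf y A')) v' D a'" "den (Node (Node t (Leaf x A)) (Leaf y A')) w' D b'"
    "r \<le> Dist C a' b'"
    using assms(2) by (auto simp: near_def)
  let ?T = "treeI t" and ?A = "tyI C A" and ?A' = "tyI C A'"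
  note v = den_valid[OF 2(1)] den_valid[OF 1(1)]
  let ?c = "assoc' ?T ?A ?A' \<cdot> Sym C (?A \<otimes>\<^sub>o ?A') ?T"
  have c: "?c \<in> hom C ((?A \<otimes>\<^sub>o ?A') \<otimes>\<^sub>o ?T) ((?T \<otimes>\<^sub>o ?A) \<otimes>\<^sub>o ?A')" using v by (simp add: hom_def)
  have i: "Id C ?T \<in> hom C ?T ?T" using v by (simp add: hom_def)
  have h: "a \<in> hom C (treeI s) (?A \<otimes>\<^sub>o ?A')" "b \<in> hom C (treeI s) (?A \<otimes>\<^sub>o ?A')"
    "a' \<in> hom C ((?T \<otimes>\<^sub>o ?A) \<otimes>\<^sub>o ?A') (tyI C D)" "b' \<in> hom C ((?T \<otimes>\<^sub>o ?A) \<otimes>\<^sub>o ?A') (tyI C D)"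
    using den_hom[OF 1(1)] den_hom[OF 1(2)] den_hom[OF 2(1)] den_hom[OF 2(2)] by simp_all
  have ct: "?c \<cdot> (e \<rhd> ?T) \<in> hom C (treeI s \<otimes>\<^sub>o ?T) ((?T \<otimes>\<^sub>o ?A) \<otimes>\<^sub>o ?A')" if "e \<in> hom C (treeI s) (?A \<otimes>\<^sub>o ?A')" for e
    using Comp_hom[OF TensM_hom[OF that i] c] .
  \<comment> \<open>The factor 1 makes room for the distance of \<open>Id C ?T\<close> to
    itself.\<close>
  have "q \<le> Dist C a b * 1" using 1 by simp
  also have "\<dots> \<le> Dist C a b * Dist C (Id C ?T) (Id C ?T)" using v by (intro quantale_mult Dist_refl) simp_all
  also have "\<dots> \<le> Dist C (a \<rhd> ?T) (b \<rhd> ?T)" using Dist_TensM[OF h(1,2) i i] .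
  also have "\<dots> \<le> Dist C (?c \<cdot> (a \<rhd> ?T)) (?c \<cdot> (b \<rhd> ?T))"
    using Dist_Comp_left[OF TensM_hom[OF h(1) i] TensM_hom[OF h(2) i] c] .
  \<comment> \<open>The body is composed on the outside, so its label comes first; commutativity
    restores the order at the end.\<close>
  finally have "r * q \<le> Dist C a' b' * Dist C (?c \<cdot> (a \<rhd> ?T)) (?c \<cdot> (b \<rhd> ?T))"
    using 2(3) quantale_mult by blast
  also have "\<dots> \<le> Dist C (a' \<cdot> ?c \<cdot> (a \<rhd> ?T)) (b' \<cdot> ?c \<cdot> (b \<rhd> ?T))"
    using Dist_Comp[OF ct[OF h(1)] ct[OF h(2)] h(3,4)] .
  finally have "q * r \<le> Dist C (pm_mor ?T ?A ?A' a a')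
      (pm_mor ?T ?A ?A' b b')"
    using h v by (simp add: mult.commute hom_def)
  then show ?thesis
    using den_pm_intro[OF 1(1) 2(1) d] den_pm_intro[OF 1(2) 2(2) d] unfolding near_def by blast
qed

text \<open>Substitution is composition with a whiskered morphism, and both composition and tensor
  are V-functors on homs.\<close>

lemma near_subst:
  assumes "near q (Node s (Leaf x A)) v w A'" "near r t v' w' A"
    and d: "linear (Node s t)"
  shows "near (q * r) (Node s t) (v[x ::= v']) (w[x ::= w']) A'"
proof -
  obtain a b where 1: "den (Node s (Leaf x A)) v A' a" "den (Node s (Leaf x A)) w A' b" "q \<le> Dist C a b"
    using assms(1) by (auto simp: near_def)
  obtain a' b' where 2: "den t v' A a'" "den t w' A b'" "r \<le> Dist C a' b'"
    using assms(2) by (auto simp: near_def)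
  let ?S = "treeI s"
  have i: "Id C ?S \<in> hom C ?S ?S" using den_valid[OF 1(1)] by (simp add: hom_def)
  have h: "a \<in> hom C (?S \<otimes>\<^sub>o tyI C A) (tyI C A')" "b \<in> hom C (?S \<otimes>\<^sub>o tyI C A) (tyI C A')"
    using den_hom[OF 1(1)] den_hom[OF 1(2)] by simp_all
  note t = TensM_hom[OF i den_hom[OF 2(1)]] TensM_hom[OF i den_hom[OF 2(2)]]
  have "r \<le> 1 * Dist C a' b'" using 2 by simp
  also have "\<dots> \<le> Dist C (Id C ?S) (Id C ?S) * Dist C a' b'"
    using den_valid[OF 1(1)] by (intro quantale_mult Dist_refl) simp_all
  also have "\<dots> \<le> Dist C (?S \<lhd> a') (?S \<lhd> b')"
    using Dist_TensM[OF i i den_hom[OF 2(1)] den_hom[OF 2(2)]] .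
  finally have "q * r \<le> Dist C a b * Dist C (?S \<lhd> a') (?S \<lhd> b')"
    using 1(3) quantale_mult by blast
  also have "\<dots> \<le> Dist C (a \<cdot> (?S \<lhd> a')) (b \<cdot> (?S \<lhd> b'))"
    using Dist_Comp[OF t h] .
  finally show ?thesis
    using den_subst_last[OF 1(1) 2(1) d] den_subst_last[OF 1(2) 2(2) d] unfolding near_def by blast
qed

lemma near_Op:
  assumes "f \<in> Ops (lang_signature C)" "lang_args C f = [A]" "near q s v w A"
  shows "near q s (Op f [v]) (Op f [w]) (lang_res C f)"
proof -
  obtain a b where h: "den s v A a" "den s w A b" "q \<le> Dist C a b"
    using assms(3) by (auto simp: near_def)
  then have "q \<le> Dist C (opI C f \<cdot> a) (opI C f \<cdot> b)"
    using Dist_Comp_left[OF den_hom[OF h(1)] den_hom[OF h(2)] opI_arr(1)[OF assms(1,2)]] order_trans by blast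
  then show ?thesis using den_op[OF assms(1,2) h(1)] den_op[OF assms(1,2) h(2)] unfolding near_def by blast
qed

text \<open>Serves the Archimedean rule and finite joins alike: the distance of two fixed
  denotations is an upper bound of \<open>R\<close>. The denotations are given on their own since
  \<open>R\<close> may be empty.\<close>

lemma near_Sup:
  assumes "den s v A m" "den s w A n" "\<And>r. r \<in> R \<Longrightarrow> near r s v w A" "q \<le> Sup R"
  shows "near q s v w A"
proof -
  have "r \<le> Dist C m n" if "r \<in> R" for r
    using assms(3)[OF that] den_unique assms(1,2) unfolding near_def by blast
  then have "Sup R \<le> Dist C m n" by (rule Sup_least)
  then show ?thesis using assms(1,2,4) order_trans unfolding near_def by blast
qed

text \<open>\<open>near\<close> asserts the existence of both denotations too, so the induction
  carries typability along.\<close>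

theorem soundness:
  assumes "quantale_basis B" "derivable B (Lang B C) \<Gamma> v q w A"
  shows "near q (ctx_tree \<Gamma>) v w A"
  using assms(2)
proof (induction rule: derivable.induct)
  case (d_ax \<Gamma> v q w A)
  then obtain m n where "interp C \<Gamma> v A m" "interp C \<Gamma> w A n" "q \<le> Dist C m n" by (auto simp: Lang_def)
  then show ?case using interp_den unfolding near_def by blast
next
  case (d_conv \<Gamma> v w A)
  then show ?case using conv_den near_refl unfolding same_den_def by blast
next
  case (d_conv_sym \<Gamma> v w A)
  then show ?case using conv_den near_refl unfolding same_den_def by blast
next
  case (d_refl \<Gamma> v A)
  then obtain m where "den (ctx_tree \<Gamma>) v A m" using typed_den by blast
  then show ?case using near_refl by blast
next
  case (d_trans \<Gamma> v q w A r u)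
  then show ?case using near_trans by blast
next
  case (d_weak \<Gamma> v q w A r)
  then show ?case unfolding near_def by (meson order_trans)
next
  case (d_arch q \<Gamma> v A w)
  obtain m n where mn: "den (ctx_tree \<Gamma>) v A m" "den (ctx_tree \<Gamma>) w A n"
    using typed_den[OF d_arch.hyps(2)] typed_den[OF d_arch.hyps(3)] by blast
  show ?case
  proof (rule near_Sup[OF mn, where R = "B \<inter> {r. r \<lless> q}"])
    \<comment> \<open>\<open>q\<close> is the join of the basis elements way below it, and these are
      the labels that the premises provide.\<close>
    show "q \<le> Sup (B \<inter> {r. r \<lless> q})"
      using assms(1) unfolding quantale_basis_def by (metis order_refl)
  qed (use d_arch.IH in blast)
next
  case (d_join Q \<Gamma> v A w)
  obtain m n where mn: "den (ctx_tree \<Gamma>) v A m" "den (ctx_tree \<Gamma>) w A n"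
    using typed_den[OF d_join.hyps(3)] typed_den[OF d_join.hyps(4)] by blast
  show ?case by (rule near_Sup[OF mn, where R = Q]) (use d_join.IH in blast, rule order_refl)
next
  case (d_op f vs ws qs \<Gamma>s E)
  obtain A where A: "lang_args C f = [A]" using lang_args_single by blast
  obtain v w q \<Gamma> where e: "vs = [v]" "ws = [w]" "qs = [q]" "\<Gamma>s = [\<Gamma>]"
    using d_op.hyps(2-5) A by (auto simp: length_Suc_conv)
  then have "near q (ctx_tree \<Gamma>) v w A" using d_op.IH A by simp
  then show ?case using near_Op[OF _ A] d_op.hyps(1,6) e by simp
next
  case (d_to \<Gamma> v q w \<Delta> v' r w' A E)
  let ?t = "Node (ctx_tree \<Gamma>) (ctx_tree \<Delta>)"
  have m: "mset (leaves ?t) = mset E" using mset_Sf[OF d_to.hyps(3)] by simp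
  show ?case by (rule near_ctx[OF near_ToStar[OF d_to.IH distinct_leaves[OF m d_to.hyps(4)]] m])
next
  case (d_tensor \<Gamma> v q w A \<Delta> v' r w' A' E)
  let ?t = "Node (ctx_tree \<Gamma>) (ctx_tree \<Delta>)"
  have m: "mset (leaves ?t) = mset E" using mset_Sf[OF d_tensor.hyps(3)] by simp
  show ?case by (rule near_ctx[OF near_Tensor[OF d_tensor.IH distinct_leaves[OF m d_tensor.hyps(4)]] m])
next
  case (d_pm \<Gamma> v q w A A' y x \<Delta> v' r w' D E)
  let ?t = "Node (ctx_tree \<Gamma>) (ctx_tree \<Delta>)"
  have m: "mset (leaves ?t) = mset E" using mset_Sf[OF d_pm.hyps(3)] by simp
  have b: "near r (Node (Node (ctx_tree \<Delta>) (Leaf x A)) (Leaf y A')) v' w' D"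
    by (rule near_tree[OF d_pm.IH(2)]) simp
  show ?case by (rule near_ctx[OF near_pm[OF d_pm.IH(1) b distinct_leaves[OF m d_pm.hyps(4)]] m])
next
  case (d_lam x A \<Gamma> v q w A')
  have b: "near q (Node (ctx_tree \<Gamma>) (Leaf x A)) v w A'"
    by (rule near_tree[OF d_lam.IH]) simp
  then show ?case by (rule near_lam)
next
  case (d_app \<Gamma> v q w A A' \<Delta> v' r w' E)
  let ?t = "Node (ctx_tree \<Gamma>) (ctx_tree \<Delta>)"
  have m: "mset (leaves ?t) = mset E" using mset_Sf[OF d_app.hyps(3)] by simp
  show ?case by (rule near_ctx[OF near_App[OF d_app.IH distinct_leaves[OF m d_app.hyps(4)]] m])
next
  case (d_subst x A \<Gamma> v q w A' \<Delta> v' r w')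
  let ?t = "Node (ctx_tree \<Gamma>) (ctx_tree \<Delta>)"
  have m: "mset (leaves ?t) = mset (\<Delta> @ \<Gamma>)" by simp
  have b: "near q (Node (ctx_tree \<Gamma>) (Leaf x A)) v w A'"
    by (rule near_tree[OF d_subst.IH(1)]) simp
  from near_subst[OF b d_subst.IH(2) distinct_leaves[OF m d_subst.hyps(3)]] show ?case
    by (rule near_tree) simp
next
  case (d_perm \<Gamma> v q w A \<Delta>)
  show ?case by (rule near_tree[OF d_perm.IH]) (simp add: d_perm.hyps)
qed

end

section \<open>The equivalence\<close>

text \<open>\<open>D\<close> is not assumed to be a category: its axioms are pulled back along
  \<open>Fm\<close>, which is bijective and distance-preserving on homs and respects identities and
  composition. \<open>Go\<close> is a strict section of \<open>Fo\<close> on objects, so the counit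
  can be the identity.\<close>

lemma enriched_equivalentI:
  fixes C :: "('o, 'm, 'v::continuous_quantale, 'z) vcat_scheme" and D :: "('p, 'n, 'v, 'y) vcat_scheme"
  assumes "enriched_category C"
    and FoOb: "\<And>A. A \<in> Ob D \<Longrightarrow> Fo A \<in> Ob C"
    and dc: "\<And>f. f \<in> Arr D \<Longrightarrow> Dom D f \<in> Ob D \<and> Cod D f \<in> Ob D"
    and bij: "\<And>A A'. A \<in> Ob D \<Longrightarrow> A' \<in> Ob D \<Longrightarrow> bij_betw Fm (hom D A A') (hom C (Fo A) (Fo A'))"
    and dist: "\<And>A A' f g. f \<in> hom D A A' \<Longrightarrow> g \<in> hom D A A' \<Longrightarrow> Dist D f g = Dist C (Fm f) (Fm g)"
    and ident: "\<And>A. A \<in> Ob D \<Longrightarrow> Id D A \<in> hom D A A \<and> Fm (Id D A) = Id C (Fo A)"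
    and comp: "\<And>A A' A'' f g. f \<in> hom D A A' \<Longrightarrow> g \<in> hom D A' A'' \<Longrightarrow>
      Comp D g f \<in> hom D A A'' \<and> Fm (Comp D g f) = Comp C (Fm g) (Fm f)"
    and GoOb: "\<And>X. X \<in> Ob C \<Longrightarrow> Go X \<in> Ob D \<and> Fo (Go X) = X"
  shows "enriched_equivalent D C"
proof -
  interpret C: enriched_category C by fact
  have hD: "A \<in> Ob D \<and> A' \<in> Ob D" if "f \<in> hom D A A'" for f A A'
    using dc that by (auto simp: hom_def)
  have Fhom: "Fm f \<in> hom C (Fo A) (Fo A')" if "f \<in> hom D A A'" for f A A'
    using bij[of A A'] hD[OF that] that by (auto simp: bij_betw_def)
  have inj: "f = g" if "f \<in> hom D A A'" "g \<in> hom D A A'" "Fm f = Fm g" for f g A A'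
    using bij[of A A'] hD[OF that(1)] that by (auto simp: bij_betw_def dest: inj_onD)
  define L where "L = (\<lambda>A A' g. inv_into (hom D A A') Fm g)"
  have L: "L A A' g \<in> hom D A A'" "Fm (L A A' g) = g"
    if "A \<in> Ob D" "A' \<in> Ob D" "g \<in> hom C (Fo A) (Fo A')" for A A' g
    using bij[OF that(1,2)] that(3) unfolding L_def bij_betw_def
    by (auto intro: inv_into_into f_inv_into_f)
  have LF: "L A A' (Fm f) = f" if "f \<in> hom D A A'" for A A' f
    using inj[OF L(1) that L(2)] hD[OF that] Fhom[OF that] by blast
  \<comment> \<open>Equations in \<open>D\<close> are tested after the injective \<open>Fm\<close>,
    inequalities by comparing distances in \<open>C\<close>.\<close>
  interpret D: enriched_category D
  proof
    fix f X Y assume f: "f \<in> hom D X Y"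
    then have X: "X \<in> Ob D" "Y \<in> Ob D" using hD by auto
    show "Comp D f (Id D X) = f"
      using comp[OF conjunct1[OF ident[OF X(1)]] f] ident[OF X(1)] C.Comp_Id[OF Fhom[OF f]] by (intro inj[OF _ f]) auto
    show "Comp D (Id D Y) f = f"
      using comp[OF f conjunct1[OF ident[OF X(2)]]] ident[OF X(2)] C.Id_Comp[OF Fhom[OF f]] by (intro inj[OF _ f]) auto
  next
    fix f g h W X Y Z assume f: "f \<in> hom D W X" and g: "g \<in> hom D X Y" and h: "h \<in> hom D Y Z"
    note gf = comp[OF f g] and hg = comp[OF g h]
    note 1 = comp[OF f conjunct1[OF hg]] and 2 = comp[OF conjunct1[OF gf] h]
    show "Comp D (Comp D h g) f = Comp D h (Comp D g f)"
      using 1 2 gf hg C.Comp_assoc[OF Fhom[OF f] Fhom[OF g] Fhom[OF h]] by (intro inj[where A = W and A' = Z]) auto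
  next
    fix X Y assume X: "X \<in> Ob D" "Y \<in> Ob D"
    show "vcategory (hom D X Y) (Dist D)"
      using C.hom_vcategory[OF FoOb[OF X(1)] FoOb[OF X(2)]] Fhom[of _ X Y] dist[of _ X Y]
      unfolding vcategory_def by simp
    show "separated (hom D X Y) (Dist D)"
      using C.hom_separated[OF FoOb[OF X(1)] FoOb[OF X(2)]] Fhom[of _ X Y] dist[of _ X Y] inj[of _ X Y]
      unfolding separated_def by metis
  next
    fix X Y Z assume X: "X \<in> Ob D" "Y \<in> Ob D" "Z \<in> Ob D"
    show "vfunctor (hom D Y Z \<times> hom D X Y) (vtensor (Dist D) (Dist D)) (hom D X Z) (Dist D) (\<lambda>(g, f). Comp D g f)"
      unfolding vfunctor_def
    proof (intro conjI ballI)
      show "(\<lambda>(g, f). Comp D g f) \<in> hom D Y Z \<times> hom D X Y \<rightarrow> hom D X Z" using comp by auto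
      fix p p' assume "p \<in> hom D Y Z \<times> hom D X Y" "p' \<in> hom D Y Z \<times> hom D X Y"
      then obtain g f g' f' where p: "p = (g, f)" "p' = (g', f')" "g \<in> hom D Y Z" "f \<in> hom D X Y"
        "g' \<in> hom D Y Z" "f' \<in> hom D X Y" by auto
      have "Dist C (Fm g) (Fm g') * Dist C (Fm f) (Fm f') \<le> Dist C (Comp C (Fm g) (Fm f)) (Comp C (Fm g') (Fm f'))"
        using C.Dist_Comp[OF Fhom[OF p(4)] Fhom[OF p(6)] Fhom[OF p(3)] Fhom[OF p(5)]] .
      then show "vtensor (Dist D) (Dist D) p p' \<le> Dist D ((\<lambda>(g, f). Comp D g f) p) ((\<lambda>(g, f). Comp D g f) p')"
        using comp[OF p(4,3)] comp[OF p(6,5)] dist[OF p(3,5)] dist[OF p(4,6)]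
          dist[OF conjunct1[OF comp[OF p(4,3)]] conjunct1[OF comp[OF p(6,5)]]]
        by (simp add: p vtensor_def)
    qed
  qed (use dc ident in auto)
  have F: "enriched_functor D C Fo Fm"
    unfolding enriched_functor_def vfunctor_def
    using D.enriched_category_axioms C.enriched_category_axioms FoOb Fhom dist ident comp by auto
  define Gm where "Gm = (\<lambda>g. L (Go (Dom C g)) (Go (Cod C g)) g)"
  have G: "Gm g \<in> hom D (Go X) (Go Y)" "Fm (Gm g) = g" if "g \<in> hom C X Y" for g X Y
  proof -
    have "X \<in> Ob C" "Y \<in> Ob C" using C.hom_Ob[OF that] by auto
    then show "Gm g \<in> hom D (Go X) (Go Y)" "Fm (Gm g) = g"
      using L[of "Go X" "Go Y" g] that GoOb unfolding Gm_def by (auto simp: hom_def)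
  qed
  have "enriched_functor C D Go Gm"
    unfolding enriched_functor_def vfunctor_def
  proof (intro conjI ballI)
    fix X assume X: "X \<in> Ob C"
    show "Gm (Id C X) = Id D (Go X)"
      using G[OF C.Id_hom[OF X]] ident[of "Go X"] GoOb[OF X] by (intro inj[where A = "Go X" and A' = "Go X"]) auto
    fix Y assume Y: "Y \<in> Ob C"
    show "Gm \<in> hom C X Y \<rightarrow> hom D (Go X) (Go Y)" using G by blast
    show "Dist C f g \<le> Dist D (Gm f) (Gm g)" if "f \<in> hom C X Y" "g \<in> hom C X Y" for f g
      using dist[OF G(1)[OF that(1)] G(1)[OF that(2)]] G(2)[OF that(1)] G(2)[OF that(2)] by simp
    show "Gm (Comp C g f) = Comp D (Gm g) (Gm f)" if "f \<in> hom C X Y" "g \<in> hom C Y Z" for f g Z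
      using G[OF C.Comp_hom[OF that]] comp[OF G(1)[OF that(1)] G(1)[OF that(2)]] G(2)[OF that(1)] G(2)[OF that(2)]
      by (intro inj[where A = "Go X" and A' = "Go Z"]) auto
  qed (use D.enriched_category_axioms C.enriched_category_axioms GoOb in auto)
  \<comment> \<open>Since \<open>Fo (Go (Fo A)) = Fo A\<close>, the identity of \<open>Fo A\<close>
    lifts to a morphism from \<open>A\<close> to \<open>Go (Fo A)\<close>.\<close>
  moreover define unit where "unit = (\<lambda>A. L A (Go (Fo A)) (Id C (Fo A)))"
  have GF: "Go (Fo A) \<in> Ob D" "Fo (Go (Fo A)) = Fo A" if "A \<in> Ob D" for A
    using GoOb FoOb that by auto
  have unit: "unit A \<in> hom D A (Go (Fo A))" "Fm (unit A) = Id C (Fo A)" if "A \<in> Ob D" for A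
    using L[of A "Go (Fo A)" "Id C (Fo A)"] GF[OF that] that C.Id_hom[OF FoOb[OF that]] unfolding unit_def by auto
  have "natural_iso D D (\<lambda>X. X) (\<lambda>f. f) (Go \<circ> Fo) (Gm \<circ> Fm) unit"
    unfolding natural_iso_def
  proof (intro conjI ballI)
    fix A assume A: "A \<in> Ob D"
    let ?i = "Id C (Fo A)" and ?A = "Go (Fo A)"
    note Ci = C.Comp_Id[OF C.Id_hom[OF FoOb[OF A]]]
    have g: "L ?A A ?i \<in> hom D ?A A" "Fm (L ?A A ?i) = ?i"
      using L[of ?A A ?i] GF[OF A] A C.Id_hom[OF FoOb[OF A]] by auto
    have "Comp D (L ?A A ?i) (unit A) = Id D A"
      using comp[OF unit(1)[OF A] g(1)] unit(2)[OF A] g(2) ident[OF A] Ci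
      by (intro inj[where A = A and A' = A]) auto
    moreover have "Comp D (unit A) (L ?A A ?i) = Id D ?A"
      using comp[OF g(1) unit(1)[OF A]] unit(2)[OF A] g(2) ident[OF GF(1)[OF A]] GF(2)[OF A] Ci
      by (intro inj[where A = ?A and A' = ?A]) auto
    ultimately show "iso_in D A ((Go \<circ> Fo) A) (unit A)"
      using unit(1)[OF A] g(1) by (intro D.iso_inI[where g = "L ?A A ?i"]) auto
    fix A' f assume A': "A' \<in> Ob D" and f: "f \<in> hom D A A'"
    have GFf: "Gm (Fm f) \<in> hom D (Go (Fo A)) (Go (Fo A'))" "Fm (Gm (Fm f)) = Fm f" using G Fhom[OF f] by auto
    show "Comp D ((Gm \<circ> Fm) f) (unit A) = Comp D (unit A') f"
      using comp[OF unit(1)[OF A] GFf(1)] comp[OF f unit(1)[OF A']] unit(2)[OF A] unit(2)[OF A'] GFf(2)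
        C.Comp_Id[OF Fhom[OF f]] C.Id_Comp[OF Fhom[OF f]]
      by (intro inj[where A = A and A' = "Go (Fo A')"]) auto
  qed
  moreover have "natural_iso C C (Fo \<circ> Go) (Fm \<circ> Gm) (\<lambda>X. X) (\<lambda>f. f) (Id C)"
    unfolding natural_iso_def
    using GoOb C.iso_Id G(2) C.Comp_Id C.Id_Comp by auto
  ultimately show ?thesis using F unfolding enriched_equivalent_def by blast
qed

section \<open>Hom-objects of the syntactic category of the internal language\<close>

locale quantale_autonomous_category = autonomous_category C
  for C :: "('o, 'm, 'v::continuous_quantale, 'z) autcat_scheme" (structure) +
  fixes B :: "'v set"
  assumes basis: "quantale_basis B"
begin

abbreviation T :: "('o, ('o, 'm) lang_op, 'v) theory_data" where
  "T \<equiv> Lang B C"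

definition denote :: "'o ty \<Rightarrow> 'o ty \<Rightarrow> ('o, ('o, 'm) lang_op) tm \<Rightarrow> 'm" where
  "denote A A' v = (THE m. den (Leaf x0 A) v A' m)"

lemma denote_eq: "den (Leaf x0 A) v A' m \<Longrightarrow> denote A A' v = m"
  unfolding denote_def using den_unique by blast

lemma terms_iff: "v \<in> terms T A A' \<longleftrightarrow> (\<exists>m. den (Leaf x0 A) v A' m)"
  using typed_den[of B "[(x0, A)]" v A'] typed_Lang[OF den_typed[of "Leaf x0 A" v A' _ "[(x0, A)]"], of _ B]
  by (auto simp: terms_def)

lemma den_denote: "v \<in> terms T A A' \<Longrightarrow> den (Leaf x0 A) v A' (denote A A' v)"
  using terms_iff denote_eq by metis

lemma denote_hom: "v \<in> terms T A A' \<Longrightarrow> denote A A' v \<in> hom C (tyI C A) (tyI C A')"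
  using den_hom[OF den_denote] by simp

text \<open>Soundness gives one inequality. For the other, the distance itself need not be a label,
  as labels lie in \<open>B\<close>; but the basis elements way below it are labels of axioms, and
  their join is the distance.\<close>

lemma tdist_eq:
  assumes v: "v \<in> terms T A A'" and w: "w \<in> terms T A A'"
  shows "tdist B T A A' v w = Dist C (denote A A' v) (denote A A' w)" (is "_ = ?d")
proof (rule antisym)
  show "tdist B T A A' v w \<le> ?d"
    unfolding tdist_def
  proof (rule Sup_least, safe)
    fix q assume "derivable B T [(x0, A)] v q w A'"
    then show "q \<le> ?d"
      using soundness[OF basis] denote_eq unfolding near_def by fastforce
  qed
  have "derivable B T [(x0, A)] v q w A'" if q: "q \<in> B" "q \<lless> ?d" for q
  proof (rule d_ax)
    obtain m n where mn: "interp C [(x0, A)] v A' m" "interp C [(x0, A)] w A' n"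
      using v w typed_interp unfolding terms_def by blast
    then have "m = denote A A' v" "n = denote A A' w" using interp_den denote_eq by fastforce+
    then show "([(x0, A)], v, q, w, A') \<in> Ax T"
      using mn q way_below_le[OF q(2)] unfolding Lang_def by auto
  qed
  then have "B \<inter> {q. q \<lless> ?d} \<subseteq> {q. derivable B T [(x0, A)] v q w A'}" by blast
  then have "Sup (B \<inter> {q. q \<lless> ?d}) \<le> tdist B T A A' v w" unfolding tdist_def by (rule Sup_subset_mono)
  then show "?d \<le> tdist B T A A' v w" using basis unfolding quantale_basis_def by metis
qed

text \<open>Classes are the fibres of denotation because the homs of \<open>C\<close> are
  separated.\<close>

lemma tclass_eq:
  assumes v: "v \<in> terms T A A'"
  shows "tclass B T A A' v = {w \<in> terms T A A'. denote A A' w = denote A A' v}"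
proof -
  have "1 \<le> tdist B T A A' v w \<and> 1 \<le> tdist B T A A' w v \<longleftrightarrow> denote A A' w = denote A A' v"
    if w: "w \<in> terms T A A'" for w
    using Dist_separated[OF denote_hom[OF v] denote_hom[OF w]] Dist_refl[OF homD(1)[OF denote_hom[OF v]]]
    unfolding tdist_eq[OF v w] tdist_eq[OF w v] by auto
  then show ?thesis unfolding tclass_def by blast
qed

lemma rep_tclass:
  assumes v: "v \<in> terms T A A'"
  shows "rep (tclass B T A A' v) \<in> terms T A A'" "denote A A' (rep (tclass B T A A' v)) = denote A A' v"
proof -
  have "v \<in> tclass B T A A' v" using v by (simp add: tclass_eq)
  then have "rep (tclass B T A A' v) \<in> tclass B T A A' v" unfolding rep_def by (rule someI)
  then show "rep (tclass B T A A' v) \<in> terms T A A'" "denote A A' (rep (tclass B T A A' v)) = denote A A' v"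
    using v by (auto simp: tclass_eq)
qed

lemma tclass_cong: "v \<in> terms T A A' \<Longrightarrow> w \<in> terms T A A' \<Longrightarrow> denote A A' v = denote A A' w \<Longrightarrow>
    tclass B T A A' v = tclass B T A A' w"
  by (simp add: tclass_eq)

lemma hom_Syn: "hom (Syn B T) A A' =
    {(A, tclass B T A A' v, A') | v. A \<in> types T \<and> A' \<in> types T \<and> v \<in> terms T A A'}"
  by (auto simp: hom_def Syn_def)

lemma hom_SynE:
  assumes "f \<in> hom (Syn B T) A A'"
  obtains v where "v \<in> terms T A A'" "f = (A, tclass B T A A' v, A')" "A \<in> types T" "A' \<in> types T"
  using assms hom_Syn by auto

lemma hom_SynI: "A \<in> types T \<Longrightarrow> A' \<in> types T \<Longrightarrow> v \<in> terms T A A' \<Longrightarrow>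
    (A, tclass B T A A' v, A') \<in> hom (Syn B T) A A'"
  using hom_Syn by auto

definition Syn_map :: "'o ty \<times> ('o, ('o, 'm) lang_op) tm set \<times> 'o ty \<Rightarrow> 'm" where
  "Syn_map = (\<lambda>(A, c, A'). denote A A' (rep c))"

lemma Syn_map_tclass: "v \<in> terms T A A' \<Longrightarrow> Syn_map (A, tclass B T A A' v, A') = denote A A' v"
  by (simp add: Syn_map_def rep_tclass)

lemma denote_surj:
  assumes "g \<in> hom C (tyI C A) (tyI C A')" "A \<in> types T" "A' \<in> types T"
  obtains v where "v \<in> terms T A A'" "denote A A' v = g"
proof -
  have A: "is_type A" "is_type A'" using assms by auto
  \<comment> \<open>\<open>ToObj\<close> and \<open>FromObj\<close> denote identities, so only
    \<open>g\<close> remains.\<close>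
  let ?v = "Op (FromObj A') [Op (Mor g) [Op (ToObj A) [FV x0]]]"
  have "den (Leaf x0 A) (Op (ToObj A) [FV x0]) (lang_res C (ToObj A)) (opI C (ToObj A) \<cdot> Id C (tyI C A))"
    by (rule den_op[OF _ _ den_var]) (use A in \<open>auto simp: lang_signature_def\<close>)
  then have "den (Leaf x0 A) (Op (ToObj A) [FV x0]) (Ground (tyI C A)) (Id C (tyI C A))" using A by simp
  then have "den (Leaf x0 A) (Op (Mor g) [Op (ToObj A) [FV x0]]) (lang_res C (Mor g)) (opI C (Mor g) \<cdot> Id C (tyI C A))"
    by (intro den_op) (use assms in \<open>auto simp: lang_signature_def hom_def\<close>)
  then have "den (Leaf x0 A) (Op (Mor g) [Op (ToObj A) [FV x0]]) (Ground (tyI C A')) g"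
    using assms by (simp add: hom_def)
  then have "den (Leaf x0 A) ?v (lang_res C (FromObj A')) (opI C (FromObj A') \<cdot> g)"
    by (intro den_op) (use A in \<open>auto simp: lang_signature_def hom_def\<close>)
  then have d: "den (Leaf x0 A) ?v A' g"
    using assms A by (simp add: hom_def)
  then show ?thesis using that[of ?v] denote_eq[OF d] terms_iff by blast
qed

text \<open>The substituted term may reuse the name \<open>x0\<close>: \<open>den_subst\<close> asks
  only that the resulting tree be linear.\<close>

lemma den_subst_single:
  assumes "den (Leaf x0 A) v A' m" "den (Leaf x0 A') w A'' n"
  shows "den (Leaf x0 A) (w[x0 ::= v]) A'' (n \<cdot> m)"
proof -
  have "den (bind (\<lambda>_ _. Leaf x0 A) (Leaf x0 A')) (subst (FV(x0 := v)) w) A'' (n \<cdot> bindM (\<lambda>_ _. m) (Leaf x0 A'))"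
    using den_lc[OF assms(1)] assms(1) by (intro den_subst[OF assms(2)]) auto
  then show ?thesis by simp
qed

text \<open>\<open>Ground\<close> is a strict section of \<open>tyI C\<close>, which provides the
  object part of the inverse functor.\<close>

theorem Syn_equivalent: "enriched_equivalent (Syn B T) C"
proof (rule enriched_equivalentI[where Fo = "tyI C" and Fm = Syn_map and Go = Ground])
  have Ob: "Ob (Syn B T) = types T" by (simp add: Syn_def)
  show "enriched_category C" by (rule enriched_category_axioms)
  show "tyI C A \<in> Ob C" if "A \<in> Ob (Syn B T)" for A using that by (simp add: Ob)
  show "Dom (Syn B T) f \<in> Ob (Syn B T) \<and> Cod (Syn B T) f \<in> Ob (Syn B T)" if "f \<in> Arr (Syn B T)" for f
    using that by (auto simp: Syn_def)
  show "bij_betw Syn_map (hom (Syn B T) A A') (hom C (tyI C A) (tyI C A'))"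
    if "A \<in> Ob (Syn B T)" "A' \<in> Ob (Syn B T)" for A A'
    unfolding bij_betw_def
  proof
    have t: "A \<in> types T" "A' \<in> types T" using that Ob by auto
    show "inj_on Syn_map (hom (Syn B T) A A')"
    proof (rule inj_onI)
      fix f g assume f: "f \<in> hom (Syn B T) A A'" and g: "g \<in> hom (Syn B T) A A'" and e: "Syn_map f = Syn_map g"
      obtain v where "v \<in> terms T A A'" "f = (A, tclass B T A A' v, A')" using hom_SynE[OF f] by metis
      moreover obtain w where "w \<in> terms T A A'" "g = (A, tclass B T A A' w, A')" using hom_SynE[OF g] by metis
      ultimately show "f = g" using e tclass_cong[of v A A' w] by (simp add: Syn_map_tclass)
    qed
    show "Syn_map ` hom (Syn B T) A A' = hom C (tyI C A) (tyI C A')"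
    proof (intro equalityI subsetI)
      fix g assume "g \<in> Syn_map ` hom (Syn B T) A A'"
      then show "g \<in> hom C (tyI C A) (tyI C A')"
        by (auto elim!: hom_SynE simp: Syn_map_tclass denote_hom)
    next
      fix g assume "g \<in> hom C (tyI C A) (tyI C A')"
      then obtain v where v: "v \<in> terms T A A'" "denote A A' v = g"
        using denote_surj t by metis
      then have "g = Syn_map (A, tclass B T A A' v, A')" by (simp add: Syn_map_tclass)
      moreover have "(A, tclass B T A A' v, A') \<in> hom (Syn B T) A A'"
        using hom_SynI[OF t v(1)] .
      ultimately show "g \<in> Syn_map ` hom (Syn B T) A A'" by (rule image_eqI)
    qed
  qed
  show "Dist (Syn B T) f g = Dist C (Syn_map f) (Syn_map g)"
    if f: "f \<in> hom (Syn B T) A A'" and g: "g \<in> hom (Syn B T) A A'" for A A' f g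
  proof -
    obtain v where v: "v \<in> terms T A A'" "f = (A, tclass B T A A' v, A')" using hom_SynE[OF f] by metis
    obtain w where w: "w \<in> terms T A A'" "g = (A, tclass B T A A' w, A')" using hom_SynE[OF g] by metis
    show ?thesis using tdist_eq[OF rep_tclass(1)[OF v(1)] rep_tclass(1)[OF w(1)]] v(2) w(2)
      by (simp add: Syn_def Syn_map_def)
  qed
  show "Id (Syn B T) A \<in> hom (Syn B T) A A \<and> Syn_map (Id (Syn B T) A) = Id C (tyI C A)"
    if "A \<in> Ob (Syn B T)" for A
  proof -
    have d: "den (Leaf x0 A) (FV x0) A (Id C (tyI C A))" using that unfolding Ob by (intro den_var) simp
    then have t: "FV x0 \<in> terms T A A" using terms_iff by blast
    have "Id (Syn B T) A = (A, tclass B T A A (FV x0), A)" by (simp add: Syn_def)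
    then show ?thesis using hom_SynI[OF _ _ t] that denote_eq[OF d] t unfolding Ob by (simp add: Syn_map_tclass)
  qed
  show "Comp (Syn B T) g f \<in> hom (Syn B T) A A'' \<and> Syn_map (Comp (Syn B T) g f) = Comp C (Syn_map g) (Syn_map f)"
    if f: "f \<in> hom (Syn B T) A A'" and g: "g \<in> hom (Syn B T) A' A''" for A A' A'' f g
  proof -
    obtain v where v: "v \<in> terms T A A'" "f = (A, tclass B T A A' v, A')" "A \<in> types T"
      using hom_SynE[OF f] by metis
    obtain w where w: "w \<in> terms T A' A''" "g = (A', tclass B T A' A'' w, A'')" "A'' \<in> types T"
      using hom_SynE[OF g] by metis
    let ?v = "rep (tclass B T A A' v)" and ?w = "rep (tclass B T A' A'' w)"
    have d: "den (Leaf x0 A) (?w[x0 ::= ?v]) A'' (denote A' A'' w \<cdot> denote A A' v)"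
      using den_subst_single[OF den_denote[OF rep_tclass(1)[OF v(1)]] den_denote[OF rep_tclass(1)[OF w(1)]]]
      by (simp add: rep_tclass v w)
    then have t: "?w[x0 ::= ?v] \<in> terms T A A''" using terms_iff by blast
    have "Comp (Syn B T) g f = (A, tclass B T A A'' (?w[x0 ::= ?v]), A'')"
      using v(2) w(2) by (simp add: Syn_def)
    then show ?thesis
      using hom_SynI[OF v(3) w(3) t] Syn_map_tclass[OF t] denote_eq[OF d] v(1,2) w(1,2) by (simp add: Syn_map_tclass)
  qed
  show "Ground X \<in> Ob (Syn B T) \<and> tyI C (Ground X) = X" if "X \<in> Ob C" for X
    using that by (simp add: Ob)
qed

end

theorem theorem3p18:
  fixes B :: "'v::continuous_quantale set"
    and C :: "('o, 'm, 'v) autcat"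
  assumes "quantale_basis B"
    and "autonomous_category C"
  shows "enriched_equivalent (Syn B (Lang B C)) C"
proof -
  interpret autonomous_category C by fact
  interpret quantale_autonomous_category C B by unfold_locales fact
  show ?thesis by (rule Syn_equivalent)
qed

end
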